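(* For every integer $d\ge 1$ there is a constant $c_d>0$, depending only on $d$, such that for every positive integer $n$ and every positive integer $N$ with $N\ge c_d\,n^{\frac{2d(d+1)}{d+2}}$ there exists a spherical $n$-design on $S^d$ consisting of $N$ points.
   Context: $S^d$ is the unit sphere in $\mathbb{R}^{d+1}$ and $\mu_d$ is Lebesgue (surface) measure on $S^d$ normalized so that $\int_{S^d}d\mu_d(x)=1$. Points $x_1,\ldots,x_N\in S^d$ form a spherical $n$-design (consisting of $N$ points) if $$\int_{S^d}P(x)\,d\mu_d(x)=\frac1N\sum_{i=1}^N P(x_i)$$ for all algebraic polynomials $P$ in $d+1$ variables of total degree at most $n$. *)

theory Defs
  imports "HOL-Analysis.Analysis"
begin

text \<open>The ambient space \<open>real ^ 'n\<close> has dimension \<open>CARD('n) = d + 1\<close>, so that \<open>sphere 0 1\<close> is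
  \<open>S\<^sup>d\<close>.  Surface measure is given by the cone construction: \<open>A\<close> has measure
  \<open>d + 1\<close> times the volume of \<open>{r x. 0 < r < 1, x \<in> A}\<close> (see \<open>emeasure_surface_measure\<close>).
  The origin is removed from the ball because it has no radial projection.\<close>

definition surface_measure :: "(real ^ 'n::finite) measure" where
  "surface_measure = scale_measure (of_nat CARD('n))
     (distr (restrict_space lborel (ball 0 1 - {0})) (restrict_space borel (sphere 0 1))
       (\<lambda>x. x /\<^sub>R norm x))"

definition sphere_measure :: "(real ^ 'n::finite) measure" where
  "sphere_measure = scale_measure (1 / emeasure surface_measure (sphere (0 :: real ^ 'n) 1))
     surface_measure"

definition exponents_le :: "nat \<Rightarrow> ('n::finite \<Rightarrow> nat) set" where
  "exponents_le n = {\<alpha>. (\<Sum>i\<in>UNIV. \<alpha> i) \<le> n}"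

definition polynomials_le :: "nat \<Rightarrow> (real ^ 'n::finite \<Rightarrow> real) set" where
  "polynomials_le n =
     {P. \<exists>c. P = (\<lambda>x. \<Sum>\<alpha>\<in>exponents_le n. c \<alpha> * (\<Prod>i\<in>UNIV. (x $ i) ^ \<alpha> i))}"

text \<open>A design is an indexed family of points \<open>x 1, \<dots>, x N\<close>; repetitions are allowed and
  values of \<open>x\<close> outside \<open>{1..N}\<close> are irrelevant.\<close>

definition spherical_design :: "nat \<Rightarrow> nat \<Rightarrow> (nat \<Rightarrow> real ^ 'n::finite) \<Rightarrow> bool" where
  "spherical_design n N x \<longleftrightarrow>
     (\<forall>i\<in>{1..N}. x i \<in> sphere 0 1) \<and>
     (\<forall>P\<in>polynomials_le n.
        (LINT y|sphere_measure. P y) = (1 / real N) * (\<Sum>i=1..N. P (x i)))"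

lemma finite_exponents_le: "finite (exponents_le n :: ('n::finite \<Rightarrow> nat) set)"
proof (rule finite_subset)
  show "(exponents_le n :: ('n \<Rightarrow> nat) set) \<subseteq> UNIV \<rightarrow>\<^sub>E {..n}"
  proof
    fix a :: "'n \<Rightarrow> nat" assume "a \<in> exponents_le n"
    then have s: "(\<Sum>i\<in>UNIV. a i) \<le> n" by (simp add: exponents_le_def)
    have "a i \<le> n" for i
      using member_le_sum[of i UNIV a] s by simp
    then show "a \<in> UNIV \<rightarrow>\<^sub>E {..n}" by auto
  qed
  show "finite (UNIV \<rightarrow>\<^sub>E {..n} :: ('n \<Rightarrow> nat) set)" by (intro finite_PiE) auto
qed

lemma space_surface_measure: "space (surface_measure :: (real ^ 'n::finite) measure) = sphere 0 1"
  by (simp add: surface_measure_def space_scale_measure space_restrict_space)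

lemma sets_surface_measure:
  "sets (surface_measure :: (real ^ 'n::finite) measure) = sets (restrict_space borel (sphere 0 1))"
  by (simp add: surface_measure_def)

lemma space_sphere_measure: "space (sphere_measure :: (real ^ 'n::finite) measure) = sphere 0 1"
  by (simp add: sphere_measure_def space_scale_measure space_surface_measure)

lemma sets_sphere_measure:
  "sets (sphere_measure :: (real ^ 'n::finite) measure) = sets (restrict_space borel (sphere 0 1))"
  by (simp add: sphere_measure_def sets_surface_measure)

lemma radial_projection_measurable:
  "(\<lambda>x :: real ^ 'n::finite. x /\<^sub>R norm x)
     \<in> restrict_space lborel (ball 0 1 - {0}) \<rightarrow>\<^sub>M restrict_space borel (sphere 0 1)"
proof (rule measurable_restrict_space2)
  show "(\<lambda>x :: real ^ 'n. x /\<^sub>R norm x)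
      \<in> space (restrict_space lborel (ball 0 1 - {0})) \<rightarrow> sphere 0 1"
    by (auto simp: space_restrict_space)
  have "(\<lambda>x :: real ^ 'n. x /\<^sub>R norm x) \<in> lborel \<rightarrow>\<^sub>M borel" by measurable
  then show "(\<lambda>x :: real ^ 'n. x /\<^sub>R norm x)
      \<in> restrict_space lborel (ball 0 1 - {0}) \<rightarrow>\<^sub>M borel"
    by (rule measurable_restrict_space1)
qed

lemma emeasure_surface_measure:
  fixes A :: "(real ^ 'n::finite) set"
  assumes A: "A \<in> sets borel" "A \<subseteq> sphere 0 1"
  shows "emeasure surface_measure A =
    of_nat CARD('n) * emeasure lborel {r *\<^sub>R x |r x. 0 < r \<and> r < 1 \<and> x \<in> A}"
proof -
  have "A \<in> sets (restrict_space borel (sphere 0 1))"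
    using A by (subst sets_restrict_space_iff) auto
  moreover have "(\<lambda>x. x /\<^sub>R norm x) -` A \<inter> (ball 0 1 - {0}) =
      {r *\<^sub>R x |r x. 0 < r \<and> r < 1 \<and> x \<in> A}" (is "?L = ?R")
  proof
    show "?L \<subseteq> ?R"
    proof
      fix y assume y: "y \<in> ?L"
      then have "y = norm y *\<^sub>R (y /\<^sub>R norm y)" "0 < norm y" "norm y < 1" "y /\<^sub>R norm y \<in> A"
        by auto
      then show "y \<in> ?R" by blast
    qed
    show "?R \<subseteq> ?L"
      using A(2) by fastforce
  qed
  moreover have "emeasure (restrict_space lborel (ball 0 1 - {0})) ?R = emeasure lborel ?R"
    using A(2) by (intro emeasure_restrict_space) auto
  ultimately show ?thesis
    unfolding surface_measure_def
    by (simp add: emeasure_distr[OF radial_projection_measurable] space_restrict_space)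
qed

lemma emeasure_surface_measure_sphere:
  "emeasure surface_measure (sphere (0 :: real ^ 'n::finite) 1) =
    of_nat CARD('n) * emeasure lborel (ball (0 :: real ^ 'n) 1)"
proof -
  have "{r *\<^sub>R x |r x. 0 < r \<and> r < 1 \<and> x \<in> sphere (0 :: real ^ 'n) 1} = ball 0 1 - {0}" (is "?L = ?R")
  proof
    show "?L \<subseteq> ?R" by auto
    show "?R \<subseteq> ?L"
    proof
      fix y :: "real ^ 'n" assume "y \<in> ?R"
      then have "y = norm y *\<^sub>R (y /\<^sub>R norm y)" "0 < norm y" "norm y < 1" "y /\<^sub>R norm y \<in> sphere 0 1"
        by auto
      then show "y \<in> ?L" by blast
    qed
  qed
  moreover have "emeasure lborel (ball (0 :: real ^ 'n) 1 - {0}) = emeasure lborel (ball (0 :: real ^ 'n) 1)"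
    by (rule emeasure_Diff_null_set) auto
  ultimately show ?thesis
    by (subst emeasure_surface_measure) auto
qed

lemma emeasure_sphere_measure_space:
  "emeasure (sphere_measure :: (real ^ 'n::finite) measure) (space sphere_measure) = 1"
proof -
  have "emeasure lborel (ball (0 :: real ^ 'n) 1) \<noteq> 0"
    using less_imp_neq[OF unit_ball_vol_pos[of "real CARD('n)"], symmetric]
    by (simp add: emeasure_ball)
  moreover have "emeasure lborel (ball (0 :: real ^ 'n) 1) \<noteq> top"
    using emeasure_lborel_ball_finite[of "0 :: real ^ 'n" 1] by auto
  ultimately have "emeasure surface_measure (sphere (0 :: real ^ 'n) 1) \<noteq> 0"
    "emeasure surface_measure (sphere (0 :: real ^ 'n) 1) \<noteq> top"
    by (auto simp: emeasure_surface_measure_sphere ennreal_mult_eq_top_iff)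
  then show ?thesis
    by (simp add: space_sphere_measure) (simp add: sphere_measure_def ennreal_divide_times
       ennreal_divide_self top.not_eq_extremum flip: zero_less_iff_neq_zero)
qed

end

theory Submission
  imports Defs
begin

text \<open>
  Write \<open>mean_error N X Q\<close> for the difference of the average of \<open>Q\<close> over the points
  \<open>X 0, \<dots>, X (N - 1)\<close> and its integral over the sphere.  The points form a design if the mean error
  vanishes for all polynomials \<open>Q\<close> of degree at most \<open>n\<close>.  Polynomials are measured by their
  Dirichlet energy, the integral of the squared length of the tangential gradient \<open>tgrad Q\<close>.  The proof starts
  from a sample \<open>x0\<close> with small mean error and then moves the points to make the error vanish.

  The starting points (\<open>exists_points_small_mean_error\<close>) come from stratified sampling.  The
  surface measure is a sum of \<open>N\<close> measures of mass \<open>1 / N\<close>, each supported on a set of diameter of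
  order \<open>N powr (- 1 / d)\<close> (\<open>sphere_weight_partition\<close>).  One random point is drawn from each of
  them, and the variances of an energy-orthonormal system of polynomials are summed.  The sum is
  controlled by a Lipschitz bound for polynomials of energy \<open>1\<close>, whose square is of order \<open>n ^ d\<close>:
  this follows from Bernstein's inequality on great circles (\<open>bernstein_sphere\<close>), which also gives
  the comparison of the supremum norm with the \<open>L\<^sup>2\<close> norm (\<open>nikolskii\<close>) because caps of radius
  \<open>r\<close> have measure at least a constant times \<open>r ^ d\<close> (\<open>cap_measure_lower_bound\<close>).  Some choice of
  the points therefore satisfies \<open>(mean_error N x0 Q)\<^sup>2 \<le> \<eta> * energy Q Q\<close> for all \<open>Q\<close> of degree
  at most \<open>2 * n + 4\<close>, with \<open>\<eta>\<close> of order \<open>n ^ d * N powr (- 1 - 2 / d)\<close>.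

  Applied to \<open>Q = \<lambda>x. (norm (tgrad P x))\<^sup>2\<close>, whose energy is at most of order
  \<open>n ^ (d + 2) * (energy P P)\<^sup>2\<close>, this estimate shows that the average of
  \<open>(norm (tgrad P (x0 i)))\<^sup>2\<close> is at least half the energy of \<open>P\<close>, as soon as \<open>n ^ (d + 2) * \<eta>\<close> is
  small.  This is the condition that \<open>N powr (1 + 2 / d)\<close> be large compared with \<open>n ^ (2 * d + 2)\<close>,
  which is the hypothesis on \<open>N\<close>.  The same condition makes the inequality survive small
  displacements of the points.

  The mean error is a functional on polynomials; let \<open>err X\<close> be its norm with respect to the energy.
  Choose \<open>X\<close> to minimise \<open>err X\<close> plus a small multiple of the distance from \<open>x0\<close>
  (\<open>exists_zero_mean_error\<close>).  Such an \<open>X\<close> is close to \<open>x0\<close>, so it still detects the energy.  If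
  \<open>err X\<close> were not zero, then moving every point \<open>X i\<close> in the direction \<open>- tgrad P (X i)\<close>, where
  \<open>P\<close> of energy \<open>1\<close> represents the mean error, would decrease \<open>err\<close> at the rate of the average of
  \<open>(norm (tgrad P (X i)))\<^sup>2\<close>, faster than the penalty can grow.  So \<open>err X = 0\<close>, and \<open>X\<close> is a
  design.
\<close>

section \<open>Polynomials of bounded degree and their tangential gradients\<close>

text \<open>The polynomials of degree at most \<open>m\<close> as functions, in a form that every closure property
  below follows from by rule induction.  Degrees only ever enter through upper bounds that are linear
  in \<open>n\<close>, so the bounds on the degrees of derivatives are left crude.\<close>

inductive poly_deg :: "nat \<Rightarrow> (real ^ 'n::finite \<Rightarrow> real) \<Rightarrow> bool" where
  const: "poly_deg m (\<lambda>x. c)"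
| add: "poly_deg m P \<Longrightarrow> poly_deg m Q \<Longrightarrow> poly_deg m (\<lambda>x. P x + Q x)"
| coord: "poly_deg m P \<Longrightarrow> poly_deg (Suc m) (\<lambda>x. x $ a * P x)"

lemma poly_deg_cmult: "poly_deg m P \<Longrightarrow> poly_deg m (\<lambda>x. c * P x)"
proof (induction rule: poly_deg.induct)
  case (const m b) show ?case by (rule poly_deg.const)
next
  case (add m P Q) then show ?case by (simp add: distrib_left poly_deg.add)
next
  case (coord m P a)
  have "(\<lambda>x. c * (x $ a * P x)) = (\<lambda>x. x $ a * (c * P x))" by (simp add: ac_simps)
  then show ?case using poly_deg.coord[OF coord.IH, of a] by simp
qed

lemma poly_deg_mono:
  assumes "poly_deg m P" "m \<le> k"
  shows "poly_deg k P"
proof -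
  have "poly_deg (m + j) P" for j
    using assms(1)
  proof (induction rule: poly_deg.induct)
    case (const m b) show ?case by (rule poly_deg.const)
  next
    case (add m P Q) then show ?case by (simp add: poly_deg.add)
  next
    case (coord m P a) then show ?case using poly_deg.coord[of "m + j" P a] by simp
  qed
  from this[of "k - m"] show ?thesis using assms(2) by simp
qed

lemma poly_deg_diff: "poly_deg m P \<Longrightarrow> poly_deg m Q \<Longrightarrow> poly_deg m (\<lambda>x. P x - Q x)"
  using poly_deg.add[of m P "\<lambda>x. (-1) * Q x"] poly_deg_cmult[of m Q "-1"] by simp

lemma poly_deg_mult:
  assumes "poly_deg m P" "poly_deg k Q"
  shows "poly_deg (m + k) (\<lambda>x. P x * Q x)"
  using assms(1)
proof (induction rule: poly_deg.induct)
  case (const m c)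
  show ?case by (rule poly_deg_mono[OF poly_deg_cmult[OF assms(2)]]) simp
next
  case (add m P R)
  then show ?case by (simp add: distrib_right poly_deg.add)
next
  case (coord m P a)
  then show ?case using poly_deg.coord[of "m + k" "\<lambda>x. P x * Q x" a] by (simp add: mult.assoc)
qed

lemma poly_deg_sum: "(\<And>i. i \<in> I \<Longrightarrow> poly_deg m (P i)) \<Longrightarrow> poly_deg m (\<lambda>x. \<Sum>i\<in>I. P i x)"
  by (induction I rule: infinite_finite_induct) (auto intro: poly_deg.const poly_deg.add)

lemma poly_deg_coord: "poly_deg 1 (\<lambda>x. x $ a)"
  using poly_deg.coord[OF poly_deg.const[of 0 1]] by simp

lemma poly_deg_power: "poly_deg k (\<lambda>x. (x $ a) ^ k)"
proof (induction k)
  case 0 show ?case using poly_deg.const[of 0 1] by simp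
next
  case (Suc k) then show ?case using poly_deg.coord[of k _ a] by simp
qed

lemma poly_deg_prod: "finite I \<Longrightarrow> (\<And>i. i \<in> I \<Longrightarrow> poly_deg (f i) (P i)) \<Longrightarrow>
   poly_deg (\<Sum>i\<in>I. f i) (\<lambda>x. \<Prod>i\<in>I. P i x)"
  by (induction I rule: finite_induct) (auto intro: poly_deg.const poly_deg_mult)

lemma poly_deg_polynomials_le:
  assumes "P \<in> polynomials_le n"
  shows "poly_deg n P"
proof -
  obtain c where P: "P = (\<lambda>x. \<Sum>\<alpha>\<in>exponents_le n. c \<alpha> * (\<Prod>i\<in>UNIV. (x $ i) ^ \<alpha> i))"
    using assms by (auto simp: polynomials_le_def)
  have "poly_deg n (\<lambda>x. \<Prod>i\<in>UNIV. (x $ i) ^ \<alpha> i)" if "\<alpha> \<in> exponents_le n" for \<alpha>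
    by (rule poly_deg_mono[OF poly_deg_prod[of UNIV \<alpha>]]) (use that in \<open>auto simp: exponents_le_def intro: poly_deg_power\<close>)
  then show ?thesis unfolding P by (intro poly_deg_sum poly_deg_cmult)
qed

definition grad :: "(real ^ 'n::finite \<Rightarrow> real) \<Rightarrow> real ^ 'n \<Rightarrow> real ^ 'n" where
  "grad f x = (\<chi> a. frechet_derivative f (at x) (axis a 1))"

lemma grad_eqI:
  assumes "(f has_derivative (\<lambda>h. g \<bullet> h)) (at x)"
  shows "grad f x = g"
proof -
  have "frechet_derivative f (at x) = (\<lambda>h. g \<bullet> h)" using frechet_derivative_at[OF assms] by simp
  then show ?thesis by (simp add: grad_def vec_eq_iff inner_axis)
qed

lemma poly_deg_has_derivative:
  "poly_deg m P \<Longrightarrow> (P has_derivative (\<lambda>h. grad P x \<bullet> h)) (at x)"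
proof (induction rule: poly_deg.induct)
  case (const m c)
  have "((\<lambda>x. c) has_derivative (\<lambda>h. 0 \<bullet> h)) (at x)" by simp
  then show ?case using grad_eqI by metis
next
  case (add m P Q)
  have "((\<lambda>x. P x + Q x) has_derivative (\<lambda>h. (grad P x + grad Q x) \<bullet> h)) (at x)"
    using has_derivative_add[OF add.IH] by (simp add: inner_add_left)
  then show ?case using grad_eqI by metis
next
  case (coord m P a)
  have "((\<lambda>x. x $ a * P x) has_derivative (\<lambda>h. (P x *\<^sub>R axis a 1 + x $ a *\<^sub>R grad P x) \<bullet> h)) (at x)"
    by (rule has_derivative_eq_rhs[OF has_derivative_mult[OF _ coord.IH]])
      (auto intro!: derivative_eq_intros simp: inner_axis' algebra_simps bounded_linear_vec_nth bounded_linear_imp_has_derivative inner_add_left)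
  then show ?case using grad_eqI by metis
qed

lemma grad_add: "poly_deg m P \<Longrightarrow> poly_deg k Q \<Longrightarrow> grad (\<lambda>x. P x + Q x) x = grad P x + grad Q x"
  by (rule grad_eqI) (auto simp: inner_add_left intro!: has_derivative_add poly_deg_has_derivative)

lemma grad_mult: "poly_deg m P \<Longrightarrow> poly_deg k Q \<Longrightarrow>
    grad (\<lambda>x. P x * Q x) x = P x *\<^sub>R grad Q x + Q x *\<^sub>R grad P x"
  by (rule grad_eqI, rule has_derivative_eq_rhs[OF has_derivative_mult[OF poly_deg_has_derivative poly_deg_has_derivative]])
    (auto simp: inner_add_left)

lemma grad_const: "grad (\<lambda>x. c) x = 0"
  by (rule grad_eqI) simp

lemma grad_coord: "grad (\<lambda>x. x $ a) x = axis a 1"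
  by (rule grad_eqI) (simp add: inner_axis' bounded_linear_vec_nth bounded_linear_imp_has_derivative)

lemma poly_deg_grad: "poly_deg m P \<Longrightarrow> poly_deg m (\<lambda>x. grad P x $ b)"
proof (induction rule: poly_deg.induct)
  case (const m c) show ?case by (simp add: grad_const poly_deg.const)
next
  case (add m P Q) then show ?case by (simp add: grad_add[OF add.hyps] poly_deg.add)
next
  case (coord m P a)
  have "poly_deg (Suc m) (\<lambda>x. x $ a * grad P x $ b + axis a 1 $ b * P x)"
    by (intro poly_deg.intros coord.IH poly_deg_cmult poly_deg_mono[OF coord.hyps]) simp
  then show ?case by (simp add: grad_mult[OF poly_deg_coord coord.hyps] grad_coord mult.commute[of "P _"])
qed

text \<open>On the unit sphere this is the gradient along the sphere.  Dropping the denominator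
  \<open>x \<bullet> x\<close> of the orthogonal projection keeps the components polynomial.\<close>

definition tgrad :: "(real ^ 'n::finite \<Rightarrow> real) \<Rightarrow> real ^ 'n \<Rightarrow> real ^ 'n" where
  "tgrad f x = grad f x - (x \<bullet> grad f x) *\<^sub>R x"

lemma poly_deg_tgrad:
  assumes "poly_deg m P"
  shows "poly_deg (m + 2) (\<lambda>x. tgrad P x $ a)"
proof -
  have "poly_deg (m + 2) (\<lambda>x. x $ a * (\<Sum>b\<in>UNIV. x $ b * grad P x $ b))"
    using poly_deg.coord[OF poly_deg_sum[OF poly_deg.coord[OF poly_deg_grad[OF assms]]]] by simp
  then show ?thesis
    using poly_deg_diff[OF poly_deg_mono[OF poly_deg_grad[OF assms, of a], of "m + 2"]]
    by (simp add: tgrad_def inner_vec_def mult.commute)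
qed

lemma tgrad_add: "poly_deg m P \<Longrightarrow> poly_deg k Q \<Longrightarrow> tgrad (\<lambda>x. P x + Q x) x = tgrad P x + tgrad Q x"
  by (simp add: tgrad_def grad_add inner_add_right algebra_simps)

lemma tgrad_mult: "poly_deg m P \<Longrightarrow> poly_deg k Q \<Longrightarrow>
    tgrad (\<lambda>x. P x * Q x) x = P x *\<^sub>R tgrad Q x + Q x *\<^sub>R tgrad P x"
  by (simp add: tgrad_def grad_mult inner_add_right algebra_simps)

lemma tgrad_const: "tgrad (\<lambda>x. c) x = 0"
  by (simp add: tgrad_def grad_const)

lemma tgrad_cmult: "poly_deg m P \<Longrightarrow> tgrad (\<lambda>x. c * P x) x = c *\<^sub>R tgrad P x"
  using tgrad_mult[OF poly_deg.const[of 0 c], of m P x] by (simp add: tgrad_const)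

lemma tgrad_sum: "(\<And>i. i \<in> I \<Longrightarrow> poly_deg m (P i)) \<Longrightarrow>
    tgrad (\<lambda>x. \<Sum>i\<in>I. P i x) x = (\<Sum>i\<in>I. tgrad (P i) x)"
  by (induction I rule: infinite_finite_induct)
    (simp_all add: tgrad_const tgrad_add[where m=m and k=m] poly_deg_sum)

lemma tgrad_orthogonal: "norm x = 1 \<Longrightarrow> tgrad f x \<bullet> x = 0"
  by (simp add: tgrad_def inner_diff_left inner_commute[of "grad f x"] flip: power2_norm_eq_inner)

text \<open>Derivatives along curves in the sphere only see the tangential part of the gradient.\<close>

lemma tgrad_inner: "v \<bullet> x = 0 \<Longrightarrow> tgrad f x \<bullet> v = grad f x \<bullet> v"
  by (simp add: tgrad_def inner_diff_left inner_commute[of x])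

lemma poly_deg_inner_tgrad:
  assumes "poly_deg m P" "poly_deg k Q"
  shows "poly_deg (m + 2 + (k + 2)) (\<lambda>x. tgrad P x \<bullet> tgrad Q x)"
  unfolding inner_vec_def inner_real_def
  by (intro poly_deg_sum poly_deg_mult poly_deg_tgrad assms)

lemma poly_deg_continuous: "poly_deg m P \<Longrightarrow> continuous_on A P"
  by (rule continuous_at_imp_continuous_on) (use has_derivative_continuous poly_deg_has_derivative in blast)

section \<open>Bernstein's inequality on the sphere\<close>

text \<open>Along a great circle a polynomial of degree \<open>m\<close> is a trigonometric polynomial of degree
  \<open>m\<close>; Bernstein's inequality is a statement about these.\<close>

definition trig_deg :: "nat \<Rightarrow> (real \<Rightarrow> complex) \<Rightarrow> bool" where
  "trig_deg m f \<longleftrightarrow> (\<exists>c. \<forall>t. f t = (\<Sum>k\<in>{-int m..int m}. c k * cis (of_int k * t)))"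

lemma trig_deg_add: "trig_deg m f \<Longrightarrow> trig_deg m g \<Longrightarrow> trig_deg m (\<lambda>t. f t + g t)"
proof -
  assume "trig_deg m f" "trig_deg m g"
  then obtain c d where "f t = (\<Sum>k\<in>{-int m..int m}. c k * cis (of_int k * t))"
    "g t = (\<Sum>k\<in>{-int m..int m}. d k * cis (of_int k * t))" for t
    unfolding trig_deg_def by blast
  then have "\<forall>t. f t + g t = (\<Sum>k\<in>{-int m..int m}. (c k + d k) * cis (of_int k * t))"
    by (simp add: sum.distrib distrib_right)
  then show ?thesis unfolding trig_deg_def by (intro exI[of _ "\<lambda>k. c k + d k"])
qed

lemma trig_deg_monomial:
  assumes "\<bar>k\<bar> \<le> int m"
  shows "trig_deg m (\<lambda>t. a * cis (of_int k * t))"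
  unfolding trig_deg_def
proof (rule exI, rule allI)
  fix t
  have k: "k \<in> {-int m..int m}" using assms by auto
  have "(\<Sum>j\<in>{-int m..int m}. (if j = k then a else 0) * cis (of_int j * t)) =
     (\<Sum>j\<in>{-int m..int m}. if j = k then a * cis (of_int j * t) else 0)"
    by (intro sum.cong) auto
  then show "a * cis (of_int k * t) = (\<Sum>j\<in>{-int m..int m}. (if j = k then a else 0) * cis (of_int j * t))"
    using k by simp
qed

lemma trig_deg_sum: "(\<And>i. i \<in> I \<Longrightarrow> trig_deg m (f i)) \<Longrightarrow> trig_deg m (\<lambda>t. \<Sum>i\<in>I. f i t)"
  using trig_deg_monomial[of 0 m 0]
  by (induction I rule: infinite_finite_induct) (auto intro: trig_deg_add)

lemma poly_deg_great_circle_trig: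
  "poly_deg m P \<Longrightarrow> trig_deg m (\<lambda>t. complex_of_real (P (cos t *\<^sub>R x + sin t *\<^sub>R v)))"
proof (induction rule: poly_deg.induct)
  case (const m c) show ?case using trig_deg_monomial[of 0 m] by simp
next
  case (add m P Q) then show ?case by (simp add: trig_deg_add)
next
  case (coord m P a)
  let ?p = "complex_of_real (x $ a)" and ?q = "complex_of_real (v $ a)"
  from coord.IH obtain c where c: "complex_of_real (P (cos t *\<^sub>R x + sin t *\<^sub>R v)) =
      (\<Sum>k\<in>{-int m..int m}. c k * cis (of_int k * t))" for t
    unfolding trig_deg_def by blast
  have "trig_deg (Suc m) (\<lambda>t. \<Sum>k\<in>{-int m..int m}.
      (?p - \<i> * ?q) / 2 * c k * cis (of_int (k + 1) * t) + (?p + \<i> * ?q) / 2 * c k * cis (of_int (k - 1) * t))"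
    by (intro trig_deg_sum trig_deg_add trig_deg_monomial) auto
  moreover have "(\<Sum>k\<in>{-int m..int m}.
      (?p - \<i> * ?q) / 2 * c k * cis (of_int (k + 1) * t) + (?p + \<i> * ?q) / 2 * c k * cis (of_int (k - 1) * t))
     = ((?p - \<i> * ?q) / 2 * cis t + (?p + \<i> * ?q) / 2 * cis (- t)) * (\<Sum>k\<in>{-int m..int m}. c k * cis (of_int k * t))" for t
    unfolding sum_distrib_left
  proof (rule sum.cong[OF refl])
    fix k
    have 1: "cis (of_int (k + 1) * t) = cis t * cis (of_int k * t)"
      and 2: "cis (of_int (k - 1) * t) = cis (- t) * cis (of_int k * t)"
      by (simp_all add: cis_mult algebra_simps)
    show "(?p - \<i> * ?q) / 2 * c k * cis (of_int (k + 1) * t) + (?p + \<i> * ?q) / 2 * c k * cis (of_int (k - 1) * t)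
      = ((?p - \<i> * ?q) / 2 * cis t + (?p + \<i> * ?q) / 2 * cis (- t)) * (c k * cis (of_int k * t))"
      unfolding 1 2 by (simp only: distrib_right distrib_left mult.assoc mult.commute mult.left_commute)
  qed
  moreover have "complex_of_real ((cos t *\<^sub>R x + sin t *\<^sub>R v) $ a) =
      (?p - \<i> * ?q) / 2 * cis t + (?p + \<i> * ?q) / 2 * cis (- t)" for t
    by (simp add: complex_eq_iff field_simps)
  ultimately show ?case by (simp only: of_real_mult c)
qed

lemma sum_cis_roots_of_unity:
  fixes s :: int and N :: nat
  assumes "\<bar>s\<bar> < int N"
  shows "(\<Sum>j<N. cis (of_int s * (2 * pi * real j / real N))) = (if s = 0 then of_nat N else 0)"
proof (cases "s = 0")
  case False
  have N: "N > 0" using assms by simp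
  define w where "w = cis (2 * pi * (of_int s / real N))"
  have pow: "cis (of_int s * (2 * pi * real j / real N)) = w ^ j" for j
  proof -
    have "real_of_int s * (2 * pi * real j / real N) = real j * (2 * pi * (of_int s / real N))" by simp
    then show ?thesis unfolding w_def Complex.DeMoivre by (rule arg_cong)
  qed
  have "real N * (2 * pi * (of_int s / real N)) = 2 * pi * of_int s" using N by simp
  then have "w ^ N = cis (2 * pi * of_int s)" unfolding w_def Complex.DeMoivre by (rule arg_cong)
  then have wN: "w ^ N = 1" by simp
  have "w \<noteq> 1"
  proof
    assume "w = 1"
    then have "cos (2 * pi * (of_int s / real N)) = 1" by (simp add: w_def complex_eq_iff)
    then obtain z :: int where "2 * pi * (of_int s / real N) = of_int z * 2 * pi"
      by (auto simp: cos_one_2pi_int)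
    then have "of_int s = (of_int (z * int N) :: real)" using N by (simp add: field_simps)
    then have sz: "s = z * int N" by (simp only: of_int_eq_iff)
    with False have "\<bar>z\<bar> \<ge> 1" by auto
    then have "\<bar>s\<bar> \<ge> int N" unfolding sz abs_mult using mult_right_mono[of 1 "\<bar>z\<bar>" "int N"] by simp
    with assms show False by simp
  qed
  then have "(\<Sum>j<N. w ^ j) = 0" using wN by (simp add: geometric_sum)
  then show ?thesis using False by (simp only: pow if_False)
qed simp

lemma card_pairs_with_difference:
  fixes s :: int
  shows "card {(l, l'). l < m \<and> l' < m \<and> int l' - int l = s} = nat (int m - \<bar>s\<bar>)" (is "card ?A = _")
proof (cases "s \<ge> 0")
  case True
  have "bij_betw (\<lambda>l. (l, l + nat s)) {..<nat (int m - s)} ?A"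
    by (rule bij_betwI[where g = fst]) (use True in auto)
  then show ?thesis using True by (simp flip: bij_betw_same_card)
next
  case False
  have "bij_betw (\<lambda>l. (l + nat (-s), l)) {..<nat (int m + s)} ?A"
    by (rule bij_betwI[where g = snd]) (use False in auto)
  then show ?thesis using False by (simp flip: bij_betw_same_card)
qed

text \<open>This is \<open>2 m sin (m t)\<close> times the Fejer kernel of order \<open>m\<close>.  Multiplication by \<open>sin (m t)\<close>
  shifts the triangular Fourier coefficients of the Fejer kernel by \<open>m\<close> to both sides, which makes
  them linear on the frequencies from \<open>-m\<close> to \<open>m\<close>: for these, averaging against the kernel is
  differentiation at \<open>0\<close>.  Nonnegativity of the Fejer kernel bounds the mass by \<open>2 m\<close>.\<close>

definition fejer_weight :: "nat \<Rightarrow> real \<Rightarrow> real" where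
  "fejer_weight m t = 2 * sin (real m * t) * (cmod (\<Sum>l<m. cis (real l * t)))\<^sup>2"

lemma of_real_norm_sum_cis_squared:
  "complex_of_real ((cmod (\<Sum>l<m. cis (real l * t)))\<^sup>2) =
    (\<Sum>l<m. \<Sum>l'<m. cis (of_int (int l - int l') * t))"
proof -
  have "complex_of_real ((cmod (\<Sum>l<m. cis (real l * t)))\<^sup>2) = (\<Sum>l<m. cis (real l * t)) * (\<Sum>l'<m. cis (- (real l' * t)))"
    by (simp only: complex_norm_square cnj_sum cis_cnj)
  then show ?thesis by (simp add: sum_product cis_mult algebra_simps)
qed

text \<open>The frequencies occurring below are smaller than \<open>4 m\<close> in absolute value, so \<open>4 m\<close>
  equidistant nodes integrate them exactly, and the sum counts the pairs of indices whose frequency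
  cancels.\<close>

lemma sum_fejer_weight_cis:
  fixes k :: int
  assumes m: "m \<ge> 1" and k: "\<bar>k\<bar> \<le> int m"
  shows "(\<Sum>j<4 * m. complex_of_real (fejer_weight m (2 * pi * real j / real (4 * m))) *
      cis (of_int k * (2 * pi * real j / real (4 * m)))) = of_nat (4 * m) * (\<i> * of_int k)"
proof -
  define t where "t j = 2 * pi * real j / real (4 * m)" for j
  have w: "complex_of_real (fejer_weight m u) * cis (of_int k * u) =
     - \<i> * (\<Sum>l<m. \<Sum>l'<m. cis (of_int (k + int m + int l - int l') * u) - cis (of_int (k - int m + int l - int l') * u))" for u
  proof -
    have s: "complex_of_real (2 * sin (real m * u)) = - \<i> * (cis (real m * u) - cis (- (real m * u)))"
      by (simp add: complex_eq_iff)
    have c: "cis (of_int (k + int m + int l - int l') * u) =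
        cis (real m * u) * cis (of_int k * u) * cis (of_int (int l - int l') * u)" for l l'
      by (simp add: cis_mult algebra_simps)
    have d: "cis (of_int (k - int m + int l - int l') * u) =
        cis (- (real m * u)) * cis (of_int k * u) * cis (of_int (int l - int l') * u)" for l l'
      by (simp add: cis_mult algebra_simps)
    show ?thesis
      unfolding fejer_weight_def of_real_mult[of "2 * sin (real m * u)"] s of_real_norm_sum_cis_squared c d
      by (simp only: left_diff_distrib[symmetric] sum_distrib_left[symmetric] mult.assoc)
        (simp only: ac_simps)
  qed
  have count: "(\<Sum>l<m. \<Sum>l'<m. \<Sum>j<4*m. cis (of_int (s + int l - int l') * t j)) =
     of_nat (4 * m) * of_nat (nat (int m - \<bar>s\<bar>))" if s: "\<bar>s\<bar> \<le> 2 * int m" for s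
  proof -
    have "(\<Sum>l<m. \<Sum>l'<m. \<Sum>j<4*m. cis (of_int (s + int l - int l') * t j)) =
      (\<Sum>l<m. \<Sum>l'<m. if int l' - int l = s then of_nat (4 * m) else 0)"
    proof (intro sum.cong refl)
      fix l l' assume "l \<in> {..<m}" "l' \<in> {..<m}"
      then have "\<bar>s + int l - int l'\<bar> < int (4 * m)" using s m by auto
      then show "(\<Sum>j<4*m. cis (of_int (s + int l - int l') * t j)) = (if int l' - int l = s then of_nat (4 * m) else 0)"
        unfolding t_def by (subst sum_cis_roots_of_unity) auto
    qed
    also have "\<dots> = (\<Sum>p\<in>{..<m}\<times>{..<m}. if int (snd p) - int (fst p) = s then of_nat (4 * m) else 0)"
      by (simp add: sum.cartesian_product case_prod_unfold)
    also have "\<dots> = (\<Sum>p\<in>{(l, l'). l < m \<and> l' < m \<and> int l' - int l = s}. of_nat (4 * m))"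
      by (intro sum.mono_neutral_cong_right) auto
    also have "\<dots> = of_nat (4 * m) * of_nat (nat (int m - \<bar>s\<bar>))"
      by (simp only: sum_constant card_pairs_with_difference mult.commute)
    finally show ?thesis .
  qed
  have "(\<Sum>j<4 * m. complex_of_real (fejer_weight m (t j)) * cis (of_int k * t j)) =
    - \<i> * (\<Sum>j<4*m. \<Sum>l<m. \<Sum>l'<m. cis (of_int (k + int m + int l - int l') * t j) - cis (of_int (k - int m + int l - int l') * t j))"
    by (simp only: w sum_distrib_left)
  also have "\<dots> = - \<i> * ((\<Sum>l<m. \<Sum>l'<m. \<Sum>j<4*m. cis (of_int (k + int m + int l - int l') * t j))
      - (\<Sum>l<m. \<Sum>l'<m. \<Sum>j<4*m. cis (of_int (k - int m + int l - int l') * t j)))"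
    by (subst sum.swap, subst (1) sum.swap[of _ "{..<m}" "{..<4*m}"]) (simp only: sum_subtractf)
  also have "\<dots> = - \<i> * (of_nat (4 * m) * (of_nat (nat (int m - \<bar>k + int m\<bar>)) - of_nat (nat (int m - \<bar>k - int m\<bar>))))"
    using count[of "k + int m"] count[of "k - int m"] k by (simp only: right_diff_distrib)
  also have "of_nat (nat (int m - \<bar>k + int m\<bar>)) - of_nat (nat (int m - \<bar>k - int m\<bar>)) = (- of_int k :: complex)"
    using k by (cases "k \<ge> 0") (auto simp: abs_if)
  finally show ?thesis unfolding t_def by simp
qed

lemma sum_abs_fejer_weight_le:
  assumes m: "m \<ge> 1"
  shows "(\<Sum>j<4 * m. \<bar>fejer_weight m (2 * pi * real j / real (4 * m))\<bar>) \<le> 2 * real (4 * m) * real m"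
proof -
  define t where "t j = 2 * pi * real j / real (4 * m)" for j
  have "complex_of_real (\<Sum>j<4 * m. (cmod (\<Sum>l<m. cis (real l * t j)))\<^sup>2) =
     (\<Sum>j<4*m. \<Sum>l<m. \<Sum>l'<m. cis (of_int (int l - int l') * t j))"
    by (simp only: of_real_sum of_real_norm_sum_cis_squared)
  also have "\<dots> = (\<Sum>l<m. \<Sum>l'<m. \<Sum>j<4*m. cis (of_int (int l - int l') * t j))"
    by (subst sum.swap, subst (1) sum.swap[of _ "{..<m}" "{..<4*m}"]) (rule refl)
  also have "\<dots> = (\<Sum>l<m. \<Sum>l'<m. if l = l' then of_nat (4 * m) else 0)"
  proof (intro sum.cong refl)
    fix l l' assume "l \<in> {..<m}" "l' \<in> {..<m}"
    then have "\<bar>int l - int l'\<bar> < int (4 * m)" by auto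
    then show "(\<Sum>j<4*m. cis (of_int (int l - int l') * t j)) = (if l = l' then of_nat (4 * m) else 0)"
      unfolding t_def by (subst sum_cis_roots_of_unity) auto
  qed
  also have "\<dots> = complex_of_real (real (4 * m) * real m)" by simp
  finally have sq: "(\<Sum>j<4 * m. (cmod (\<Sum>l<m. cis (real l * t j)))\<^sup>2) = real (4 * m) * real m"
    by (simp only: of_real_eq_iff)
  have "(\<Sum>j<4 * m. \<bar>fejer_weight m (t j)\<bar>) \<le> (\<Sum>j<4 * m. 2 * (cmod (\<Sum>l<m. cis (real l * t j)))\<^sup>2)"
    by (intro sum_mono) (auto simp: fejer_weight_def abs_mult mult_left_le_one_le)
  also have "\<dots> = 2 * real (4 * m) * real m" by (simp only: sq mult.assoc flip: sum_distrib_left)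
  finally show ?thesis unfolding t_def .
qed

text \<open>The derivative at \<open>0\<close> is a weighted sum of values of \<open>f\<close>, and the weights have total mass at
  most \<open>2 m\<close> relative to the number of nodes.\<close>

lemma bernstein_trig:
  fixes f :: "real \<Rightarrow> real"
  assumes trig: "trig_deg m (\<lambda>t. complex_of_real (f t))" and m: "m \<ge> 1"
    and M: "\<And>t. \<bar>f t\<bar> \<le> M" and f': "(f has_real_derivative f') (at 0)"
  shows "\<bar>f'\<bar> \<le> 2 * real m * M"
proof -
  obtain c where c: "complex_of_real (f t) = (\<Sum>k\<in>{-int m..int m}. c k * cis (of_int k * t))" for t
    using trig unfolding trig_deg_def by blast
  define t where "t j = 2 * pi * real j / real (4 * m)" for j
  have "((\<lambda>t. complex_of_real (f t)) has_vector_derivative complex_of_real f') (at 0)"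
    using f' by (intro has_vector_derivative_of_real) (simp add: has_real_derivative_iff_has_vector_derivative)
  moreover have "((\<lambda>t. complex_of_real (f t)) has_vector_derivative
      (\<Sum>k\<in>{-int m..int m}. c k * (\<i> * of_int k))) (at 0)"
    unfolding c has_vector_derivative_def
    by (auto intro!: derivative_eq_intros simp: scaleR_sum_right scaleR_conv_of_real sum_distrib_left algebra_simps)
  ultimately have f'c: "complex_of_real f' = (\<Sum>k\<in>{-int m..int m}. c k * (\<i> * of_int k))"
    by (rule vector_derivative_unique_at)
  have "complex_of_real (\<Sum>j<4*m. fejer_weight m (t j) * f (t j)) =
    (\<Sum>j<4*m. \<Sum>k\<in>{-int m..int m}. c k * (complex_of_real (fejer_weight m (t j)) * cis (of_int k * t j)))"
    by (simp add: c sum_distrib_left algebra_simps)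
  also have "\<dots> = (\<Sum>k\<in>{-int m..int m}. c k * (\<Sum>j<4*m. complex_of_real (fejer_weight m (t j)) * cis (of_int k * t j)))"
    by (subst sum.swap) (simp only: sum_distrib_left)
  also have "\<dots> = (\<Sum>k\<in>{-int m..int m}. c k * (of_nat (4 * m) * (\<i> * of_int k)))"
  proof (intro sum.cong refl)
    fix k assume "k \<in> {-int m..int m}"
    then have "\<bar>k\<bar> \<le> int m" by auto
    then show "c k * (\<Sum>j<4*m. complex_of_real (fejer_weight m (t j)) * cis (of_int k * t j)) =
        c k * (of_nat (4 * m) * (\<i> * of_int k))"
      unfolding t_def by (simp only: sum_fejer_weight_cis[OF m])
  qed
  also have "\<dots> = of_nat (4 * m) * complex_of_real f'"
    unfolding f'c sum_distrib_left by (simp only: mult.left_commute)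
  also have "\<dots> = complex_of_real (real (4 * m) * f')" by simp
  finally have eq: "real (4 * m) * f' = (\<Sum>j<4*m. fejer_weight m (t j) * f (t j))"
    by (simp only: of_real_eq_iff)
  have "\<bar>real (4 * m) * f'\<bar> \<le> (\<Sum>j<4*m. \<bar>fejer_weight m (t j)\<bar> * M)"
    unfolding eq by (rule order_trans[OF sum_abs]) (auto simp: abs_mult intro!: sum_mono mult_left_mono M)
  also have "\<dots> \<le> 2 * real (4 * m) * real m * M"
    unfolding sum_distrib_right[symmetric] t_def
    by (intro mult_right_mono sum_abs_fejer_weight_le m) (use M[of 0] in linarith)
  finally show ?thesis using m by (simp add: abs_mult mult.commute[of M])
qed

lemma great_circle_in_sphere:
  fixes x v :: "real ^ 'n::finite"
  assumes "norm x = 1" "norm v = 1" "v \<bullet> x = 0"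
  shows "norm (cos t *\<^sub>R x + sin t *\<^sub>R v) = 1"
proof -
  have "(norm (cos t *\<^sub>R x + sin t *\<^sub>R v))\<^sup>2 = (cos t)\<^sup>2 + (sin t)\<^sup>2"
    using assms by (subst power2_norm_eq_inner)
      (simp add: inner_add_left inner_add_right inner_commute[of x v] power2_eq_square norm_eq_1)
  then show ?thesis by (simp add: power2_eq_1_iff) (use norm_ge_zero[of "cos t *\<^sub>R x + sin t *\<^sub>R v"] in linarith)
qed

lemma great_circle_has_derivative:
  assumes "poly_deg m P"
  shows "((\<lambda>t. P (cos t *\<^sub>R x + sin t *\<^sub>R v)) has_real_derivative
    grad P (cos t *\<^sub>R x + sin t *\<^sub>R v) \<bullet> (- sin t *\<^sub>R x + cos t *\<^sub>R v)) (at t)"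
proof -
  have "((\<lambda>t. cos t *\<^sub>R x + sin t *\<^sub>R v) has_derivative (\<lambda>h. h *\<^sub>R (- sin t *\<^sub>R x + cos t *\<^sub>R v))) (at t)"
    by (auto intro!: derivative_eq_intros simp: algebra_simps)
  from has_derivative_compose[OF this poly_deg_has_derivative[OF assms]] show ?thesis
    unfolding has_field_derivative_def
    by (rule has_derivative_eq_rhs) (simp add: fun_eq_iff mult.commute)
qed

text \<open>Bernstein's inequality on the great circle that leaves \<open>x\<close> in the direction of the gradient.\<close>

lemma bernstein_sphere:
  assumes P: "poly_deg m P" and m: "m \<ge> 1" and x: "norm x = 1"
    and M: "\<And>y. norm y = 1 \<Longrightarrow> \<bar>P y\<bar> \<le> M"
  shows "norm (tgrad P x) \<le> 2 * real m * M"
proof (cases "tgrad P x = 0")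
  case True
  then show ?thesis using M[OF x] by simp
next
  case False
  define v where "v = tgrad P x /\<^sub>R norm (tgrad P x)"
  have v: "norm v = 1" "v \<bullet> x = 0" using False x by (simp_all add: v_def tgrad_orthogonal)
  have "((\<lambda>t. P (cos t *\<^sub>R x + sin t *\<^sub>R v)) has_real_derivative grad P x \<bullet> v) (at 0)"
    using great_circle_has_derivative[OF P, of x v 0] by simp
  from bernstein_trig[OF poly_deg_great_circle_trig[OF P] m _ this] M great_circle_in_sphere[OF x v]
  have "\<bar>grad P x \<bullet> v\<bar> \<le> 2 * real m * M" by blast
  moreover have "grad P x \<bullet> v = norm (tgrad P x)"
    using False by (simp add: tgrad_inner[OF v(2), symmetric]) (simp add: v_def norm_eq_sqrt_inner real_sqrt_mult_self field_simps)
  ultimately show ?thesis by simp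
qed

lemma exists_orthogonal_unit:
  assumes "CARD('n::finite) \<ge> 2"
  shows "\<exists>v::real^'n. norm v = 1 \<and> v \<bullet> x = 0"
proof -
  obtain y :: "real^'n" where "y \<noteq> 0" "orthogonal x y"
    using assms by (auto intro: orthogonal_to_vector_exists[of x])
  then show ?thesis
    by (intro exI[of _ "y /\<^sub>R norm y"]) (simp add: orthogonal_def inner_commute)
qed

text \<open>The angle \<open>\<theta>\<close> satisfies \<open>norm (x - y) = 2 * sin (\<theta> / 2)\<close>; up to \<open>\<theta> / 2 = \<pi> / 3\<close> the
  cosine is at least \<open>1 / 2\<close>, and beyond that the chord is longer than half of the angle.\<close>

lemma exists_great_circle:
  fixes x y :: "real ^ 'n::finite"
  assumes "CARD('n) \<ge> 2" "norm x = 1" "norm y = 1"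
  obtains v \<theta> where "norm v = 1" "v \<bullet> x = 0" "0 \<le> \<theta>" "\<theta> \<le> 2 * norm (x - y)"
    "y = cos \<theta> *\<^sub>R x + sin \<theta> *\<^sub>R v"
proof -
  define \<theta> where "\<theta> = arccos (x \<bullet> y)"
  have xy: "\<bar>x \<bullet> y\<bar> \<le> 1" using Cauchy_Schwarz_ineq2[of x y] assms by simp
  have cos: "cos \<theta> = x \<bullet> y" using xy by (simp add: \<theta>_def)
  have \<theta>: "0 \<le> \<theta>" "\<theta> \<le> pi" using xy by (auto simp: \<theta>_def intro: arccos_lbound arccos_ubound)
  have sin0: "sin \<theta> \<ge> 0" using \<theta> by (rule sin_ge_zero)
  define w where "w = y - cos \<theta> *\<^sub>R x"
  have xx: "x \<bullet> x = 1" "y \<bullet> y = 1" using assms by (simp_all flip: norm_eq_1)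
  have wx: "w \<bullet> x = 0" using xx by (simp add: w_def cos inner_diff_left inner_commute[of y x])
  have "(norm w)\<^sup>2 = 1 - (cos \<theta>)\<^sup>2"
    unfolding w_def power2_norm_eq_inner using xx
    by (simp add: cos inner_diff_left inner_diff_right inner_commute power2_eq_square)
  then have "(norm w)\<^sup>2 = (sin \<theta>)\<^sup>2" by (simp add: sin_squared_eq)
  then have nw: "norm w = sin \<theta>" using sin0 by (simp add: power2_eq_iff_nonneg)
  have "(norm (x - y))\<^sup>2 = 2 - 2 * cos \<theta>"
    unfolding power2_norm_eq_inner using xx
    by (simp add: cos inner_diff_left inner_diff_right inner_commute)
  also have "\<dots> = (2 * sin (\<theta> / 2))\<^sup>2" using cos_double_sin[of "\<theta> / 2"] by (simp add: power2_eq_square)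
  finally have dist: "norm (x - y) = 2 * sin (\<theta> / 2)"
    using \<theta> sin_ge_zero[of "\<theta> / 2"] by (subst (asm) power2_eq_iff_nonneg) auto
  have len: "\<theta> \<le> 2 * norm (x - y)"
  proof (cases "\<theta> / 2 \<le> pi / 3")
    case True
    show ?thesis
    proof (cases "\<theta> = 0")
      case False
      with \<theta> have "0 < \<theta> / 2" by simp
      obtain z where z: "0 < z" "z < \<theta> / 2" "sin (\<theta> / 2) - sin 0 = (\<theta> / 2 - 0) * cos z"
        using MVT2[OF \<open>0 < \<theta> / 2\<close>, of sin cos] by (auto intro: DERIV_sin)
      have "cos (pi / 3) \<le> cos z" using z True by (intro cos_monotone_0_pi_le) auto
      then have "\<theta> / 2 * (1 / 2) \<le> \<theta> / 2 * cos z" using \<theta> by (intro mult_left_mono) (auto simp: cos_60)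
      then show ?thesis using z(3) dist by simp
    qed simp
  next
    case False
    have "sin (pi / 3) \<le> sin (\<theta> / 2)" using False \<theta> by (intro sin_monotone_2pi_le) auto
    moreover have "sqrt 3 \<ge> 17 / 10" by (intro real_le_rsqrt) (simp add: power2_eq_square)
    ultimately have "norm (x - y) \<ge> 17 / 10" by (simp add: dist sin_60)
    moreover have "pi \<le> 17 / 5" using pi_approx(2) by simp
    ultimately show ?thesis using \<theta> by linarith
  qed
  show ?thesis
  proof (cases "sin \<theta> = 0")
    case True
    then have "w = 0" using nw by simp
    obtain v :: "real^'n" where "norm v = 1" "v \<bullet> x = 0" using exists_orthogonal_unit[OF assms(1)] by blast
    with \<open>w = 0\<close> True len \<theta> show ?thesis by (intro that[of v \<theta>]) (auto simp: w_def)
  next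
    case False
    show ?thesis
      by (rule that[of "w /\<^sub>R sin \<theta>" \<theta>]) (use False sin0 nw wx len \<theta> in \<open>auto simp: w_def\<close>)
  qed
qed

text \<open>The mean value theorem on the shorter great circle arc from \<open>x\<close> to \<open>y\<close>.\<close>

lemma poly_deg_lipschitz_sphere:
  fixes P :: "real ^ 'n::finite \<Rightarrow> real"
  assumes card: "CARD('n) \<ge> 2" and P: "poly_deg m P" and x: "norm x = 1" "norm y = 1"
    and M: "\<And>y. norm y = 1 \<Longrightarrow> norm (tgrad P y) \<le> M"
  shows "\<bar>P x - P y\<bar> \<le> 2 * M * norm (x - y)"
proof -
  obtain v \<theta> where v: "norm v = 1" "v \<bullet> x = 0" "0 \<le> \<theta>" "\<theta> \<le> 2 * norm (x - y)"
    and y: "y = cos \<theta> *\<^sub>R x + sin \<theta> *\<^sub>R v"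
    by (rule exists_great_circle[OF card x])
  have M0: "M \<ge> 0" using M[OF x(1)] norm_ge_zero order_trans by blast
  define p where "p t = cos t *\<^sub>R x + sin t *\<^sub>R v" for t
  define q where "q t = - sin t *\<^sub>R x + cos t *\<^sub>R v" for t
  have p: "norm (p t) = 1" for t unfolding p_def by (rule great_circle_in_sphere) (use x v in auto)
  have xx: "x \<bullet> x = 1" "v \<bullet> v = 1" using x v by (simp_all flip: norm_eq_1)
  have qp: "q t \<bullet> p t = 0" for t
    using xx v by (simp add: p_def q_def inner_diff_left inner_add_right inner_add_left inner_commute[of x v])
  have "norm (cos t *\<^sub>R v + sin t *\<^sub>R (- x)) = 1" for t
    by (rule great_circle_in_sphere) (use x v in \<open>auto simp: inner_commute\<close>)
  then have q: "norm (q t) = 1" for t by (simp add: q_def algebra_simps)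
  have bound: "\<bar>grad P (p t) \<bullet> q t\<bar> \<le> M" for t
  proof -
    have "\<bar>grad P (p t) \<bullet> q t\<bar> = \<bar>tgrad P (p t) \<bullet> q t\<bar>" by (simp add: tgrad_inner[OF qp])
    also have "\<dots> \<le> norm (tgrad P (p t)) * norm (q t)" by (rule Cauchy_Schwarz_ineq2)
    also have "\<dots> \<le> M" using M[OF p] by (simp add: q)
    finally show ?thesis .
  qed
  have "\<bar>P (p \<theta>) - P (p 0)\<bar> \<le> M * \<theta>"
  proof (cases "\<theta> = 0")
    case False
    then have "0 < \<theta>" using v by simp
    have "\<exists>z. z > 0 \<and> z < \<theta> \<and> P (p \<theta>) - P (p 0) = (\<theta> - 0) * (grad P (p z) \<bullet> q z)"
      using MVT2[OF \<open>0 < \<theta>\<close>, of "\<lambda>t. P (p t)" "\<lambda>t. grad P (p t) \<bullet> q t"]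
        great_circle_has_derivative[OF P] unfolding p_def q_def by blast
    then obtain z where "P (p \<theta>) - P (p 0) = \<theta> * (grad P (p z) \<bullet> q z)" by auto
    then show ?thesis using bound[of z] \<open>0 < \<theta>\<close> by (simp add: abs_mult)
  qed simp
  also have "\<dots> \<le> M * (2 * norm (x - y))" using v M0 by (intro mult_left_mono)
  finally show ?thesis by (simp add: p_def y[symmetric] abs_minus_commute algebra_simps)
qed

section \<open>The measure of spherical caps\<close>

lemma emeasure_sphere_measure:
  fixes A :: "(real ^ 'n::finite) set"
  assumes A: "A \<in> sets borel" "A \<subseteq> sphere 0 1"
  shows "emeasure sphere_measure A =
    emeasure lborel {r *\<^sub>R x |r x. 0 < r \<and> r < 1 \<and> x \<in> A} / emeasure lborel (ball (0 :: real ^ 'n) 1)"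
proof -
  have fin: "emeasure lborel (ball (0 :: real ^ 'n) 1) \<noteq> top"
    using emeasure_lborel_ball_finite[of "0 :: real ^ 'n" 1] by auto
  have "emeasure sphere_measure A = 1 / (of_nat CARD('n) * emeasure lborel (ball (0 :: real ^ 'n) 1)) *
     (of_nat CARD('n) * emeasure lborel {r *\<^sub>R x |r x. 0 < r \<and> r < 1 \<and> x \<in> A})"
    by (simp add: sphere_measure_def emeasure_surface_measure_sphere emeasure_surface_measure[OF A])
  also have "\<dots> = (of_nat CARD('n) * emeasure lborel {r *\<^sub>R x |r x. 0 < r \<and> r < 1 \<and> x \<in> A}) /
      (of_nat CARD('n) * emeasure lborel (ball (0 :: real ^ 'n) 1))"
    by (simp only: mult.commute[of "1 / _"] ennreal_times_divide mult_1_right)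
  also have "\<dots> = emeasure lborel {r *\<^sub>R x |r x. 0 < r \<and> r < 1 \<and> x \<in> A} / emeasure lborel (ball (0 :: real ^ 'n) 1)"
    by (subst (1 2) mult.commute[of "of_nat CARD('n)"], rule divide_mult_eq) simp_all
  finally show ?thesis .
qed

text \<open>The cone over a cap of radius \<open>r\<close> contains about \<open>1 / r\<close> disjoint balls of radius \<open>r / 8\<close>
  whose centres are strung along the axis, and each of them has volume proportional to the power
  \<open>CARD('n)\<close> of \<open>r\<close>.\<close>

lemma cap_measure_lower_bound:
  fixes x :: "real ^ 'n::finite"
  assumes x: "norm x = 1" and r: "0 < r" "r \<le> 1"
  shows "measure sphere_measure (sphere 0 1 \<inter> ball x r) \<ge> r ^ (CARD('n) - 1) / (2 * 8 ^ CARD('n))"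
proof -
  let ?A = "sphere 0 1 \<inter> ball x r"
  let ?C = "{s *\<^sub>R y |s y. 0 < s \<and> s < 1 \<and> y \<in> ?A}"
  define V where "V = unit_ball_vol (real CARD('n))"
  have V: "V > 0" by (simp add: V_def)
  define \<rho> where "\<rho> = r / 8"
  define J where "J = nat \<lfloor>1 / r\<rfloor>"
  \<comment> \<open>Centres between \<open>1 / 2\<close> and \<open>3 / 4\<close> keep the balls inside the unit ball and away from the origin, near which radial projection is not Lipschitz.\<close>
  define t where "t j = 1 / 2 + 2 * \<rho> * real j" for j :: nat
  have J: "real J \<le> 1 / r" "real J \<ge> 1 / (2 * r)"
  proof -
    have "1 / r \<ge> 1" using r by simp
    then have fl: "\<lfloor>1 / r\<rfloor> \<ge> 1" by simp
    have "real J = of_int \<lfloor>1 / r\<rfloor>" unfolding J_def using fl by (intro of_nat_nat) linarith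
    then show "real J \<le> 1 / r" by simp
    have "of_int \<lfloor>1 / r\<rfloor> > 1 / r - 1" by linarith
    moreover have "of_int \<lfloor>1 / r\<rfloor> \<ge> (1::real)" using fl by simp
    ultimately have "2 * real J \<ge> 1 / r" using \<open>real J = _\<close> by linarith
    then show "real J \<ge> 1 / (2 * r)" using r by (simp add: field_simps)
  qed
  have t: "1 / 2 \<le> t j" "t j \<le> 3 / 4" if "j < J" for j
  proof -
    show "1 / 2 \<le> t j" using r by (simp add: t_def \<rho>_def)
    have "r * real j \<le> r * (1 / r)" using that J r by (intro mult_left_mono) auto
    then show "t j \<le> 3 / 4" using r by (simp add: t_def \<rho>_def)
  qed
  have sub: "ball (t j *\<^sub>R x) \<rho> \<subseteq> ?C" if j: "j < J" for j
  proof
    fix u assume "u \<in> ball (t j *\<^sub>R x) \<rho>"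
    then have u: "norm (u - t j *\<^sub>R x) < \<rho>" by (simp add: dist_norm norm_minus_commute)
    have nt: "norm (t j *\<^sub>R x) = t j" using t[OF j] x by simp
    have du: "\<bar>norm u - t j\<bar> < \<rho>" using norm_triangle_ineq3[of u "t j *\<^sub>R x"] u nt by linarith
    have bounds: "3 / 8 < norm u" "norm u < 1" using du t[OF j] r by (auto simp: \<rho>_def abs_if split: if_splits)
    have "u - norm u *\<^sub>R x = (u - t j *\<^sub>R x) + (t j - norm u) *\<^sub>R x" by (simp add: algebra_simps)
    also have "norm \<dots> \<le> norm (u - t j *\<^sub>R x) + \<bar>t j - norm u\<bar>"
      using norm_triangle_ineq[of "u - t j *\<^sub>R x" "(t j - norm u) *\<^sub>R x"] x by simp
    also have "\<dots> < 2 * \<rho>" using u du by linarith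
    finally have n: "norm (u - norm u *\<^sub>R x) < 2 * \<rho>" .
    have pos: "0 < norm u" using bounds by linarith
    have "norm u * norm (x - u /\<^sub>R norm u) = norm (norm u *\<^sub>R (x - u /\<^sub>R norm u))" by simp
    also have "norm u *\<^sub>R (x - u /\<^sub>R norm u) = - (u - norm u *\<^sub>R x)" using pos by (simp add: algebra_simps)
    finally have "norm u * norm (x - u /\<^sub>R norm u) < 2 * \<rho>" using n by (simp only: norm_minus_cancel)
    moreover have "3 / 8 * norm (x - u /\<^sub>R norm u) \<le> norm u * norm (x - u /\<^sub>R norm u)"
      using bounds by (intro mult_right_mono) auto
    ultimately have "norm (x - u /\<^sub>R norm u) < r" using r unfolding \<rho>_def by linarith
    then have "u /\<^sub>R norm u \<in> ?A" using pos by (simp add: dist_norm)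
    moreover note pos
    moreover have "u = norm u *\<^sub>R (u /\<^sub>R norm u)" using pos by simp
    ultimately show "u \<in> ?C" using bounds(2) by blast
  qed
  have disj: "disjoint_family_on (\<lambda>j. ball (t j *\<^sub>R x) \<rho>) {..<J}"
    unfolding disjoint_family_on_def
  proof (intro ballI impI)
    fix i j :: nat assume "i \<noteq> j"
    have "dist (t i *\<^sub>R x) (t j *\<^sub>R x) = \<bar>t i - t j\<bar>"
      using x by (simp add: dist_norm flip: scaleR_diff_left)
    also have "t i - t j = 2 * \<rho> * (real i - real j)" by (simp add: t_def algebra_simps)
    also have "\<bar>2 * \<rho> * (real i - real j)\<bar> = 2 * \<rho> * \<bar>real i - real j\<bar>" using r by (simp add: abs_mult \<rho>_def)
    also have "\<dots> \<ge> 2 * \<rho> * 1" using \<open>i \<noteq> j\<close> r by (intro mult_left_mono) (auto simp: \<rho>_def)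
    finally show "ball (t i *\<^sub>R x) \<rho> \<inter> ball (t j *\<^sub>R x) \<rho> = {}"
      by (intro disjoint_ballI) simp
  qed
  have "ennreal (r ^ (CARD('n) - 1) / (2 * 8 ^ CARD('n)) * V) \<le> ennreal (real J * (V * \<rho> ^ CARD('n)))"
  proof (rule ennreal_leI)
    have pw: "r ^ CARD('n) = r * r ^ (CARD('n) - 1)" by (simp flip: power_Suc)
    have "r ^ (CARD('n) - 1) / (2 * 8 ^ CARD('n)) * V = 1 / (2 * r) * (V * \<rho> ^ CARD('n))"
      using r by (simp add: \<rho>_def power_divide pw)
    also have "\<dots> \<le> real J * (V * \<rho> ^ CARD('n))"
      using J V r by (intro mult_right_mono) (auto simp: \<rho>_def)
    finally show "r ^ (CARD('n) - 1) / (2 * 8 ^ CARD('n)) * V \<le> real J * (V * \<rho> ^ CARD('n))" .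
  qed
  also have "\<dots> = (\<Sum>j<J. ennreal (V * \<rho> ^ CARD('n)))"
    using V r by (simp add: ennreal_mult \<rho>_def ennreal_of_nat_eq_real_of_nat)
  also have "\<dots> = (\<Sum>j<J. emeasure lborel (ball (t j *\<^sub>R x) \<rho>))"
    using r by (simp add: emeasure_ball V_def \<rho>_def)
  also have "\<dots> = emeasure lborel (\<Union>j<J. ball (t j *\<^sub>R x) \<rho>)"
    by (rule sum_emeasure) (use disj in auto)
  also have "\<dots> \<le> emeasure lborel ?C"
  proof (rule emeasure_mono)
    show "(\<Union>j<J. ball (t j *\<^sub>R x) \<rho>) \<subseteq> ?C" using sub by blast
    have "(\<lambda>x. x /\<^sub>R norm x) -` ?A \<inter> space (restrict_space lborel (ball 0 1 - {0})) \<in> sets (restrict_space lborel (ball (0::real^'n) 1 - {0}))"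
      by (rule measurable_sets[OF radial_projection_measurable]) (auto simp: sets_restrict_space_iff)
    moreover have "(\<lambda>x. x /\<^sub>R norm x) -` ?A \<inter> space (restrict_space lborel (ball 0 1 - {0})) = ?C"
    proof (intro equalityI subsetI)
      fix y assume y: "y \<in> (\<lambda>x. x /\<^sub>R norm x) -` ?A \<inter> space (restrict_space lborel (ball 0 1 - {0}))"
      then have "y = norm y *\<^sub>R (y /\<^sub>R norm y)" "0 < norm y" "norm y < 1" "y /\<^sub>R norm y \<in> ?A"
        by (auto simp: space_restrict_space)
      then show "y \<in> ?C" by blast
    next
      fix y assume "y \<in> ?C"
      then obtain s z where "y = s *\<^sub>R z" "0 < s" "s < 1" "z \<in> ?A" by blast
      then show "y \<in> (\<lambda>x. x /\<^sub>R norm x) -` ?A \<inter> space (restrict_space lborel (ball 0 1 - {0}))"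
        by (auto simp: space_restrict_space)
    qed
    ultimately show "?C \<in> sets lborel"
      by (subst (asm) sets_restrict_space_iff) auto
  qed
  finally have "ennreal (r ^ (CARD('n) - 1) / (2 * 8 ^ CARD('n)) * V) / ennreal V \<le> emeasure lborel ?C / ennreal V"
    by (intro divide_right_mono_ennreal)
  also have "ennreal V = emeasure lborel (ball (0 :: real ^ 'n) 1)" by (simp add: emeasure_ball V_def)
  also have "emeasure lborel ?C / emeasure lborel (ball (0 :: real ^ 'n) 1) = emeasure sphere_measure ?A"
    by (subst emeasure_sphere_measure) auto
  finally have "ennreal (r ^ (CARD('n) - 1) / (2 * 8 ^ CARD('n))) \<le> emeasure sphere_measure ?A"
    using V r by (simp add: divide_ennreal less_imp_neq[OF V, symmetric] emeasure_ball flip: V_def)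
  moreover have "emeasure sphere_measure ?A \<noteq> top"
  proof -
    have "emeasure sphere_measure ?A \<le> emeasure sphere_measure (space (sphere_measure :: (real^'n) measure))"
      by (rule emeasure_space)
    then show ?thesis by (auto simp: emeasure_sphere_measure_space top_unique)
  qed
  ultimately show ?thesis
    using r by (simp add: measure_def) (metis enn2real_ennreal enn2real_mono top.not_eq_extremum zero_le_divide_iff zero_le_mult_iff zero_le_numeral zero_le_power less_imp_le)
qed

lemma finite_measure_sphere_measure: "finite_measure (sphere_measure :: (real ^ 'n::finite) measure)"
  by (rule finite_measureI) (simp add: emeasure_sphere_measure_space)

lemma measure_sphere_measure_sphere: "measure (sphere_measure :: (real ^ 'n::finite) measure) (sphere 0 1) = 1"
  using emeasure_sphere_measure_space by (simp add: measure_def space_sphere_measure)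

section \<open>The energy of polynomials\<close>

lemma measurable_sphere_measure:
  fixes f :: "real ^ 'n::finite \<Rightarrow> real"
  assumes "continuous_on UNIV f"
  shows "f \<in> borel_measurable sphere_measure"
proof -
  have "f \<in> borel_measurable (restrict_space borel (sphere 0 1))"
    by (intro measurable_restrict_space1 borel_measurable_continuous_onI assms)
  then show ?thesis using measurable_cong_sets[OF sets_sphere_measure refl] by blast
qed

lemma integrable_sphere_weighted:
  fixes f w :: "real ^ 'n::finite \<Rightarrow> real"
  assumes f: "continuous_on UNIV f" and w: "w \<in> borel_measurable sphere_measure"
    and B: "\<And>x. \<bar>w x\<bar> \<le> B"
  shows "integrable sphere_measure (\<lambda>x. w x * f x)"
proof -
  interpret finite_measure "sphere_measure :: (real ^ 'n) measure" by (rule finite_measure_sphere_measure)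
  have "compact (f ` sphere 0 1)" by (intro compact_continuous_image continuous_on_subset[OF f]) auto
  then obtain C where C: "\<And>x. x \<in> sphere 0 1 \<Longrightarrow> \<bar>f x\<bar> \<le> C"
    using compact_imp_bounded bounded_iff by (metis imageI real_norm_def)
  show ?thesis
  proof (rule integrable_const_bound)
    show "AE x in sphere_measure. norm (w x * f x) \<le> B * C"
    proof (rule AE_I2)
      fix x :: "real^'n" assume "x \<in> space sphere_measure"
      then have "\<bar>f x\<bar> \<le> C" using C by (simp add: space_sphere_measure)
      then show "norm (w x * f x) \<le> B * C"
        unfolding real_norm_def abs_mult using B[of x] by (intro mult_mono) auto
    qed
    show "(\<lambda>x. w x * f x) \<in> borel_measurable sphere_measure"
      by (intro borel_measurable_times w measurable_sphere_measure f)
  qed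
qed

lemma integrable_sphere_continuous:
  fixes f :: "real ^ 'n::finite \<Rightarrow> real"
  assumes f: "continuous_on UNIV f"
  shows "integrable sphere_measure f"
  using integrable_sphere_weighted[OF f, of "\<lambda>_. 1" 1] by simp

lemma integrable_poly_deg: "poly_deg m P \<Longrightarrow> integrable sphere_measure P"
  by (rule integrable_sphere_continuous) (rule poly_deg_continuous)

lemma integral_sphere_const: "(LINT x|(sphere_measure :: (real ^ 'n::finite) measure). c) = (c::real)"
  by (simp add: space_sphere_measure measure_sphere_measure_sphere)

text \<open>Up to a factor that depends on \<open>CARD('n)\<close> this is the dimension of the space of polynomials of
  degree \<open>m\<close> on the sphere.\<close>

definition nikolskii_const :: "'n::finite itself \<Rightarrow> nat \<Rightarrow> real" where
  "nikolskii_const T m = 64 ^ CARD('n) * real m ^ (CARD('n) - 1)"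

text \<open>By Bernstein's inequality \<open>P\<close> keeps at least half of its maximal absolute value on a cap of
  radius \<open>1 / (8 m)\<close> around a maximum point, and the measure of that cap is bounded below.\<close>

lemma nikolskii:
  fixes P :: "real ^ 'n::finite \<Rightarrow> real"
  assumes card: "CARD('n) \<ge> 2" and P: "poly_deg m P" and m: "m \<ge> 1" and x: "norm x = 1"
  shows "(P x)\<^sup>2 \<le> nikolskii_const TYPE('n) m * (LINT y|sphere_measure. (P y)\<^sup>2)"
proof -
  interpret finite_measure "sphere_measure :: (real ^ 'n) measure" by (rule finite_measure_sphere_measure)
  have "continuous_on (sphere 0 1) (\<lambda>y. \<bar>P y\<bar>)" by (intro continuous_intros poly_deg_continuous[OF P])
  moreover have "sphere 0 1 \<noteq> ({} :: (real^'n) set)" using x by (auto intro: exI[of _ x])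
  ultimately obtain x0 where x0: "norm x0 = 1" and max: "\<And>y. norm y = 1 \<Longrightarrow> \<bar>P y\<bar> \<le> \<bar>P x0\<bar>"
    using continuous_attains_sup[of "sphere (0 :: real^'n) 1" "\<lambda>y. \<bar>P y\<bar>"] by auto
  define M where "M = \<bar>P x0\<bar>"
  define r where "r = 1 / (8 * real m)"
  define A where "A = sphere 0 1 \<inter> ball x0 r"
  have r: "0 < r" "r \<le> 1" using m by (auto simp: r_def)
  have half: "M / 2 \<le> \<bar>P y\<bar>" if "y \<in> A" for y
  proof -
    have y: "norm y = 1" "norm (x0 - y) \<le> r" using that by (auto simp: A_def dist_norm)
    have "\<bar>P x0 - P y\<bar> \<le> 2 * (2 * real m * M) * norm (x0 - y)"
      by (rule poly_deg_lipschitz_sphere[OF card P x0 y(1)], rule bernstein_sphere[OF P m])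
        (auto simp: M_def max)
    also have "\<dots> \<le> 2 * (2 * real m * M) * r" using y by (intro mult_left_mono) (auto simp: M_def)
    also have "\<dots> = M / 2" using m by (simp add: r_def)
    finally show ?thesis unfolding M_def by linarith
  qed
  have Am: "A \<in> sets sphere_measure"
    unfolding sets_sphere_measure A_def by (subst sets_restrict_space_iff) auto
  have P2: "poly_deg (m + m) (\<lambda>y. (P y)\<^sup>2)" unfolding power2_eq_square by (rule poly_deg_mult[OF P P])
  have "(M / 2)\<^sup>2 * measure sphere_measure A = (LINT y|sphere_measure. indicator A y * (M / 2)\<^sup>2)"
    using Am sets.sets_into_space[OF Am] by (simp add: Int_absorb2)
  also have "\<dots> \<le> (LINT y|sphere_measure. (P y)\<^sup>2)"
  proof (rule integral_mono)
    show "integrable sphere_measure (\<lambda>y. indicator A y * (M / 2)\<^sup>2)"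
      using Am by (intro integrable_mult_left integrable_real_indicator) (auto simp flip: top.not_eq_extremum)
    show "integrable sphere_measure (\<lambda>y. (P y)\<^sup>2)" by (rule integrable_poly_deg[OF P2])
    fix y :: "real^'n"
    show "indicator A y * (M / 2)\<^sup>2 \<le> (P y)\<^sup>2"
    proof (cases "y \<in> A")
      case True
      have "(M / 2)\<^sup>2 \<le> \<bar>P y\<bar>\<^sup>2" using half[OF True] by (intro power_mono) (auto simp: M_def)
      then show ?thesis using True by simp
    qed simp
  qed
  finally have 1: "(M / 2)\<^sup>2 * measure sphere_measure A \<le> (LINT y|sphere_measure. (P y)\<^sup>2)" .
  have "M\<^sup>2 = nikolskii_const TYPE('n) m * ((M / 2)\<^sup>2 * (r ^ (CARD('n) - 1) / (2 * 8 ^ CARD('n))))"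
  proof -
    obtain d where d: "CARD('n) = Suc d" using card by (cases "CARD('n)") auto
    have "(64::real) ^ d = 8 ^ d * 8 ^ d" by (simp flip: power_mult_distrib)
    then show ?thesis using m by (simp add: nikolskii_const_def r_def d power_divide power_mult_distrib)
  qed
  also have "\<dots> \<le> nikolskii_const TYPE('n) m * ((M / 2)\<^sup>2 * measure sphere_measure A)"
    unfolding A_def using cap_measure_lower_bound[OF x0 r]
    by (intro mult_left_mono) (auto simp: nikolskii_const_def)
  also have "\<dots> \<le> nikolskii_const TYPE('n) m * (LINT y|sphere_measure. (P y)\<^sup>2)"
    using 1 by (intro mult_left_mono) (auto simp: nikolskii_const_def)
  finally have "M\<^sup>2 \<le> nikolskii_const TYPE('n) m * (LINT y|sphere_measure. (P y)\<^sup>2)" .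
  moreover have "\<bar>P x\<bar>\<^sup>2 \<le> M\<^sup>2" using max[OF x] by (intro power_mono) (auto simp: M_def)
  ultimately show ?thesis by simp
qed

text \<open>The Dirichlet form.  A polynomial of energy \<open>0\<close> is constant on the sphere, and for constants
  every average of sample values is exact.\<close>

definition energy :: "(real ^ 'n::finite \<Rightarrow> real) \<Rightarrow> (real ^ 'n \<Rightarrow> real) \<Rightarrow> real" where
  "energy P Q = (LINT x|sphere_measure. tgrad P x \<bullet> tgrad Q x)"

lemma energy_commute: "energy P Q = energy Q P"
  by (simp add: energy_def inner_commute)

lemma energy_nonneg: "energy P P \<ge> 0"
  by (simp add: energy_def)

lemma energy_add:
  assumes "poly_deg m P" "poly_deg m Q" "poly_deg m R"
  shows "energy (\<lambda>x. P x + Q x) R = energy P R + energy Q R"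
  unfolding energy_def tgrad_add[OF assms(1,2)] inner_add_left
  by (rule Bochner_Integration.integral_add)
    (rule integrable_poly_deg, rule poly_deg_inner_tgrad, rule assms, rule assms)+

lemma energy_cmult: "poly_deg m P \<Longrightarrow> energy (\<lambda>x. c * P x) R = c * energy P R"
  by (simp add: energy_def tgrad_cmult)

lemma energy_diff:
  assumes "poly_deg m P" "poly_deg m Q" "poly_deg m R"
  shows "energy (\<lambda>x. P x - Q x) R = energy P R - energy Q R"
  using energy_add[OF assms(1) poly_deg_cmult[OF assms(2), of "-1"] assms(3)]
    energy_cmult[OF assms(2), of "-1" R] by simp

lemma energy_sum:
  assumes "\<And>i. i \<in> I \<Longrightarrow> poly_deg m (P i)" "poly_deg m R"
  shows "energy (\<lambda>x. \<Sum>i\<in>I. P i x) R = (\<Sum>i\<in>I. energy (P i) R)"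
  using assms(1)
proof (induction I rule: infinite_finite_induct)
  case (insert i I)
  then show ?case using energy_add[of m "P i" "\<lambda>x. \<Sum>i\<in>I. P i x" R] assms(2) by (simp add: poly_deg_sum)
qed (simp_all add: energy_def tgrad_const)

lemma norm_squared_vec: "(norm (v :: real ^ 'n::finite))\<^sup>2 = (\<Sum>a\<in>UNIV. (v $ a)\<^sup>2)"
  unfolding power2_norm_eq_inner inner_vec_def by (simp add: power2_eq_square)

lemma norm_tgrad_squared_le_energy:
  fixes P :: "real ^ 'n::finite \<Rightarrow> real"
  assumes card: "CARD('n) \<ge> 2" and P: "poly_deg m P" and x: "norm x = 1"
  shows "(norm (tgrad P x))\<^sup>2 \<le> nikolskii_const TYPE('n) (m + 2) * energy P P"
proof -
  have sq: "poly_deg (m + 2 + (m + 2)) (\<lambda>y. (tgrad P y $ a)\<^sup>2)" for a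
    unfolding power2_eq_square by (intro poly_deg_mult poly_deg_tgrad P)
  have "(norm (tgrad P x))\<^sup>2 \<le> (\<Sum>a\<in>UNIV. nikolskii_const TYPE('n) (m + 2) * (LINT y|sphere_measure. (tgrad P y $ a)\<^sup>2))"
    unfolding norm_squared_vec by (intro sum_mono nikolskii[OF card poly_deg_tgrad[OF P] _ x]) simp
  also have "\<dots> = nikolskii_const TYPE('n) (m + 2) * (LINT y|sphere_measure. (\<Sum>a\<in>UNIV. (tgrad P y $ a)\<^sup>2))"
    by (subst Bochner_Integration.integral_sum) (auto intro!: integrable_poly_deg sq simp: sum_distrib_left)
  also have "\<dots> = nikolskii_const TYPE('n) (m + 2) * energy P P"
    by (simp add: energy_def norm_squared_vec[symmetric] power2_norm_eq_inner)
  finally show ?thesis .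
qed

lemma nikolskii_const_nonneg: "nikolskii_const T m \<ge> 0"
  by (simp add: nikolskii_const_def)

lemma poly_deg_lipschitz_energy:
  fixes P :: "real ^ 'n::finite \<Rightarrow> real"
  assumes card: "CARD('n) \<ge> 2" and P: "poly_deg m P" and x: "norm x = 1" "norm y = 1"
  shows "(P x - P y)\<^sup>2 \<le> 4 * (norm (x - y))\<^sup>2 * nikolskii_const TYPE('n) (m + 2) * energy P P"
proof -
  let ?M = "nikolskii_const TYPE('n) (m + 2) * energy P P"
  have M: "0 \<le> ?M" by (intro mult_nonneg_nonneg nikolskii_const_nonneg energy_nonneg)
  have "\<bar>P x - P y\<bar> \<le> 2 * sqrt ?M * norm (x - y)"
    by (rule poly_deg_lipschitz_sphere[OF card P x], rule real_le_rsqrt)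
      (rule norm_tgrad_squared_le_energy[OF card P])
  then have "\<bar>P x - P y\<bar>\<^sup>2 \<le> (2 * sqrt ?M * norm (x - y))\<^sup>2" by (rule power_mono) simp
  then show ?thesis using M by (simp add: power_mult_distrib algebra_simps)
qed

definition energy_orthonormal :: "nat \<Rightarrow> nat \<Rightarrow> (nat \<Rightarrow> real ^ 'n::finite \<Rightarrow> real) \<Rightarrow> bool" where
  "energy_orthonormal m D e \<longleftrightarrow> (\<forall>k<D. poly_deg m (e k)) \<and>
     (\<forall>k<D. \<forall>l<D. energy (e k) (e l) = (if k = l then 1 else 0))"

lemma energy_orthonormal_combination:
  assumes "energy_orthonormal m D e"
  shows "poly_deg m (\<lambda>x. \<Sum>k<D. c k * e k x)"
    and "l < D \<Longrightarrow> energy (\<lambda>x. \<Sum>k<D. c k * e k x) (e l) = c l"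
    and "poly_deg m Q \<Longrightarrow> energy (\<lambda>x. \<Sum>k<D. c k * e k x) Q = (\<Sum>k<D. c k * energy (e k) Q)"
    and "energy (\<lambda>x. \<Sum>k<D. c k * e k x) (\<lambda>x. \<Sum>k<D. c k * e k x) = (\<Sum>k<D. (c k)\<^sup>2)"
proof -
  let ?P = "\<lambda>x. \<Sum>k<D. c k * e k x"
  have e: "poly_deg m (e k)" if "k < D" for k using assms that by (simp add: energy_orthonormal_def)
  show P: "poly_deg m ?P" by (intro poly_deg_sum poly_deg_cmult) (use e in auto)
  have exp: "energy ?P Q = (\<Sum>k<D. c k * energy (e k) Q)" if "poly_deg m Q" for Q
    using that e by (subst energy_sum[where m = m]) (auto intro!: poly_deg_cmult sum.cong energy_cmult)
  then show "poly_deg m Q \<Longrightarrow> energy ?P Q = (\<Sum>k<D. c k * energy (e k) Q)" .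
  have coeff: "energy ?P (e l) = c l" if l: "l < D" for l
  proof -
    have "energy ?P (e l) = (\<Sum>k<D. if k = l then c k else 0)"
      unfolding exp[OF e[OF l]] using assms l by (intro sum.cong) (simp_all add: energy_orthonormal_def)
    then show ?thesis using l by simp
  qed
  then show "l < D \<Longrightarrow> energy ?P (e l) = c l" .
  have "energy ?P ?P = (\<Sum>k<D. c k * energy ?P (e k))" by (subst exp[OF P]) (simp add: energy_commute)
  then show "energy ?P ?P = (\<Sum>k<D. (c k)\<^sup>2)" by (simp add: coeff power2_eq_square)
qed

text \<open>The sum of squares is the squared norm of the functional \<open>\<phi>\<close>: test the bound on the polynomial
  that represents \<open>\<phi>\<close> in the orthonormal system.  This turns a bound for single polynomials into a
  bound for sums over an orthonormal system without any loss.\<close>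

lemma energy_orthonormal_functional_bound:
  assumes e: "energy_orthonormal m D e" and A: "A \<ge> 0"
    and linear: "\<And>c. \<phi> (\<lambda>x. \<Sum>k<D. c k * e k x) = (\<Sum>k<D. c k * \<phi> (e k))"
    and bound: "\<And>P. poly_deg m P \<Longrightarrow> (\<phi> P)\<^sup>2 \<le> A * energy P P"
  shows "(\<Sum>k<D. (\<phi> (e k))\<^sup>2) \<le> A"
proof -
  define s where "s = (\<Sum>k<D. (\<phi> (e k))\<^sup>2)"
  have "\<phi> (\<lambda>x. \<Sum>k<D. \<phi> (e k) * e k x) = s" by (simp add: linear s_def power2_eq_square)
  then have "s\<^sup>2 \<le> A * s"
    using bound[OF energy_orthonormal_combination(1)[OF e, of "\<lambda>k. \<phi> (e k)"]]
    unfolding energy_orthonormal_combination(4)[OF e] by (simp add: s_def)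
  moreover have "s \<ge> 0" by (simp add: s_def sum_nonneg)
  ultimately show ?thesis using A unfolding s_def[symmetric]
    by (cases "s = 0") (auto simp: power2_eq_square)
qed

text \<open>Integrating the pointwise bound for the sum of the squared gradients over the sphere
  recovers the number of elements.\<close>

lemma energy_orthonormal_size_le:
  fixes e :: "nat \<Rightarrow> real ^ 'n::finite \<Rightarrow> real"
  assumes card: "CARD('n) \<ge> 2" and e: "energy_orthonormal m D e"
  shows "real D \<le> real CARD('n) * nikolskii_const TYPE('n) (m + 2)"
proof -
  interpret finite_measure "sphere_measure :: (real ^ 'n) measure" by (rule finite_measure_sphere_measure)
  let ?K = "nikolskii_const TYPE('n) (m + 2)"
  have ek: "poly_deg m (e k)" "energy (e k) (e k) = 1" if "k < D" for k
    using e that by (simp_all add: energy_orthonormal_def)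
  have int: "integrable sphere_measure (\<lambda>x. tgrad (e k) x \<bullet> tgrad (e k) x)" if "k < D" for k
    by (rule integrable_poly_deg[OF poly_deg_inner_tgrad]) (rule ek(1)[OF that])+
  have pt: "(\<Sum>k<D. tgrad (e k) x \<bullet> tgrad (e k) x) \<le> real CARD('n) * ?K" if x: "norm x = 1" for x
  proof -
    have "(\<Sum>k<D. (tgrad (e k) x $ a)\<^sup>2) \<le> ?K" for a
    proof (rule energy_orthonormal_functional_bound[OF e nikolskii_const_nonneg, where \<phi> = "\<lambda>P. tgrad P x $ a"])
      fix c
      have "tgrad (\<lambda>x. \<Sum>k<D. c k * e k x) x = (\<Sum>k<D. c k *\<^sub>R tgrad (e k) x)"
        by (subst tgrad_sum[where m = m]) (auto intro!: poly_deg_cmult sum.cong tgrad_cmult ek)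
      then show "tgrad (\<lambda>x. \<Sum>k<D. c k * e k x) x $ a = (\<Sum>k<D. c k * tgrad (e k) x $ a)" by simp
    next
      fix P :: "real^'n \<Rightarrow> real" assume P: "poly_deg m P"
      have "\<bar>tgrad P x $ a\<bar>\<^sup>2 \<le> (norm (tgrad P x))\<^sup>2"
        by (intro power_mono component_le_norm_cart) auto
      then show "(tgrad P x $ a)\<^sup>2 \<le> ?K * energy P P"
        using norm_tgrad_squared_le_energy[OF card P x] by simp
    qed
    then have "(\<Sum>a\<in>UNIV. \<Sum>k<D. (tgrad (e k) x $ a)\<^sup>2) \<le> (\<Sum>a\<in>(UNIV::'n set). ?K)" by (intro sum_mono)
    then show ?thesis by (subst (asm) sum.swap) (simp add: inner_vec_def power2_eq_square)
  qed
  have "real D = (\<Sum>k<D. energy (e k) (e k))" using ek by simp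
  also have "\<dots> = (LINT x|sphere_measure. (\<Sum>k<D. tgrad (e k) x \<bullet> tgrad (e k) x))"
    unfolding energy_def by (subst Bochner_Integration.integral_sum) (auto intro: int)
  also have "\<dots> \<le> (LINT x|(sphere_measure :: (real^'n) measure). real CARD('n) * ?K)"
    by (rule integral_mono) (use pt in \<open>auto intro!: Bochner_Integration.integrable_sum int simp: space_sphere_measure\<close>)
  finally show ?thesis unfolding integral_sphere_const .
qed

text \<open>An orthonormal system of maximal size is complete up to polynomials of energy \<open>0\<close>, since a
  residual of positive energy could be normalised and added to it.\<close>

lemma complete_energy_orthonormal:
  assumes card: "CARD('n::finite) \<ge> 2"
  obtains D and e :: "nat \<Rightarrow> real ^ 'n \<Rightarrow> real" where "energy_orthonormal m D e"
    "\<And>P. poly_deg m P \<Longrightarrow> energy (\<lambda>x. P x - (\<Sum>k<D. energy P (e k) * e k x)) (\<lambda>x. P x - (\<Sum>k<D. energy P (e k) * e k x)) = 0"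
proof -
  let ?S = "{D. \<exists>e :: nat \<Rightarrow> real ^ 'n \<Rightarrow> real. energy_orthonormal m D e}"
  have "finite ?S"
  proof (rule finite_subset)
    show "?S \<subseteq> {..nat \<lfloor>real CARD('n) * nikolskii_const TYPE('n) (m + 2)\<rfloor>}"
      using energy_orthonormal_size_le[OF card, of m] by (auto simp: le_nat_floor)
  qed simp
  moreover have "0 \<in> ?S" by (auto simp: energy_orthonormal_def)
  ultimately have in_S: "Max ?S \<in> ?S" and max: "\<And>D. D \<in> ?S \<Longrightarrow> D \<le> Max ?S"
    using Max_in[of ?S] Max_ge[of ?S] by blast+
  obtain D and e :: "nat \<Rightarrow> real ^ 'n \<Rightarrow> real" where D: "D = Max ?S" and e: "energy_orthonormal m D e" using in_S by blast
  show ?thesis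
  proof (rule that[OF e], rule ccontr)
    fix P :: "real ^ 'n \<Rightarrow> real" assume P: "poly_deg m P"
    let ?R = "\<lambda>x. P x - (\<Sum>k<D. energy P (e k) * e k x)"
    assume "energy ?R ?R \<noteq> 0"
    then have pos: "energy ?R ?R > 0" using energy_nonneg[of ?R] by linarith
    have ek: "poly_deg m (e k)" if "k < D" for k using e that by (simp add: energy_orthonormal_def)
    have R: "poly_deg m ?R" by (rule poly_deg_diff[OF P energy_orthonormal_combination(1)[OF e]])
    have orth: "energy ?R (e l) = 0" if "l < D" for l
      using energy_diff[OF P energy_orthonormal_combination(1)[OF e] ek[OF that], of "\<lambda>k. energy P (e k)"]
        energy_orthonormal_combination(2)[OF e that, of "\<lambda>k. energy P (e k)"] by simp
    define q where "q x = (1 / sqrt (energy ?R ?R)) * ?R x" for x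
    have q: "poly_deg m q" unfolding q_def by (rule poly_deg_cmult[OF R])
    have qQ: "energy q Q = 1 / sqrt (energy ?R ?R) * energy ?R Q" for Q
      unfolding q_def by (rule energy_cmult[OF R])
    have qq: "energy q q = 1" using pos
      by (subst qQ, subst energy_commute, subst qQ) (simp flip: power2_eq_square)
    have qe: "energy q (e l) = 0" "energy (e l) q = 0" if "l < D" for l
      using qQ[of "e l"] orth[OF that] energy_commute[of "e l" q] by simp_all
    have "energy_orthonormal m (Suc D) (e(D := q))"
      using e q qq qe by (auto simp: energy_orthonormal_def less_Suc_eq)
    then have "Suc D \<le> Max ?S" by (intro max) blast
    then show False by (simp add: D)
  qed
qed

section \<open>Redistributing masses to integral amounts\<close>

text \<open>Masses \<open>m c \<ge> 1\<close> sit on the vertices of a connected graph (connectedness enters as the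
  growth property).  They can be moved along edges, each at most once, so that every vertex ends up
  with an integral amount: grow the vertex set one vertex at a time, and let the vertex added last
  hand the fractional part of what it holds to a neighbour.  As the fractional part is less than
  \<open>1\<close>, the vertex can pay it from its own mass, so nothing travels further than one edge.
  In the proof \<open>e k\<close> is the mass that \<open>k\<close> has already received; in the result \<open>a k c\<close> is the
  amount at \<open>k\<close> that stems from \<open>c\<close>.\<close>

lemma integral_redistribution:
  fixes m :: "'v \<Rightarrow> real" and R :: "'v \<Rightarrow> 'v \<Rightarrow> bool" and N :: nat
  assumes fin: "finite Y" and ne: "Y \<noteq> {}"
    and grow: "\<And>A. A \<subset> Y \<Longrightarrow> A \<noteq> {} \<Longrightarrow> \<exists>a\<in>A. \<exists>b\<in>Y - A. R a b"
    and m: "\<And>c. c \<in> Y \<Longrightarrow> m c \<ge> 1" and total: "(\<Sum>c\<in>Y. m c) = real N"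
  obtains a :: "'v \<Rightarrow> 'v \<Rightarrow> real" and t :: "'v \<Rightarrow> nat" where
    "\<And>k c. k \<in> Y \<Longrightarrow> c \<in> Y \<Longrightarrow> a k c \<ge> 0"
    "\<And>k c. k \<in> Y \<Longrightarrow> c \<in> Y \<Longrightarrow> a k c \<noteq> 0 \<Longrightarrow> k = c \<or> R k c"
    "\<And>c. c \<in> Y \<Longrightarrow> (\<Sum>k\<in>Y. a k c) = m c"
    "\<And>k. k \<in> Y \<Longrightarrow> (\<Sum>c\<in>Y. a k c) = real (t k)"
    "\<And>k. k \<in> Y \<Longrightarrow> t k \<ge> 1"
proof -
  define flow where "flow A e a t \<longleftrightarrow>
      (\<forall>k\<in>A. \<forall>c\<in>A. a k c \<ge> 0 \<and> (a k c \<noteq> 0 \<longrightarrow> k = c \<or> R k c)) \<and>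
      (\<forall>c\<in>A. (\<Sum>k\<in>A. a k c) = m c) \<and>
      (\<forall>k\<in>A. (\<Sum>c\<in>A. a k c) + e k = real (t k) \<and> t k \<ge> 1)"
    for A and e :: "'v \<Rightarrow> real" and a :: "'v \<Rightarrow> 'v \<Rightarrow> real" and t :: "'v \<Rightarrow> nat"
  define good where "good A \<longleftrightarrow> (\<forall>e T. (\<forall>k\<in>A. e k \<ge> 0) \<longrightarrow> (\<Sum>k\<in>A. m k + e k) = real (T :: nat) \<longrightarrow>
      (\<exists>a t. flow A e a t))" for A
  have "\<exists>A. A \<subseteq> Y \<and> card A = Suc j \<and> good A" if "Suc j \<le> card Y" for j
    using that
  proof (induction j)
    case 0
    obtain r where r: "r \<in> Y" using ne by blast
    have "good {r}"
      unfolding good_def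
    proof (intro allI impI)
      fix e T assume e: "\<forall>k\<in>{r}. e k \<ge> 0" and T: "(\<Sum>k\<in>{r}. m k + e k) = real (T :: nat)"
      have "flow {r} e (\<lambda>_ _. m r) (\<lambda>_. T)" using e T m[OF r] by (auto simp: flow_def)
      then show "\<exists>a t. flow {r} e a t" by blast
    qed
    then show ?case using r by (intro exI[of _ "{r}"]) auto
  next
    case (Suc j)
    then obtain A where A: "A \<subseteq> Y" "card A = Suc j" "good A" by auto
    have finA: "finite A" using A(1) fin by (rule finite_subset)
    have "A \<noteq> Y" "A \<noteq> {}" using A(2) Suc.prems by auto
    then obtain p b where p: "p \<in> A" and b: "b \<in> Y" "b \<notin> A" and R: "R p b"
      using grow[of A] A(1) by blast
    have pb: "p \<noteq> b" using p b by blast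
    have "good (insert b A)"
      unfolding good_def
    proof (intro allI impI)
      fix e T assume e: "\<forall>k\<in>insert b A. e k \<ge> 0" and T: "(\<Sum>k\<in>insert b A. m k + e k) = real (T :: nat)"
      define s where "s = nat \<lfloor>m b + e b\<rfloor>"
      define f where "f = m b + e b - real s"
      have mb: "m b \<ge> 1" "e b \<ge> 0" using m[OF b(1)] e by auto
      have fl: "\<lfloor>m b + e b\<rfloor> \<ge> 1" using mb by (simp add: le_floor_iff)
      have s: "real s = of_int \<lfloor>m b + e b\<rfloor>" unfolding s_def using fl by (intro of_nat_nat) linarith
      have s1: "s \<ge> 1" unfolding s_def using fl by linarith
      have f: "0 \<le> f" "f \<le> m b" using mb unfolding f_def s by linarith+
      define e' where "e' = e(p := e p + f)"
      have e': "\<forall>k\<in>A. e' k \<ge> 0" using e f by (auto simp: e'_def)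
      have "(\<Sum>k\<in>A. m k + e' k) = (\<Sum>k\<in>A. (m k + e k) + (if k = p then f else 0))"
        by (intro sum.cong) (auto simp: e'_def)
      also have "\<dots> = (\<Sum>k\<in>A. m k + e k) + f" using p finA by (simp add: sum.distrib)
      also have "\<dots> = real T - real s" using T b finA by (simp add: f_def)
      finally have sumA: "(\<Sum>k\<in>A. m k + e' k) = real T - real s" .
      have "0 \<le> (\<Sum>k\<in>A. m k + e' k)"
        by (intro sum_nonneg) (use e' m A(1) in \<open>fastforce intro: add_nonneg_nonneg order_trans[OF zero_le_one]\<close>)
      then have "(\<Sum>k\<in>A. m k + e' k) = real (T - s)" using sumA by simp
      then obtain a t where at: "flow A e' a t" using A(3) e' unfolding good_def by blast
      define a' where "a' k c = (if c = b then if k = b then m b - f else if k = p then f else 0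
          else if k = b then 0 else a k c)" for k c
      define t' where "t' = t(b := s)"
      have "flow (insert b A) e a' t'"
        unfolding flow_def
      proof (intro conjI ballI)
        fix k c assume kc: "k \<in> insert b A" "c \<in> insert b A"
        show "a' k c \<ge> 0 " using kc f at by (auto simp: a'_def flow_def)
        show "a' k c \<noteq> 0 \<longrightarrow> k = c \<or> R k c" using kc R at by (auto simp: a'_def flow_def)
      next
        fix c assume c: "c \<in> insert b A"
        show "(\<Sum>k\<in>insert b A. a' k c) = m c"
        proof (cases "c = b")
          case True
          have "(\<Sum>k\<in>A. a' k b) = (\<Sum>k\<in>A. if k = p then f else 0)"
            using b by (intro sum.cong) (auto simp: a'_def)
          then have "(\<Sum>k\<in>A. a' k b) = f" using p finA by simp
          then show ?thesis using True b finA by (simp add: a'_def)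
        next
          case False
          have "(\<Sum>k\<in>A. a' k c) = (\<Sum>k\<in>A. a k c)"
            using b False by (intro sum.cong) (auto simp: a'_def)
          then show ?thesis using False c b finA at by (simp add: a'_def flow_def)
        qed
      next
        fix k assume k: "k \<in> insert b A"
        show "(\<Sum>c\<in>insert b A. a' k c) + e k = real (t' k)"
        proof (cases "k = b")
          case True
          have "(\<Sum>c\<in>A. a' b c) = 0" using b by (intro sum.neutral) (auto simp: a'_def)
          then show ?thesis using True b finA by (simp add: a'_def t'_def f_def)
        next
          case False
          then have kA: "k \<in> A" using k by simp
          have "(\<Sum>c\<in>A. a' k c) = (\<Sum>c\<in>A. a k c)"
            using b False by (intro sum.cong) (auto simp: a'_def)
          moreover have "(\<Sum>c\<in>A. a k c) + e' k = real (t k)" using at kA by (simp add: flow_def)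
          ultimately show ?thesis using False b finA by (auto simp: a'_def t'_def e'_def)
        qed
        show "1 \<le> t' k" using k s1 at by (auto simp: t'_def flow_def)
      qed
      then show "\<exists>a t. flow (insert b A) e a t" by blast
    qed
    then show ?case using A b finA by (intro exI[of _ "insert b A"]) auto
  qed
  moreover have "card Y \<ge> 1" using fin ne by (simp add: Suc_le_eq card_gt_0_iff)
  ultimately obtain A where "A \<subseteq> Y" "card A = card Y" "good A"
    by (metis One_nat_def Suc_pred' Suc_le_eq le_refl)
  then have "good Y" using fin card_subset_eq by metis
  then obtain a t where "flow Y (\<lambda>_. 0) a t"
    unfolding good_def using total by (metis (no_types, lifting) add_0_right order_refl sum.cong)
  then show ?thesis by (intro that[of a t]) (auto simp: flow_def)
qed

section \<open>Decomposing the surface measure into small pieces of equal mass\<close>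

text \<open>Half-radius caps around separated points are disjoint and have measure at least \<open>1 / N\<close>, so a
  separated set has at most \<open>N\<close> points and one of maximal size exists.\<close>

lemma maximal_separated_set:
  fixes \<delta> :: real
  assumes N: "N \<ge> 1" and \<delta>: "\<delta> > 0"
    and cap: "\<And>x :: real ^ 'n::finite. norm x = 1 \<Longrightarrow> measure sphere_measure (sphere 0 1 \<inter> ball x (\<delta> / 2)) \<ge> 1 / real N"
  obtains Y :: "(real ^ 'n) set" where "finite Y" "Y \<subseteq> sphere 0 1"
    "\<And>x y. x \<in> Y \<Longrightarrow> y \<in> Y \<Longrightarrow> x \<noteq> y \<Longrightarrow> dist x y \<ge> \<delta>"
    "\<And>x. norm x = 1 \<Longrightarrow> \<exists>y\<in>Y. dist x y < \<delta>"
proof -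
  interpret finite_measure "sphere_measure :: (real ^ 'n) measure" by (rule finite_measure_sphere_measure)
  define sep where "sep Y \<longleftrightarrow> finite Y \<and> Y \<subseteq> sphere 0 1 \<and> (\<forall>x\<in>Y. \<forall>y\<in>Y. x \<noteq> y \<longrightarrow> dist x y \<ge> \<delta>)"
    for Y :: "(real ^ 'n) set"
  have card_le: "card Y \<le> N" if Y: "sep Y" for Y
  proof -
    let ?B = "\<lambda>y. sphere 0 1 \<inter> ball y (\<delta> / 2)"
    have meas: "?B ` Y \<subseteq> sets sphere_measure"
      unfolding sets_sphere_measure by (auto simp: sets_restrict_space_iff)
    have disj: "disjoint_family_on ?B Y"
      unfolding disjoint_family_on_def
    proof (intro ballI impI)
      fix x y assume "x \<in> Y" "y \<in> Y" "x \<noteq> y"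
      then have "dist x y \<ge> \<delta> / 2 + \<delta> / 2" using Y by (auto simp: sep_def)
      then have "ball x (\<delta> / 2) \<inter> ball y (\<delta> / 2) = {}" by (rule disjoint_ballI)
      then show "?B x \<inter> ?B y = {}" by blast
    qed
    have "real (card Y) * (1 / real N) = (\<Sum>y\<in>Y. 1 / real N)" by simp
    also have "\<dots> \<le> (\<Sum>y\<in>Y. measure sphere_measure (?B y))"
      using Y by (intro sum_mono cap) (auto simp: sep_def)
    also have "\<dots> = measure sphere_measure (\<Union>y\<in>Y. ?B y)"
      using Y by (intro finite_measure_finite_Union[symmetric] meas disj) (auto simp: sep_def)
    also have "\<dots> \<le> measure sphere_measure (space (sphere_measure :: (real ^ 'n) measure))" by (rule bounded_measure)
    also have "\<dots> = 1" by (simp add: space_sphere_measure measure_sphere_measure_sphere)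
    finally show ?thesis using N by (simp add: field_simps)
  qed
  define T where "T = {card Y |Y. sep Y}"
  have T: "\<exists>Y. sep Y \<and> c = card Y" if "c \<in> T" for c using that by (auto simp: T_def)
  have "finite T" by (rule finite_subset[of _ "{..N}"]) (use card_le T in auto)
  moreover have "T \<noteq> {}" by (auto simp: T_def sep_def intro!: exI[of _ "{}"])
  ultimately obtain Y where Y: "sep Y" and card: "Max T = card Y" using T[OF Max_in] by blast
  have max: "card Z \<le> Max T" if "sep Z" for Z
    using \<open>finite T\<close> that by (intro Max_ge) (auto simp: T_def)
  show ?thesis
  proof (rule that[of Y])
    show "finite Y" "Y \<subseteq> sphere 0 1" "\<And>x y. x \<in> Y \<Longrightarrow> y \<in> Y \<Longrightarrow> x \<noteq> y \<Longrightarrow> dist x y \<ge> \<delta>"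
      using Y by (auto simp: sep_def)
    fix x :: "real^'n" assume x: "norm x = 1"
    show "\<exists>y\<in>Y. dist x y < \<delta>"
    proof (rule ccontr)
      assume "\<not> ?thesis"
      then have far: "\<delta> \<le> dist x y" if "y \<in> Y" for y using that by (auto simp: not_less)
      then have "sep (insert x Y)" using Y x by (auto simp: sep_def dist_commute)
      moreover have "x \<notin> Y" using far[of x] \<delta> by auto
      ultimately show False using max[of "insert x Y"] card Y by (simp add: sep_def)
    qed
  qed
qed

text \<open>If no two points on different sides were close, the closed balls around the two sides would
  separate the connected set \<open>S\<close>.\<close>

lemma connected_set_cover_growth:
  fixes S :: "'a::metric_space set"
  assumes S: "connected S" and Y: "finite Y" "Y \<subseteq> S" and cover: "\<And>x. x \<in> S \<Longrightarrow> \<exists>y\<in>Y. dist x y < \<delta>"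
    and A: "A \<subset> Y" "A \<noteq> {}" and \<delta>: "\<delta> > 0"
  shows "\<exists>a\<in>A. \<exists>b\<in>Y - A. dist a b \<le> 2 * \<delta>"
proof -
  let ?U = "\<Union>a\<in>A. cball a \<delta>" and ?W = "\<Union>b\<in>Y - A. cball b \<delta>"
  have fin: "finite A" "finite (Y - A)" using A(1) Y(1) by (auto intro: finite_subset)
  obtain a b where ab: "a \<in> A" "b \<in> Y - A" using A by blast
  then have "a \<in> S \<inter> ?U" "b \<in> S \<inter> ?W" using A(1) Y(2) \<delta> by force+
  then have ne: "S \<inter> ?U \<noteq> {}" "S \<inter> ?W \<noteq> {}" by blast+
  have sub: "S \<subseteq> ?U \<union> ?W"
  proof
    fix x assume "x \<in> S"
    then obtain y where "y \<in> Y" "dist x y < \<delta>" using cover by blast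
    then have "x \<in> cball y \<delta>" by (simp add: dist_commute)
    then show "x \<in> ?U \<union> ?W" using \<open>y \<in> Y\<close> by blast
  qed
  have "closed ?U" "closed ?W" using fin by (auto intro: closed_UN)
  then have "?U \<inter> ?W \<inter> S \<noteq> {}"
    using connected_closedD[OF S _ sub] ne by blast
  then obtain x a b where "a \<in> A" "b \<in> Y - A" "x \<in> cball a \<delta>" "x \<in> cball b \<delta>" by blast
  then have "a \<in> A" "b \<in> Y - A" "dist a x \<le> \<delta>" "dist b x \<le> \<delta>" by auto
  moreover have "dist a b \<le> dist a x + dist b x" by (metis dist_commute dist_triangle2)
  ultimately show ?thesis by (intro bexI[of _ a] bexI[of _ b]) auto
qed

text \<open>The Voronoi cells of a maximal separated set have \<open>N\<close>-fold mass at least \<open>1\<close> but in general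
  not an integral one.  Redistributing their masses between adjacent cells makes the masses
  integral, after which a vertex of mass \<open>t\<close> is split into \<open>t\<close> equal weights.  The weights are
  allowed to overlap; for the variance estimate below it matters only that they add up to \<open>N\<close> and
  that each of them lives on a small set.\<close>

lemma sphere_weight_partition_of_caps:
  fixes \<delta> :: real
  assumes dim: "CARD('n::finite) \<ge> 2" and N: "N \<ge> 1" and \<delta>: "\<delta> > 0"
    and cap: "\<And>x :: real ^ 'n. norm x = 1 \<Longrightarrow> measure sphere_measure (sphere 0 1 \<inter> ball x (\<delta> / 2)) \<ge> 1 / real N"
  obtains w :: "nat \<Rightarrow> real ^ 'n \<Rightarrow> real" and y :: "nat \<Rightarrow> real ^ 'n" where
    "\<And>i. i < N \<Longrightarrow> w i \<in> borel_measurable sphere_measure"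
    "\<And>i. i < N \<Longrightarrow> \<exists>B. \<forall>x. \<bar>w i x\<bar> \<le> B"
    "\<And>i x. i < N \<Longrightarrow> w i x \<ge> 0"
    "\<And>i. i < N \<Longrightarrow> (LINT x|sphere_measure. w i x) = 1"
    "\<And>i. i < N \<Longrightarrow> norm (y i) = 1"
    "\<And>i x. i < N \<Longrightarrow> w i x \<noteq> 0 \<Longrightarrow> norm (x - y i) \<le> 3 * \<delta>"
    "\<And>x. norm x = 1 \<Longrightarrow> (\<Sum>i<N. w i x) = real N"
proof -
  interpret finite_measure "sphere_measure :: (real ^ 'n) measure" by (rule finite_measure_sphere_measure)
  obtain Y :: "(real ^ 'n) set" where Y: "finite Y" "Y \<subseteq> sphere 0 1"
    and sep: "\<And>x y. x \<in> Y \<Longrightarrow> y \<in> Y \<Longrightarrow> x \<noteq> y \<Longrightarrow> dist x y \<ge> \<delta>"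
    and cover: "\<And>x. norm x = 1 \<Longrightarrow> \<exists>y\<in>Y. dist x y < \<delta>"
    by (rule maximal_separated_set[OF N \<delta> cap]) (assumption | rule that | blast)+
  obtain h where h: "bij_betw h {..<card Y} Y"
    using ex_bij_betw_nat_finite[OF Y(1)] by (auto simp: atLeast0LessThan)
  define M where "M = card Y"
  have inj: "inj_on h {..<M}" and im: "h ` {..<M} = Y" using h by (simp_all add: M_def bij_betw_def)
  have hY: "h j \<in> Y" if "j < M" for j using im that by blast
  have hsep: "dist (h i) (h j) \<ge> \<delta>" if "i < M" "j < M" "i \<noteq> j" for i j
  proof (rule sep[OF hY[OF that(1)] hY[OF that(2)]])
    show "h i \<noteq> h j" using inj_onD[OF inj, of i j] that by blast
  qed
  have hcover: "\<exists>j<M. dist x (h j) < \<delta>" if x: "norm x = 1" for x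
  proof -
    obtain y where y: "y \<in> Y" "dist x y < \<delta>" using cover[OF x] by blast
    then obtain j where "j < M" "y = h j" using im by blast
    then show ?thesis using y by blast
  qed
  have hS: "norm (h j) = 1" if "j < M" for j using hY[OF that] Y(2) by auto
  \<comment> \<open>Ties between nearest centres are broken in favour of the smallest index.\<close>
  define V where "V j = {x. norm x = 1 \<and> (\<forall>i<M. dist x (h j) \<le> dist x (h i)) \<and> (\<forall>i<j. dist x (h j) < dist x (h i))}" for j
  have V_unique: "i = j" if "x \<in> V i" "x \<in> V j" "i < M" "j < M" for x i j
  proof (rule ccontr)
    assume "i \<noteq> j"
    then consider "i < j" | "j < i" by linarith
    then show False
    proof cases
      case 1
      then have "dist x (h j) < dist x (h i)" "dist x (h i) \<le> dist x (h j)" using that by (simp_all add: V_def)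
      then show False by simp
    next
      case 2
      then have "dist x (h i) < dist x (h j)" "dist x (h j) \<le> dist x (h i)" using that by (simp_all add: V_def)
      then show False by simp
    qed
  qed
  have V_ex: "\<exists>j<M. x \<in> V j" if x: "norm x = 1" for x
  proof -
    define Q where "Q j \<longleftrightarrow> j < M \<and> (\<forall>i<M. dist x (h j) \<le> dist x (h i))" for j
    have "{..<M} \<noteq> {}" using hcover[OF x] by auto
    then obtain j where "is_arg_min (\<lambda>j. dist x (h j)) (\<lambda>j. j \<in> {..<M}) j"
      using ex_is_arg_min_if_finite[of "{..<M}" "\<lambda>j. dist x (h j)"] by blast
    then have "Q j" unfolding Q_def is_arg_min_linorder by simp
    define l where "l = (LEAST j. Q j)"
    have Ql: "Q l" unfolding l_def using \<open>Q j\<close> by (rule LeastI)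
    have "dist x (h l) < dist x (h i)" if "i < l" for i
    proof -
      have "\<not> Q i" using that unfolding l_def by (rule not_less_Least)
      moreover have "i < M" using that Ql by (simp add: Q_def)
      ultimately obtain i' where "i' < M" "dist x (h i') < dist x (h i)" by (auto simp: Q_def not_le)
      then show ?thesis using Ql unfolding Q_def by force
    qed
    then show ?thesis using Ql x by (auto simp: V_def Q_def)
  qed
  have V_meas: "V j \<in> sets sphere_measure" for j
  proof -
    have "V j \<subseteq> sphere 0 1" by (auto simp: V_def)
    moreover have "V j \<in> sets borel"
    proof -
      have "V j = (sphere 0 1 \<inter> (\<Inter>i\<in>{..<M}. {x. dist x (h j) \<le> dist x (h i)})) \<inter>
          (\<Inter>i\<in>{..<j}. {x. dist x (h j) < dist x (h i)})" by (auto simp: V_def)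
      also have "\<dots> \<in> sets borel"
      proof (rule sets.Int)
        show "sphere 0 1 \<inter> (\<Inter>i\<in>{..<M}. {x. dist x (h j) \<le> dist x (h i)}) \<in> sets borel"
          by (intro borel_closed closed_Int closed_INT ballI closed_Collect_le continuous_intros) auto
        show "(\<Inter>i\<in>{..<j}. {x. dist x (h j) < dist x (h i)}) \<in> sets borel"
          by (intro borel_open open_INT ballI open_Collect_less continuous_intros) auto
      qed
      finally show ?thesis .
    qed
    ultimately show ?thesis unfolding sets_sphere_measure by (auto simp: sets_restrict_space_iff)
  qed
  have V_near: "dist x (h j) < \<delta>" if "x \<in> V j" for x j
  proof -
    have "norm x = 1" using that by (simp add: V_def)
    then obtain i where "i < M" "dist x (h i) < \<delta>" using hcover[of x] by blast
    moreover have "dist x (h j) \<le> dist x (h i)" using that \<open>i < M\<close> by (simp add: V_def)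
    ultimately show ?thesis by linarith
  qed
  define m where "m j = real N * measure sphere_measure (V j)" for j
  have m1: "m j \<ge> 1" if j: "j < M" for j
  proof -
    have "sphere 0 1 \<inter> ball (h j) (\<delta> / 2) \<subseteq> V j"
    proof
      fix x assume "x \<in> sphere 0 1 \<inter> ball (h j) (\<delta> / 2)"
      then have x: "norm x = 1" "dist x (h j) < \<delta> / 2" by (auto simp: dist_commute)
      have *: "dist x (h j) < dist x (h i)" if "i < M" "i \<noteq> j" for i
        using hsep[OF that(1) j that(2)] x(2) dist_triangle3[of "h i" "h j" x] by linarith
      then have "dist x (h j) \<le> dist x (h i)" if "i < M" for i
        using that by (cases "i = j") (auto intro: less_imp_le)
      moreover have "dist x (h j) < dist x (h i)" if "i < j" for i
        using * that j by simp
      ultimately show "x \<in> V j" using x by (simp add: V_def)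
    qed
    then have "measure sphere_measure (sphere 0 1 \<inter> ball (h j) (\<delta> / 2)) \<le> measure sphere_measure (V j)"
      by (rule finite_measure_mono) (rule V_meas)
    then have "1 / real N \<le> measure sphere_measure (V j)" using cap[OF hS[OF j]] by linarith
    then show ?thesis using N by (simp add: m_def field_simps)
  qed
  have V_pos: "measure sphere_measure (V j) > 0" if "j < M" for j
  proof -
    have "0 < real N * measure sphere_measure (V j)" using m1[OF that] unfolding m_def by linarith
    then show ?thesis by (simp add: zero_less_mult_iff)
  qed
  have total: "(\<Sum>j<M. m j) = real N"
  proof -
    have "(\<Sum>j<M. measure sphere_measure (V j)) = measure sphere_measure (\<Union>j<M. V j)"
      by (rule finite_measure_finite_Union[symmetric]) (use V_meas V_unique in \<open>auto simp: disjoint_family_on_def\<close>)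
    also have "(\<Union>j<M. V j) = sphere 0 1"
    proof
      show "(\<Union>j<M. V j) \<subseteq> sphere 0 1" by (auto simp: V_def)
      show "sphere 0 1 \<subseteq> (\<Union>j<M. V j)" 
      proof
        fix x :: "real ^ 'n" assume "x \<in> sphere 0 1"
        then have "norm x = 1" by simp
        from V_ex[OF this] show "x \<in> (\<Union>j<M. V j)" by blast
      qed
    qed
    finally show ?thesis by (simp add: m_def measure_sphere_measure_sphere flip: sum_distrib_left)
  qed
  have "connected (sphere (0 :: real ^ 'n) 1)" by (rule connected_sphere) (use dim in simp)
  note grow0 = connected_set_cover_growth[OF this Y, of \<delta>]
  have grow: "\<exists>a\<in>A. \<exists>b\<in>{..<M} - A. dist (h a) (h b) \<le> 2 * \<delta>" if A: "A \<subset> {..<M}" "A \<noteq> {}" for A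
  proof -
    obtain b where b: "b \<in> {..<M}" "b \<notin> A" using A(1) by blast
    have "h b \<notin> h ` A" using inj b A(1) by (subst inj_on_image_mem_iff[of h "{..<M}"]) auto
    then have "h ` A \<subset> Y" using A(1) im b by blast
    then have "\<exists>a\<in>h ` A. \<exists>b\<in>Y - h ` A. dist a b \<le> 2 * \<delta>"
      using A(2) cover \<delta> by (intro grow0) auto
    then show ?thesis using im by blast
  qed
  have ne: "{..<M} \<noteq> {}" using total N by auto
  obtain a t where a0: "\<And>k c. k \<in> {..<M} \<Longrightarrow> c \<in> {..<M} \<Longrightarrow> a k c \<ge> 0"
    and aR: "\<And>k c. k \<in> {..<M} \<Longrightarrow> c \<in> {..<M} \<Longrightarrow> a k c \<noteq> 0 \<Longrightarrow> k = c \<or> dist (h k) (h c) \<le> 2 * \<delta>"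
    and col: "\<And>c. c \<in> {..<M} \<Longrightarrow> (\<Sum>k\<in>{..<M}. a k c) = m c"
    and row: "\<And>k. k \<in> {..<M} \<Longrightarrow> (\<Sum>c\<in>{..<M}. a k c) = real (t k)"
    and t1: "\<And>k. k \<in> {..<M} \<Longrightarrow> t k \<ge> 1"
    by (rule integral_redistribution[OF finite_lessThan ne grow m1 total]) auto
  define W where "W k x = (\<Sum>c<M. a k c / measure sphere_measure (V c) * indicator (V c) x)" for k x
  have W_meas: "W k \<in> borel_measurable sphere_measure" for k
    unfolding W_def using V_meas by (intro borel_measurable_sum borel_measurable_times) auto
  have W0: "W k x \<ge> 0" if "k < M" for k x
    unfolding W_def using that a0 by (intro sum_nonneg mult_nonneg_nonneg divide_nonneg_nonneg) auto
  have W_bound: "\<bar>W k x\<bar> \<le> (\<Sum>c<M. a k c / measure sphere_measure (V c))" if "k < M" for k x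
    unfolding W_def by (rule order_trans[OF sum_abs sum_mono])
      (use a0 that in \<open>auto simp: abs_mult indicator_def\<close>)
  have W_int: "(LINT x|sphere_measure. W k x) = real (t k)" if k: "k < M" for k
  proof -
    have "(LINT x|sphere_measure. W k x) = (\<Sum>c<M. LINT x|sphere_measure. a k c / measure sphere_measure (V c) * indicator (V c) x)"
      unfolding W_def using V_meas
      by (intro Bochner_Integration.integral_sum integrable_mult_right integrable_real_indicator) (auto simp flip: top.not_eq_extremum)
    also have "\<dots> = (\<Sum>c<M. a k c)"
    proof (rule sum.cong[OF refl])
      fix c assume "c \<in> {..<M}"
      then show "(LINT x|sphere_measure. a k c / measure sphere_measure (V c) * indicator (V c) x) = a k c"
        using V_pos[of c] sets.sets_into_space[OF V_meas[of c]] by (simp add: Int_absorb2)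
    qed
    finally show ?thesis using row k by simp
  qed
  have W_sum: "(\<Sum>k<M. W k x) = real N" if x: "norm x = 1" for x
  proof -
    obtain j where j: "j < M" "x \<in> V j" using V_ex[OF x] by blast
    have ind: "indicator (V c) x = (if c = j then 1 else (0::real))" if "c < M" for c
    proof (cases "c = j")
      case False
      then have "x \<notin> V c" using V_unique[OF _ j(2) that j(1)] by blast
      then show ?thesis using False by simp
    qed (simp add: j)
    have "(\<Sum>k<M. W k x) = (\<Sum>c<M. (\<Sum>k<M. a k c) / measure sphere_measure (V c) * indicator (V c) x)"
      unfolding W_def by (subst sum.swap) (simp add: sum_divide_distrib sum_distrib_right)
    also have "\<dots> = (\<Sum>c<M. if c = j then real N else 0)"
    proof (rule sum.cong[OF refl])
      fix c assume c: "c \<in> {..<M}"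
      then have "measure sphere_measure (V c) \<noteq> 0" using V_pos[of c] by simp
      then show "(\<Sum>k<M. a k c) / measure sphere_measure (V c) * indicator (V c) x = (if c = j then real N else 0)"
        using ind[of c] c col[OF c] by (simp add: m_def)
    qed
    finally show ?thesis using j by simp
  qed
  have W_supp: "norm (x - h k) \<le> 3 * \<delta>" if k: "k < M" and Wk: "W k x \<noteq> 0" for k x
  proof -
    obtain c where c: "c < M" "a k c \<noteq> 0" "x \<in> V c"
    proof -
      have "\<exists>c<M. a k c \<noteq> 0 \<and> x \<in> V c"
      proof (rule ccontr)
        assume "\<not> ?thesis"
        then have "W k x = 0" unfolding W_def by (intro sum.neutral) (auto simp: indicator_def)
        then show False using Wk by simp
      qed
      then show ?thesis using that by blast
    qed
    have "dist x (h c) < \<delta>" using V_near[OF c(3)] .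
    moreover have "dist (h k) (h c) \<le> 2 * \<delta>" using aR[of k c] k c \<delta> by fastforce
    moreover have "dist x (h k) \<le> dist x (h c) + dist (h k) (h c)" by (rule dist_triangle2)
    ultimately show ?thesis by (simp add: dist_norm)
  qed
  let ?I = "SIGMA k:{..<M}. {..<t k}"
  have "real (\<Sum>k<M. t k) = (\<Sum>k<M. \<Sum>c<M. a k c)" by (simp add: row)
  also have "\<dots> = real N" by (subst sum.swap) (simp add: col total)
  finally have "(\<Sum>k<M. t k) = N" by (simp only: of_nat_eq_iff)
  then have "card ?I = N" by simp
  then obtain g where g: "bij_betw g {..<N} ?I"
    using ex_bij_betw_nat_finite[of ?I] by (auto simp: atLeast0LessThan)
  have gM: "fst (g i) < M" if "i < N" for i using bij_betw_apply[OF g, of i] that by auto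
  have gt: "real (t (fst (g i))) \<ge> 1" if "i < N" for i using t1[of "fst (g i)"] gM[OF that] by simp
  show ?thesis
  proof (rule that[of "\<lambda>i x. W (fst (g i)) x / real (t (fst (g i)))" "\<lambda>i. h (fst (g i))"])
    fix i assume i: "i < N"
    show "(\<lambda>x. W (fst (g i)) x / real (t (fst (g i)))) \<in> borel_measurable sphere_measure"
      using W_meas by simp
    show "\<exists>B. \<forall>x. \<bar>W (fst (g i)) x / real (t (fst (g i)))\<bar> \<le> B"
      using W_bound[OF gM[OF i]] gt[OF i]
      by (intro exI[of _ "(\<Sum>c<M. a (fst (g i)) c / measure sphere_measure (V c)) / real (t (fst (g i)))"])
        (auto simp: abs_divide intro!: divide_right_mono)
    show "W (fst (g i)) x / real (t (fst (g i))) \<ge> 0" for x using W0[OF gM[OF i]] by simp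
    show "(LINT x|sphere_measure. W (fst (g i)) x / real (t (fst (g i)))) = 1"
      using W_int[OF gM[OF i]] gt[OF i] by simp
    show "norm (h (fst (g i))) = 1" by (rule hS[OF gM[OF i]])
    show "norm (x - h (fst (g i))) \<le> 3 * \<delta>" if "W (fst (g i)) x / real (t (fst (g i))) \<noteq> 0" for x
      using that by (intro W_supp gM i) auto
  next
    fix x :: "real ^ 'n" assume x: "norm x = 1"
    have "(\<Sum>i<N. W (fst (g i)) x / real (t (fst (g i)))) = (\<Sum>p\<in>?I. W (fst p) x / real (t (fst p)))"
      by (rule sum.reindex_bij_betw[OF g])
    also have "\<dots> = (\<Sum>k<M. \<Sum>l<t k. W k x / real (t k))"
      by (subst sum.Sigma) (auto simp: case_prod_unfold)
    also have "\<dots> = (\<Sum>k<M. W k x)" using t1 by (intro sum.cong) (fastforce)+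
    finally show "(\<Sum>i<N. W (fst (g i)) x / real (t (fst (g i)))) = real N" using W_sum[OF x] by simp
  qed
qed

text \<open>Three times four times the radius at which the lower bound for the measure of a cap equals
  \<open>1 / N\<close>: caps of twice that radius have measure at least \<open>1 / N\<close> whether or not the radius
  exceeds \<open>1\<close>, which gives the separation \<open>\<delta>\<close> a factor of four, and the weights have support in
  balls of radius \<open>3 * \<delta>\<close>.\<close>

definition cell_radius :: "'n::finite itself \<Rightarrow> nat \<Rightarrow> real" where
  "cell_radius T N = 12 * (2 * 8 ^ CARD('n) / real N) powr (1 / real (CARD('n) - 1))"

lemma sphere_weight_partition:
  assumes dim: "CARD('n::finite) \<ge> 2" and N: "N \<ge> 1"
  obtains w :: "nat \<Rightarrow> real ^ 'n \<Rightarrow> real" and y :: "nat \<Rightarrow> real ^ 'n" where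
    "\<And>i. i < N \<Longrightarrow> w i \<in> borel_measurable sphere_measure"
    "\<And>i. i < N \<Longrightarrow> \<exists>B. \<forall>x. \<bar>w i x\<bar> \<le> B"
    "\<And>i x. i < N \<Longrightarrow> w i x \<ge> 0"
    "\<And>i. i < N \<Longrightarrow> (LINT x|sphere_measure. w i x) = 1"
    "\<And>i. i < N \<Longrightarrow> norm (y i) = 1"
    "\<And>i x. i < N \<Longrightarrow> w i x \<noteq> 0 \<Longrightarrow> norm (x - y i) \<le> cell_radius TYPE('n) N"
    "\<And>x. norm x = 1 \<Longrightarrow> (\<Sum>i<N. w i x) = real N"
proof -
  interpret finite_measure "sphere_measure :: (real ^ 'n) measure" by (rule finite_measure_sphere_measure)
  define d where "d = CARD('n) - 1"
  have d: "d \<ge> 1" using dim by (simp add: d_def)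
  define r where "r = (2 * 8 ^ CARD('n) / real N) powr (1 / real d)"
  have r: "r > 0" using N by (simp add: r_def)
  have "r ^ d = r powr real d" using r by (simp add: powr_realpow)
  also have "\<dots> = 2 * 8 ^ CARD('n) / real N" using d N by (simp add: r_def powr_powr)
  finally have rd: "r ^ d = 2 * 8 ^ CARD('n) / real N" .
  have cap: "measure sphere_measure (sphere 0 1 \<inter> ball x (4 * r / 2)) \<ge> 1 / real N" if x: "norm x = 1" for x :: "real^'n"
  proof (cases "r \<le> 1")
    case True
    have "1 / real N = r ^ d / (2 * 8 ^ CARD('n))" by (simp add: rd)
    also have "\<dots> \<le> measure sphere_measure (sphere 0 1 \<inter> ball x r)"
      unfolding d_def by (rule cap_measure_lower_bound[OF x r True])
    also have "\<dots> \<le> measure sphere_measure (sphere 0 1 \<inter> ball x (4 * r / 2))"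
      by (rule finite_measure_mono) (use r in \<open>auto simp: sets_sphere_measure sets_restrict_space_iff\<close>)
    finally show ?thesis .
  next
    case False
    have "sphere 0 1 \<subseteq> ball x (4 * r / 2)"
    proof
      fix z :: "real^'n" assume "z \<in> sphere 0 1"
      then have "dist x z \<le> 2" using x norm_triangle_ineq4[of x z] by (simp add: dist_norm)
      then show "z \<in> ball x (4 * r / 2)" using False by simp
    qed
    then show ?thesis using N by (simp add: Int_absorb2 measure_sphere_measure_sphere)
  qed
  have "4 * r > 0" using r by simp
  have rad: "3 * (4 * r) = cell_radius TYPE('n) N" by (simp add: cell_radius_def r_def d_def)
  show ?thesis
    by (rule sphere_weight_partition_of_caps[OF dim N \<open>4 * r > 0\<close> cap, unfolded rad])
      (assumption | rule that | blast)+
qed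

section \<open>Points with small mean error\<close>

text \<open>For independent random points with densities \<open>w i\<close> the expected value of the left hand side is
  the sum of the variances, hence at most \<open>N * V\<close>.  The points are found one by one: given the
  deviation \<open>S\<close> of the earlier points, the average over the next point of the squared norm of the
  deviation is the square of the norm of \<open>S\<close> plus a variance, because the cross term vanishes.\<close>

lemma exists_points_small_total_deviation:
  fixes g :: "nat \<Rightarrow> real ^ 'n::finite \<Rightarrow> real" and w :: "nat \<Rightarrow> real ^ 'n \<Rightarrow> real"
  assumes g: "\<And>k. k < D \<Longrightarrow> continuous_on UNIV (g k)"
    and w: "\<And>i. i < N \<Longrightarrow> w i \<in> borel_measurable sphere_measure"
    and wB: "\<And>i. i < N \<Longrightarrow> \<exists>B. \<forall>x. \<bar>w i x\<bar> \<le> B"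
    and w0: "\<And>i x. i < N \<Longrightarrow> w i x \<ge> 0"
    and w1: "\<And>i. i < N \<Longrightarrow> (LINT x|sphere_measure. w i x) = 1"
    and y: "\<And>i. i < N \<Longrightarrow> norm (y i) = 1"
    and near: "\<And>i x. i < N \<Longrightarrow> w i x \<noteq> 0 \<Longrightarrow> norm x = 1 \<Longrightarrow> (\<Sum>k<D. (g k x - g k (y i))\<^sup>2) \<le> V"
  shows "\<exists>x. (\<forall>i<N. norm (x i) = 1) \<and>
     (\<Sum>k<D. (\<Sum>i<N. g k (x i) - (LINT z|sphere_measure. w i z * g k z))\<^sup>2) \<le> real N * V"
proof -
  define E where "E i k = (LINT z|sphere_measure. w i z * g k z)" for i k
  have "\<exists>x. (\<forall>i<j. norm (x i) = 1) \<and> (\<Sum>k<D. (\<Sum>i<j. g k (x i) - E i k)\<^sup>2) \<le> real j * V" if "j \<le> N" for j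
    using that
  proof (induction j)
    case 0 show ?case by simp
  next
    case (Suc j)
    then have j: "j < N" by simp
    from Suc obtain x where x: "\<forall>i<j. norm (x i) = 1"
      and IH: "(\<Sum>k<D. (\<Sum>i<j. g k (x i) - E i k)\<^sup>2) \<le> real j * V" by auto
    define S where "S k = (\<Sum>i<j. g k (x i) - E i k)" for k
    obtain B where B: "\<And>x. \<bar>w j x\<bar> \<le> B" using wB[OF j] by blast
    define I where "I f = (LINT z|sphere_measure. w j z * f z)" for f
    note int = integrable_sphere_weighted[OF _ w[OF j] B]
    have I_add: "I (\<lambda>z. f z + h z) = I f + I h" if "continuous_on UNIV f" "continuous_on UNIV h" for f h
      unfolding I_def distrib_left by (intro Bochner_Integration.integral_add int that)
    have I_cmult: "I (\<lambda>z. c * f z) = c * I f" for c f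
      unfolding I_def mult.left_commute[of _ c] by simp
    have I_const: "I (\<lambda>z. c) = c" for c unfolding I_def using w1[OF j] by simp
    have I_sum: "I (\<lambda>z. \<Sum>k<D. f k z) = (\<Sum>k<D. I (f k))" if "\<And>k. k < D \<Longrightarrow> continuous_on UNIV (f k)" for f
      unfolding I_def sum_distrib_left by (intro Bochner_Integration.integral_sum int that) simp
    have I_mono: "I f \<le> I h" if "continuous_on UNIV f" "continuous_on UNIV h"
      "\<And>z. norm z = 1 \<Longrightarrow> w j z \<noteq> 0 \<Longrightarrow> f z \<le> h z" for f h
      unfolding I_def
    proof (intro integral_mono int that)
      fix z :: "real^'n" assume "z \<in> space sphere_measure"
      then have "norm z = 1" by (simp add: space_sphere_measure)
      then show "w j z * f z \<le> w j z * h z"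
        using that(3)[of z] w0[OF j, of z] by (cases "w j z = 0") (auto intro: mult_left_mono)
    qed
    have I_sq: "I (\<lambda>z. (g k z + c)\<^sup>2) = I (\<lambda>z. (g k z)\<^sup>2) + 2 * c * E j k + c\<^sup>2" if k: "k < D" for k c
    proof -
      have "I (\<lambda>z. (g k z + c)\<^sup>2) = I (\<lambda>z. ((g k z)\<^sup>2 + (2 * c) * g k z) + c\<^sup>2)"
        by (simp add: power2_sum algebra_simps)
      also have "\<dots> = I (\<lambda>z. (g k z)\<^sup>2 + (2 * c) * g k z) + I (\<lambda>z. c\<^sup>2)"
        using g[OF k] by (intro I_add continuous_intros)
      also have "I (\<lambda>z. (g k z)\<^sup>2 + (2 * c) * g k z) = I (\<lambda>z. (g k z)\<^sup>2) + I (\<lambda>z. (2 * c) * g k z)"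
        using g[OF k] by (intro I_add continuous_intros)
      also have "\<dots> + I (\<lambda>z. c\<^sup>2) = I (\<lambda>z. (g k z)\<^sup>2) + 2 * c * I (g k) + c\<^sup>2"
        by (simp only: I_cmult I_const)
      finally show ?thesis by (simp add: I_def E_def)
    qed
    have cont: "continuous_on UNIV (\<lambda>z. \<Sum>k<D. (g k z + c k)\<^sup>2)" for c
      using g by (intro continuous_intros) auto
    define F where "F z = (\<Sum>k<D. (g k z + (S k - E j k))\<^sup>2)" for z
    have "sphere 0 1 \<noteq> ({} :: (real^'n) set)" using y[OF j] by (auto intro!: exI[of _ "y j"])
    then obtain z0 where z0: "norm z0 = 1" and min: "\<And>z. norm z = 1 \<Longrightarrow> F z0 \<le> F z"
      using continuous_attains_inf[of "sphere (0 :: real^'n) 1" F] continuous_on_subset[OF cont, of "sphere 0 1"]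
      unfolding F_def by auto
    have "F z0 = I (\<lambda>z. F z0)" by (simp add: I_const)
    also have "\<dots> \<le> I F" using cont[of "\<lambda>k. S k - E j k"] min by (intro I_mono) (auto simp: F_def[abs_def])
    also have "I F = (\<Sum>k<D. I (\<lambda>z. (g k z + (S k - E j k))\<^sup>2))"
      unfolding F_def using g by (intro I_sum continuous_intros) auto
    also have "\<dots> = (\<Sum>k<D. (S k)\<^sup>2 + (I (\<lambda>z. (g k z)\<^sup>2) - (E j k)\<^sup>2))"
    proof (rule sum.cong[OF refl])
      fix k assume "k \<in> {..<D}"
      then show "I (\<lambda>z. (g k z + (S k - E j k))\<^sup>2) = (S k)\<^sup>2 + (I (\<lambda>z. (g k z)\<^sup>2) - (E j k)\<^sup>2)"
        by (simp only: I_sq lessThan_iff) (simp add: power2_eq_square algebra_simps)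
    qed
    \<comment> \<open>The variance does not exceed the second moment around any other centre.\<close>
    also have "\<dots> \<le> (\<Sum>k<D. (S k)\<^sup>2 + I (\<lambda>z. (g k z + (- g k (y j)))\<^sup>2))"
    proof (intro sum_mono add_left_mono)
      fix k assume "k \<in> {..<D}"
      then have "I (\<lambda>z. (g k z + (- g k (y j)))\<^sup>2) - (I (\<lambda>z. (g k z)\<^sup>2) - (E j k)\<^sup>2) = (E j k - g k (y j))\<^sup>2"
        by (simp only: I_sq lessThan_iff) (simp add: power2_eq_square algebra_simps)
      then show "I (\<lambda>z. (g k z)\<^sup>2) - (E j k)\<^sup>2 \<le> I (\<lambda>z. (g k z + (- g k (y j)))\<^sup>2)"
        by (metis diff_ge_0_iff_ge zero_le_power2)
    qed
    also have "\<dots> = (\<Sum>k<D. (S k)\<^sup>2) + I (\<lambda>z. \<Sum>k<D. (g k z + (- g k (y j)))\<^sup>2)"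
      unfolding sum.distrib using g by (subst I_sum) (auto intro!: continuous_intros)
    also have "I (\<lambda>z. \<Sum>k<D. (g k z + (- g k (y j)))\<^sup>2) \<le> I (\<lambda>z. V)"
      by (rule I_mono[OF cont]) (use near[OF j] in auto)
    also have "I (\<lambda>z. V) = V" by (rule I_const)
    also have "(\<Sum>k<D. (S k)\<^sup>2) \<le> real j * V" using IH by (simp add: S_def)
    finally have "F z0 \<le> real (Suc j) * V" by (simp add: algebra_simps)
    moreover have "F z0 = (\<Sum>k<D. (\<Sum>i<Suc j. g k ((x(j := z0)) i) - E i k)\<^sup>2)"
      unfolding F_def S_def by (intro sum.cong refl) (simp add: algebra_simps)
    ultimately show ?case using x z0 by (intro exI[of _ "x(j := z0)"]) (auto simp: less_Suc_eq)
  qed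
  from this[of N] show ?thesis by (simp add: E_def)
qed

definition mean_error :: "nat \<Rightarrow> (nat \<Rightarrow> real ^ 'n::finite) \<Rightarrow> (real ^ 'n \<Rightarrow> real) \<Rightarrow> real" where
  "mean_error N x Q = (\<Sum>i<N. Q (x i)) / real N - (LINT y|sphere_measure. Q y)"

lemma mean_error_add:
  assumes "poly_deg m P" "poly_deg m Q"
  shows "mean_error N x (\<lambda>y. P y + Q y) = mean_error N x P + mean_error N x Q"
  unfolding mean_error_def
  by (subst Bochner_Integration.integral_add) (use assms in \<open>auto intro: integrable_poly_deg simp: sum.distrib add_divide_distrib\<close>)

lemma mean_error_cmult: "mean_error N x (\<lambda>y. c * Q y) = c * mean_error N x Q"
  by (simp add: mean_error_def algebra_simps flip: sum_distrib_left)

lemma mean_error_sum: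
  fixes D :: nat
  assumes "\<And>k. k < D \<Longrightarrow> poly_deg m (P k)"
  shows "mean_error N x (\<lambda>y. \<Sum>k<D. c k * P k y) = (\<Sum>k<D. c k * mean_error N x (P k))"
  using assms
proof (induction D)
  case 0 show ?case by (simp add: mean_error_def)
next
  case (Suc D)
  have "poly_deg m (\<lambda>y. \<Sum>k<D. c k * P k y)" "poly_deg m (\<lambda>y. c D * P D y)"
    using Suc.prems by (auto intro!: poly_deg_sum poly_deg_cmult)
  then have "mean_error N x (\<lambda>y. (\<Sum>k<D. c k * P k y) + c D * P D y) =
      mean_error N x (\<lambda>y. \<Sum>k<D. c k * P k y) + mean_error N x (\<lambda>y. c D * P D y)"
    by (rule mean_error_add)
  then show ?case using Suc.IH Suc.prems by (simp add: mean_error_cmult)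
qed

lemma mean_error_const_on_sphere:
  assumes N: "N \<ge> 1" and x: "\<And>i. i < N \<Longrightarrow> norm (x i) = 1" and Q: "\<And>y. norm y = 1 \<Longrightarrow> Q y = c"
  shows "mean_error N (x :: nat \<Rightarrow> real ^ 'n::finite) Q = 0"
proof -
  have "(LINT y|sphere_measure. Q y) = (LINT y|(sphere_measure :: (real ^ 'n) measure). c)"
    by (rule Bochner_Integration.integral_cong) (simp_all add: space_sphere_measure Q)
  also have "\<dots> = c" by (rule integral_sphere_const)
  finally have "(LINT y|sphere_measure. Q y) = c" .
  moreover have "(\<Sum>i<N. Q (x i)) = (\<Sum>i<N. c)" by (intro sum.cong refl Q x) simp
  ultimately show ?thesis using N by (simp add: mean_error_def)
qed

lemma const_on_sphere_of_energy_zero: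
  fixes P :: "real ^ 'n::finite \<Rightarrow> real"
  assumes "CARD('n) \<ge> 2" "poly_deg m P" "energy P P = 0" "norm x = 1" "norm y = 1"
  shows "P x = P y"
  using poly_deg_lipschitz_energy[OF assms(1,2,4,5)] assms(3) by simp

text \<open>The residual of \<open>Q\<close> has energy \<open>0\<close>, so it is constant on the sphere and contributes neither
  to the mean error nor to the energy.\<close>

lemma mean_error_expansion:
  fixes x :: "nat \<Rightarrow> real ^ 'n::finite"
  assumes card: "CARD('n) \<ge> 2" and N: "N \<ge> 1" and x: "\<And>i. i < N \<Longrightarrow> norm (x i) = 1"
    and e: "energy_orthonormal m D e" and Q: "poly_deg m Q"
    and residual: "energy (\<lambda>x. Q x - (\<Sum>k<D. energy Q (e k) * e k x)) (\<lambda>x. Q x - (\<Sum>k<D. energy Q (e k) * e k x)) = 0"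
  shows "mean_error N x Q = (\<Sum>k<D. energy Q (e k) * mean_error N x (e k))"
    and "energy Q Q = (\<Sum>k<D. (energy Q (e k))\<^sup>2)"
proof -
  let ?P = "\<lambda>y. \<Sum>k<D. energy Q (e k) * e k y" and ?R = "\<lambda>x. Q x - (\<Sum>k<D. energy Q (e k) * e k x)"
  have P: "poly_deg m ?P" by (rule energy_orthonormal_combination(1)[OF e])
  have R: "poly_deg m ?R" by (rule poly_deg_diff[OF Q P])
  have ek: "poly_deg m (e k)" if "k < D" for k using e that by (simp add: energy_orthonormal_def)
  have "mean_error N x Q = mean_error N x (\<lambda>y. ?R y + ?P y)" by simp
  also have "\<dots> = mean_error N x ?R + mean_error N x ?P" by (rule mean_error_add[OF R P])
  also have "mean_error N x ?R = 0"
  proof (rule mean_error_const_on_sphere[OF N])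
    show "norm (x i) = 1" if "i < N" for i using x[OF that] .
    show "?R y = ?R (x 0)" if "norm y = 1" for y
      by (rule const_on_sphere_of_energy_zero[OF card R residual that]) (use x[of 0] N in simp)
  qed
  finally show "mean_error N x Q = (\<Sum>k<D. energy Q (e k) * mean_error N x (e k))"
    using ek by (simp add: mean_error_sum[where m = m])
  have PQ: "energy ?P Q = (\<Sum>k<D. (energy Q (e k))\<^sup>2)"
    by (simp add: energy_orthonormal_combination(3)[OF e Q] energy_commute[of "e _" Q] power2_eq_square)
  have PR: "energy ?P ?R = 0"
    using energy_diff[OF Q P P] energy_orthonormal_combination(4)[OF e, of "\<lambda>k. energy Q (e k)"] PQ
      energy_commute[of ?P Q] energy_commute[of ?P ?R] by simp
  show "energy Q Q = (\<Sum>k<D. (energy Q (e k))\<^sup>2)"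
    using energy_diff[OF Q P R] energy_diff[OF Q P Q] residual PR PQ energy_commute[of Q ?R] by simp
qed

text \<open>Up to constants this is \<open>m ^ d * N powr (- 1 - 2 / d)\<close> on the sphere of dimension \<open>d\<close>: one
  factor \<open>1 / N\<close> comes from independence, and \<open>N powr (- 2 / d)\<close> is the squared diameter of the
  supports of the weights.\<close>

definition discrepancy_const :: "'n::finite itself \<Rightarrow> nat \<Rightarrow> nat \<Rightarrow> real" where
  "discrepancy_const T m N = 4 * nikolskii_const T (m + 2) * (cell_radius T N)\<^sup>2 / real N"

text \<open>Apply the second moment estimate to a complete orthonormal system and conclude for all
  polynomials by the Cauchy-Schwarz inequality.\<close>

lemma exists_points_small_mean_error:
  assumes card: "CARD('n::finite) \<ge> 2" and N: "N \<ge> 1"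
  obtains x :: "nat \<Rightarrow> real ^ 'n" where "\<And>i. i < N \<Longrightarrow> norm (x i) = 1"
    "\<And>Q. poly_deg m Q \<Longrightarrow> (mean_error N x Q)\<^sup>2 \<le> discrepancy_const TYPE('n) m N * energy Q Q"
proof -
  let ?K = "nikolskii_const TYPE('n) (m + 2)" and ?\<rho> = "cell_radius TYPE('n) N"
  obtain D and e :: "nat \<Rightarrow> real ^ 'n \<Rightarrow> real" where e: "energy_orthonormal m D e"
    and complete: "\<And>P. poly_deg m P \<Longrightarrow> energy (\<lambda>x. P x - (\<Sum>k<D. energy P (e k) * e k x)) (\<lambda>x. P x - (\<Sum>k<D. energy P (e k) * e k x)) = 0"
    by (rule complete_energy_orthonormal[OF card, of m]) blast
  have ek: "poly_deg m (e k)" if "k < D" for k using e that by (simp add: energy_orthonormal_def)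
  obtain w :: "nat \<Rightarrow> real ^ 'n \<Rightarrow> real" and y :: "nat \<Rightarrow> real ^ 'n" where
    w: "\<And>i. i < N \<Longrightarrow> w i \<in> borel_measurable sphere_measure"
    and wB: "\<And>i. i < N \<Longrightarrow> \<exists>B. \<forall>x. \<bar>w i x\<bar> \<le> B"
    and w0: "\<And>i x. i < N \<Longrightarrow> w i x \<ge> 0"
    and w1: "\<And>i. i < N \<Longrightarrow> (LINT x|sphere_measure. w i x) = 1"
    and y: "\<And>i. i < N \<Longrightarrow> norm (y i) = 1"
    and near: "\<And>i x. i < N \<Longrightarrow> w i x \<noteq> 0 \<Longrightarrow> norm (x - y i) \<le> ?\<rho>"
    and wN: "\<And>x. norm x = 1 \<Longrightarrow> (\<Sum>i<N. w i x) = real N"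
    by (rule sphere_weight_partition[OF card N]) blast
  have lip: "(\<Sum>k<D. (e k u - e k v)\<^sup>2) \<le> 4 * (norm (u - v))\<^sup>2 * ?K" if uv: "norm u = 1" "norm v = 1" for u v
  proof (rule energy_orthonormal_functional_bound[OF e, where \<phi> = "\<lambda>P. P u - P v"])
    show "0 \<le> 4 * (norm (u - v))\<^sup>2 * ?K" by (simp add: nikolskii_const_nonneg)
    show "\<And>P. poly_deg m P \<Longrightarrow> (P u - P v)\<^sup>2 \<le> 4 * (norm (u - v))\<^sup>2 * ?K * energy P P"
      by (rule poly_deg_lipschitz_energy[OF card _ uv])
  qed (simp add: algebra_simps sum_subtractf)
  have "\<exists>x. (\<forall>i<N. norm (x i) = 1) \<and>
     (\<Sum>k<D. (\<Sum>i<N. e k (x i) - (LINT z|sphere_measure. w i z * e k z))\<^sup>2) \<le> real N * (4 * ?\<rho>\<^sup>2 * ?K)"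
  proof (rule exists_points_small_total_deviation[OF _ w wB w0 w1 y])
    show "continuous_on UNIV (e k)" if "k < D" for k by (rule poly_deg_continuous[OF ek[OF that]])
    fix i x assume "i < N" "w i x \<noteq> 0" "norm x = 1"
    then have "(\<Sum>k<D. (e k x - e k (y i))\<^sup>2) \<le> 4 * (norm (x - y i))\<^sup>2 * ?K" using lip y by blast
    also have "\<dots> \<le> 4 * ?\<rho>\<^sup>2 * ?K"
      using near[OF \<open>i < N\<close> \<open>w i x \<noteq> 0\<close>] by (intro mult_right_mono mult_left_mono power_mono nikolskii_const_nonneg) auto
    finally show "(\<Sum>k<D. (e k x - e k (y i))\<^sup>2) \<le> 4 * ?\<rho>\<^sup>2 * ?K" .
  qed
  then obtain x where x: "\<And>i. i < N \<Longrightarrow> norm (x i) = 1"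
    and dev: "(\<Sum>k<D. (\<Sum>i<N. e k (x i) - (LINT z|sphere_measure. w i z * e k z))\<^sup>2) \<le> real N * (4 * ?\<rho>\<^sup>2 * ?K)"
    by blast
  have dev_eq: "(\<Sum>i<N. e k (x i) - (LINT z|sphere_measure. w i z * e k z)) = real N * mean_error N x (e k)" if k: "k < D" for k
  proof -
    have "(\<Sum>i<N. LINT z|sphere_measure. w i z * e k z) = (LINT z|sphere_measure. (\<Sum>i<N. w i z * e k z))"
    proof (rule Bochner_Integration.integral_sum[symmetric])
      fix i assume "i \<in> {..<N}"
      then have i: "i < N" by simp
      obtain B where "\<And>x. \<bar>w i x\<bar> \<le> B" using wB[OF i] by blast
      then show "integrable sphere_measure (\<lambda>z. w i z * e k z)"
        by (rule integrable_sphere_weighted[OF poly_deg_continuous[OF ek[OF k]] w[OF i]])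
    qed
    also have "\<dots> = (LINT z|sphere_measure. real N * e k z)"
      by (rule Bochner_Integration.integral_cong) (auto simp: space_sphere_measure wN simp flip: sum_distrib_right)
    finally show ?thesis using N by (simp add: sum_subtractf mean_error_def algebra_simps)
  qed
  have "(real N)\<^sup>2 * (\<Sum>k<D. (mean_error N x (e k))\<^sup>2) \<le> real N * (4 * ?\<rho>\<^sup>2 * ?K)"
    using dev by (simp add: dev_eq power_mult_distrib flip: sum_distrib_left)
  then have total: "(\<Sum>k<D. (mean_error N x (e k))\<^sup>2) \<le> discrepancy_const TYPE('n) m N"
    using N by (simp add: discrepancy_const_def field_simps power2_eq_square)
  show ?thesis
  proof (rule that[OF x])
    fix Q :: "real ^ 'n \<Rightarrow> real" assume Q: "poly_deg m Q"
    have exp: "mean_error N x Q = (\<Sum>k<D. energy Q (e k) * mean_error N x (e k))"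
      "energy Q Q = (\<Sum>k<D. (energy Q (e k))\<^sup>2)"
      by (rule mean_error_expansion[OF card N _ e Q complete[OF Q]], rule x, assumption)+
    have "(mean_error N x Q)\<^sup>2 \<le> (\<Sum>k<D. (energy Q (e k))\<^sup>2) * (\<Sum>k<D. (mean_error N x (e k))\<^sup>2)"
      unfolding exp(1) by (rule Cauchy_Schwarz_ineq_sum)
    also have "\<dots> \<le> energy Q Q * discrepancy_const TYPE('n) m N"
      unfolding exp(2)[symmetric] by (intro mult_left_mono total energy_nonneg)
    finally show "(mean_error N x Q)\<^sup>2 \<le> discrepancy_const TYPE('n) m N * energy Q Q" by (simp add: mult.commute)
  qed
qed

section \<open>Gradients at the sample points\<close>

text \<open>A Lipschitz constant, squared, of the tangential gradient of polynomials of energy \<open>1\<close>.\<close>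

definition gradient_lipschitz_const :: "'n::finite itself \<Rightarrow> nat \<Rightarrow> real" where
  "gradient_lipschitz_const T n = 16 * (real (n + 2))\<^sup>2 * nikolskii_const T (n + 2) * real CARD('n)"

lemma tgrad_component_bounds:
  fixes P :: "real ^ 'n::finite \<Rightarrow> real"
  assumes card: "CARD('n) \<ge> 2" and P: "poly_deg n P" and x: "norm x = 1"
  defines "s \<equiv> sqrt (nikolskii_const TYPE('n) (n + 2) * energy P P)"
  shows "norm (tgrad (\<lambda>y. tgrad P y $ a) x) \<le> 2 * real (n + 2) * s"
proof (rule bernstein_sphere[OF poly_deg_tgrad[OF P] _ x])
  fix y :: "real ^ 'n" assume "norm y = 1"
  then have "norm (tgrad P y) \<le> s"
    unfolding s_def by (intro real_le_rsqrt norm_tgrad_squared_le_energy[OF card P])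
  then show "\<bar>tgrad P y $ a\<bar> \<le> s" using component_le_norm_cart[of "tgrad P y" a] by linarith
qed simp

lemma tgrad_lipschitz:
  fixes P :: "real ^ 'n::finite \<Rightarrow> real"
  assumes card: "CARD('n) \<ge> 2" and P: "poly_deg n P" and xy: "norm x = 1" "norm y = 1"
  shows "(norm (tgrad P x - tgrad P y))\<^sup>2 \<le> gradient_lipschitz_const TYPE('n) n * energy P P * (norm (x - y))\<^sup>2"
proof -
  let ?K = "nikolskii_const TYPE('n) (n + 2) * energy P P"
  have K: "?K \<ge> 0" by (intro mult_nonneg_nonneg nikolskii_const_nonneg energy_nonneg)
  have "((tgrad P x - tgrad P y) $ a)\<^sup>2 \<le> 16 * (real (n + 2))\<^sup>2 * ?K * (norm (x - y))\<^sup>2" for a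
  proof -
    have "\<bar>tgrad P x $ a - tgrad P y $ a\<bar> \<le> 2 * (2 * real (n + 2) * sqrt ?K) * norm (x - y)"
      by (rule poly_deg_lipschitz_sphere[OF card poly_deg_tgrad[OF P] xy]) (rule tgrad_component_bounds[OF card P])
    then have "\<bar>tgrad P x $ a - tgrad P y $ a\<bar>\<^sup>2 \<le> (2 * (2 * real (n + 2) * sqrt ?K) * norm (x - y))\<^sup>2"
      by (rule power_mono) simp
    also have "\<dots> = 16 * (real (n + 2))\<^sup>2 * ?K * (norm (x - y))\<^sup>2"
      using K by (simp only: power_mult_distrib real_sqrt_pow2) simp
    finally show ?thesis by simp
  qed
  then have "(norm (tgrad P x - tgrad P y))\<^sup>2 \<le> (\<Sum>a\<in>(UNIV::'n set). 16 * (real (n + 2))\<^sup>2 * ?K * (norm (x - y))\<^sup>2)"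
    unfolding norm_squared_vec by (rule sum_mono)
  then show ?thesis by (simp add: gradient_lipschitz_const_def mult_ac)
qed

text \<open>The gradient of \<open>\<Sum>a. (tgrad P x $ a)\<^sup>2\<close> is at most a constant times \<open>norm (tgrad P x)\<close>
  times a bound for the gradients of the components of \<open>tgrad P\<close>.  Taking only the latter in the supremum norm and
  integrating the former gives the energy of \<open>P\<close> once more.\<close>

lemma energy_norm_tgrad_squared_le:
  fixes P :: "real ^ 'n::finite \<Rightarrow> real"
  assumes card: "CARD('n) \<ge> 2" and P: "poly_deg n P"
  shows "energy (\<lambda>x. tgrad P x \<bullet> tgrad P x) (\<lambda>x. tgrad P x \<bullet> tgrad P x)
    \<le> gradient_lipschitz_const TYPE('n) n * (energy P P)\<^sup>2"
proof -
  let ?K = "nikolskii_const TYPE('n) (n + 2) * energy P P" and ?L = "gradient_lipschitz_const TYPE('n) n"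
  define Q where "Q x = tgrad P x \<bullet> tgrad P x" for x
  have K: "?K \<ge> 0" by (intro mult_nonneg_nonneg nikolskii_const_nonneg energy_nonneg)
  have Qd: "poly_deg (n + 2 + (n + 2)) Q" unfolding Q_def by (rule poly_deg_inner_tgrad[OF P P])
  have pt: "tgrad Q x \<bullet> tgrad Q x \<le> ?L * energy P P * Q x" if x: "norm x = 1" for x
  proof -
    let ?s = "4 * real (n + 2) * sqrt ?K"
    have g: "poly_deg (n + 2) (\<lambda>y. tgrad P y $ a)" for a by (rule poly_deg_tgrad[OF P])
    have "tgrad Q x = tgrad (\<lambda>y. \<Sum>a\<in>UNIV. tgrad P y $ a * tgrad P y $ a) x"
      by (simp only: Q_def[abs_def] inner_vec_def inner_real_def)
    also have "\<dots> = (\<Sum>a\<in>UNIV. tgrad (\<lambda>y. tgrad P y $ a * tgrad P y $ a) x)"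
      by (rule tgrad_sum[where m = "n + 2 + (n + 2)"]) (rule poly_deg_mult[OF g g])
    also have "\<dots> = (\<Sum>a\<in>UNIV. (2 * tgrad P x $ a) *\<^sub>R tgrad (\<lambda>y. tgrad P y $ a) x)"
      unfolding tgrad_mult[OF g g] mult_2 scaleR_add_left by (rule refl)
    finally have "norm (tgrad Q x) \<le> (\<Sum>a\<in>UNIV. norm ((2 * tgrad P x $ a) *\<^sub>R tgrad (\<lambda>y. tgrad P y $ a) x))"
      by (simp only: norm_sum)
    also have "\<dots> \<le> (\<Sum>a\<in>UNIV. \<bar>2 * tgrad P x $ a\<bar> * (2 * real (n + 2) * sqrt ?K))"
      unfolding norm_scaleR by (intro sum_mono mult_left_mono tgrad_component_bounds[OF card P x]) simp
    also have "\<dots> = ?s * (\<Sum>a\<in>UNIV. \<bar>tgrad P x $ a\<bar>)"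
      unfolding sum_distrib_left by (intro sum.cong refl) (simp add: abs_mult)
    finally have "(norm (tgrad Q x))\<^sup>2 \<le> (?s * (\<Sum>a\<in>UNIV. \<bar>tgrad P x $ a\<bar>))\<^sup>2"
      by (rule power_mono) simp
    also have "\<dots> = ?s\<^sup>2 * (\<Sum>a\<in>UNIV. \<bar>tgrad P x $ a\<bar>)\<^sup>2" by (rule power_mult_distrib)
    also have "\<dots> \<le> ?s\<^sup>2 * ((\<Sum>a\<in>UNIV. \<bar>tgrad P x $ a\<bar>\<^sup>2) * real CARD('n))"
      by (intro mult_left_mono sum_squared_le_sum_of_squares) simp
    also have "(\<Sum>a\<in>UNIV. \<bar>tgrad P x $ a\<bar>\<^sup>2) = Q x"
      by (simp add: Q_def inner_vec_def power2_eq_square)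
    also have "?s\<^sup>2 = 16 * (real (n + 2))\<^sup>2 * ?K"
      using K by (simp only: power_mult_distrib real_sqrt_pow2) simp
    finally have "tgrad Q x \<bullet> tgrad Q x \<le> 16 * (real (n + 2))\<^sup>2 * ?K * (Q x * real CARD('n))"
      by (simp only: power2_norm_eq_inner)
    also have "\<dots> = ?L * energy P P * Q x" unfolding gradient_lipschitz_const_def by (simp only: mult_ac)
    finally show ?thesis .
  qed
  have "energy Q Q \<le> (LINT x|sphere_measure. ?L * energy P P * Q x)"
    unfolding energy_def[of Q Q]
  proof (rule integral_mono)
    show "integrable sphere_measure (\<lambda>x. tgrad Q x \<bullet> tgrad Q x)"
      by (rule integrable_poly_deg[OF poly_deg_inner_tgrad[OF Qd Qd]])
    show "integrable sphere_measure (\<lambda>x. ?L * energy P P * Q x)"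
      by (rule integrable_poly_deg[OF poly_deg_cmult[OF Qd]])
  qed (use pt in \<open>auto simp: space_sphere_measure\<close>)
  also have "\<dots> = ?L * energy P P * energy P P"
    by (simp add: energy_def[of P P] Q_def)
  finally show ?thesis by (simp add: Q_def[abs_def] power2_eq_square)
qed

text \<open>The squared length of the gradient is itself a polynomial, so points that sample polynomials of
  twice the degree well also detect the energy of \<open>P\<close>.\<close>

lemma energy_le_sampled_gradient:
  fixes P :: "real ^ 'n::finite \<Rightarrow> real"
  assumes card: "CARD('n) \<ge> 2" and P: "poly_deg n P"
    and disc: "\<And>Q. poly_deg (n + 2 + (n + 2)) Q \<Longrightarrow> (mean_error N x Q)\<^sup>2 \<le> \<eta> * energy Q Q"
    and \<eta>: "\<eta> \<ge> 0" "4 * gradient_lipschitz_const TYPE('n) n * \<eta> \<le> 1"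
  shows "energy P P / 2 \<le> (\<Sum>i<N. (norm (tgrad P (x i)))\<^sup>2) / real N"
proof -
  let ?Q = "\<lambda>y. tgrad P y \<bullet> tgrad P y" and ?L = "gradient_lipschitz_const TYPE('n) n"
  have "(mean_error N x ?Q)\<^sup>2 \<le> \<eta> * energy ?Q ?Q" by (rule disc[OF poly_deg_inner_tgrad[OF P P]])
  also have "\<dots> \<le> \<eta> * (?L * (energy P P)\<^sup>2)"
    by (intro mult_left_mono energy_norm_tgrad_squared_le[OF card P] \<eta>)
  also have "\<dots> = (?L * \<eta>) * (energy P P)\<^sup>2" by simp
  also have "\<dots> \<le> (1 / 4) * (energy P P)\<^sup>2" using \<eta>(2) by (intro mult_right_mono) auto
  also have "\<dots> = (energy P P / 2)\<^sup>2" by (simp add: power_divide)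
  finally have "\<bar>mean_error N x ?Q\<bar> \<le> \<bar>energy P P / 2\<bar>" by (simp only: abs_le_square_iff)
  then have "\<bar>mean_error N x ?Q\<bar> \<le> energy P P / 2" using energy_nonneg[of P] by simp
  moreover have "mean_error N x ?Q = (\<Sum>i<N. (norm (tgrad P (x i)))\<^sup>2) / real N - energy P P"
    by (simp add: mean_error_def energy_def power2_norm_eq_inner)
  ultimately show ?thesis by linarith
qed

text \<open>A curve in the sphere through \<open>x\<close> with velocity \<open>v\<close>, for \<open>v\<close> tangential at \<open>x\<close>: the
  denominator is the norm of \<open>x + t *\<^sub>R v\<close>.\<close>

definition sphere_step :: "real ^ 'n::finite \<Rightarrow> real ^ 'n \<Rightarrow> real \<Rightarrow> real ^ 'n" where
  "sphere_step x v t = (1 / sqrt (1 + t\<^sup>2 * (norm v)\<^sup>2)) *\<^sub>R (x + t *\<^sub>R v)"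

lemma sphere_step_properties:
  assumes x: "norm x = 1" and v: "v \<bullet> x = 0"
  shows "sphere_step x v 0 = x" "norm (sphere_step x v t) = 1"
    "t \<ge> 0 \<Longrightarrow> norm (sphere_step x v t - x) \<le> 2 * t * norm v"
    "(sphere_step x v has_vector_derivative v) (at 0)"
proof -
  define q where "q t = sqrt (1 + t\<^sup>2 * (norm v)\<^sup>2)" for t
  have q1: "q t \<ge> 1" for t unfolding q_def by (simp add: real_le_rsqrt)
  show "sphere_step x v 0 = x" by (simp add: sphere_step_def)
  have "(norm (x + t *\<^sub>R v))\<^sup>2 = 1 + t\<^sup>2 * (norm v)\<^sup>2" for t
    unfolding power2_norm_eq_inner using x v
    by (simp add: inner_add_left inner_add_right inner_commute[of x v] norm_eq_1 power2_eq_square)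
  then have nq: "norm (x + t *\<^sub>R v) = q t" for t unfolding q_def by (metis norm_ge_zero real_sqrt_unique)
  show "norm (sphere_step x v t) = 1"
    using q1[of t] by (simp add: sphere_step_def nq flip: q_def)
  show "norm (sphere_step x v t - x) \<le> 2 * t * norm v" if t: "t \<ge> 0"
  proof -
    have "q t \<le> 1 + t * norm v"
      unfolding q_def using t by (intro real_le_lsqrt) (auto simp: power2_sum power_mult_distrib)
    moreover have "norm (sphere_step x v t - (x + t *\<^sub>R v)) = q t - 1"
    proof -
      have "sphere_step x v t - (x + t *\<^sub>R v) = (1 / q t - 1) *\<^sub>R (x + t *\<^sub>R v)"
        by (simp add: sphere_step_def q_def algebra_simps)
      then have "norm (sphere_step x v t - (x + t *\<^sub>R v)) = \<bar>1 / q t - 1\<bar> * q t" by (simp add: nq)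
      also have "\<dots> = \<bar>(1 / q t - 1) * q t\<bar>" using q1[of t] by (simp add: abs_mult)
      also have "(1 / q t - 1) * q t = 1 - q t" using q1[of t] by (simp add: field_simps)
      finally show ?thesis using q1[of t] by simp
    qed
    moreover have "norm (sphere_step x v t - x) \<le> norm (sphere_step x v t - (x + t *\<^sub>R v)) + norm (t *\<^sub>R v)"
      using norm_triangle_ineq[of "sphere_step x v t - (x + t *\<^sub>R v)" "t *\<^sub>R v"] by (simp add: algebra_simps)
    ultimately show ?thesis using t by simp
  qed
  have "(q has_real_derivative 0) (at 0)"
    unfolding q_def[abs_def] by (auto intro!: derivative_eq_intros)
  then have "((\<lambda>t. 1 / q t) has_real_derivative 0) (at 0)"
    using q1[of 0] by (auto intro!: derivative_eq_intros)
  then have "((\<lambda>t. (1 / q t) *\<^sub>R (x + t *\<^sub>R v)) has_vector_derivative (1 / q 0) *\<^sub>R v + 0 *\<^sub>R (x + 0 *\<^sub>R v)) (at 0)"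
    by (intro has_vector_derivative_scaleR) (auto intro!: derivative_eq_intros simp: has_vector_derivative_def)
  then show "(sphere_step x v has_vector_derivative v) (at 0)"
    by (simp add: sphere_step_def[abs_def] q_def)
qed

lemma poly_deg_sphere_step_derivative:
  assumes "norm x = 1" "v \<bullet> x = 0" "poly_deg m P"
  shows "((\<lambda>t. P (sphere_step x v t)) has_real_derivative grad P x \<bullet> v) (at 0)"
proof -
  have "(sphere_step x v has_derivative (\<lambda>h. h *\<^sub>R v)) (at 0)"
    using sphere_step_properties(4)[OF assms(1,2)] by (simp add: has_vector_derivative_def)
  from has_derivative_compose[OF this poly_deg_has_derivative[OF assms(3)]]
  show ?thesis unfolding has_field_derivative_def sphere_step_properties(1)[OF assms(1,2)]
    by (rule has_derivative_eq_rhs) (simp add: fun_eq_iff mult.commute)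
qed

section \<open>Moving the points to zero mean error\<close>

text \<open>Minimise \<open>J X = err X + \<kappa> * dst X x0\<close> over all \<open>N\<close>-tuples of points of the sphere, where
  \<open>err X\<close> is the norm of the mean error as a functional and \<open>dst\<close> the Euclidean distance of
  tuples.  Comparison with \<open>x0\<close> bounds the distance of a minimiser \<open>X\<close> from \<open>x0\<close>, and since
  gradients are Lipschitz the points \<open>X\<close> still detect the energy.  If \<open>err X\<close> were positive, let
  \<open>P\<close> be the polynomial of energy \<open>1\<close> that represents the mean error, and move all points with
  velocity \<open>- tgrad P\<close>.  With \<open>g\<^sup>2\<close> the average of the squared speeds, \<open>err\<close> then decreases at
  rate \<open>g\<^sup>2\<close> while the penalty grows at rate at most \<open>g / 4\<close>, and \<open>g\<close> is greater than
  \<open>1 / 4\<close>.\<close>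

lemma exists_zero_mean_error:
  fixes x0 :: "nat \<Rightarrow> real ^ 'n::finite"
  assumes card: "CARD('n) \<ge> 2" and N: "N \<ge> 1"
    and x0: "\<And>i. norm (x0 i) = 1"
    and disc: "\<And>Q. poly_deg (n + 2 + (n + 2)) Q \<Longrightarrow> (mean_error N x0 Q)\<^sup>2 \<le> \<eta> * energy Q Q"
    and \<eta>: "\<eta> \<ge> 0" "512 * gradient_lipschitz_const TYPE('n) n * \<eta> \<le> 1"
  obtains X :: "nat \<Rightarrow> real ^ 'n" where "\<And>i. norm (X i) = 1" "\<And>Q. poly_deg n Q \<Longrightarrow> mean_error N X Q = 0"
proof -
  let ?L = "gradient_lipschitz_const TYPE('n) n"
  have L0: "?L \<ge> 0" by (simp add: gradient_lipschitz_const_def nikolskii_const_nonneg)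
  obtain D and e :: "nat \<Rightarrow> real ^ 'n \<Rightarrow> real" where e: "energy_orthonormal n D e"
    and complete: "\<And>P. poly_deg n P \<Longrightarrow> energy (\<lambda>x. P x - (\<Sum>k<D. energy P (e k) * e k x)) (\<lambda>x. P x - (\<Sum>k<D. energy P (e k) * e k x)) = 0"
    by (rule complete_energy_orthonormal[OF card, of n]) blast
  have ek: "poly_deg n (e k)" if "k < D" for k using e that by (simp add: energy_orthonormal_def)
  define err where "err X = L2_set (\<lambda>k. mean_error N X (e k)) {..<D}" for X
  define dst where "dst X Y = L2_set (\<lambda>i. norm (X i - Y i)) {..<N}" for X Y :: "nat \<Rightarrow> real ^ 'n"
  \<comment> \<open>The square root of \<open>N\<close> turns the distance of tuples into a root mean square.\<close>
  define \<kappa> where "\<kappa> = 1 / (8 * sqrt (real N))"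
  have \<kappa>: "\<kappa> > 0" using N by (simp add: \<kappa>_def)
  define J where "J X = err X + \<kappa> * dst X x0" for X
  let ?T = "Pi UNIV (\<lambda>i::nat. sphere (0 :: real ^ 'n) 1)"
  have coord: "continuous_on ?T (\<lambda>X. X i)" for i
    by (rule continuous_on_subset[OF continuous_on_product_coordinates]) simp
  have "compactin (product_topology (\<lambda>i::nat. euclidean) UNIV) (PiE UNIV (\<lambda>i::nat. sphere (0 :: real ^ 'n) 1))"
    unfolding compactin_PiE by simp
  then have compact: "compact ?T" by (simp add: euclidean_product_topology PiE_UNIV_domain)
  have cont: "continuous_on ?T J"
  proof -
    have "continuous_on ?T (\<lambda>X. mean_error N X (e k))" if "k < D" for k
      unfolding mean_error_def
      by (intro continuous_intros continuous_on_compose2[OF poly_deg_continuous[OF ek[OF that], of UNIV] coord]) (use N in auto)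
    then show ?thesis unfolding J_def err_def dst_def L2_set_def
      by (intro continuous_intros coord) auto
  qed
  have two_squares: "(a + b)\<^sup>2 \<le> 2 * a\<^sup>2 + 2 * b\<^sup>2" for a b :: real
    using zero_le_power2[of "a - b"] by (simp add: power2_sum power2_diff)
  have "x0 \<in> ?T" using x0 by auto
  then obtain X where XT: "X \<in> ?T" and min: "\<And>Y. Y \<in> ?T \<Longrightarrow> J X \<le> J Y"
    using continuous_attains_inf[OF compact _ cont] by blast
  have X: "norm (X i) = 1" for i using XT by auto
  have "(\<Sum>k<D. (mean_error N x0 (e k))\<^sup>2) \<le> \<eta>"
  proof (rule energy_orthonormal_functional_bound[OF e \<eta>(1)])
    show "mean_error N x0 (\<lambda>x. \<Sum>k<D. c k * e k x) = (\<Sum>k<D. c k * mean_error N x0 (e k))" for c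
      by (rule mean_error_sum) (rule ek)
    show "(mean_error N x0 P)\<^sup>2 \<le> \<eta> * energy P P" if "poly_deg n P" for P
      by (rule disc, rule poly_deg_mono[OF that]) simp
  qed
  then have err0: "(err x0)\<^sup>2 \<le> \<eta>" by (simp add: err_def L2_set_def sum_nonneg)
  have "J X \<le> J x0" by (rule min) fact
  moreover have "dst x0 x0 = 0" by (simp add: dst_def L2_set_def)
  moreover have "err X \<ge> 0" by (simp add: err_def)
  ultimately have "\<kappa> * dst X x0 \<le> err x0" by (simp add: J_def)
  then have "(\<kappa> * dst X x0)\<^sup>2 \<le> (err x0)\<^sup>2"
    using \<kappa> by (intro power_mono mult_nonneg_nonneg) (auto simp: dst_def)
  then have "(dst X x0)\<^sup>2 / (64 * real N) \<le> \<eta>"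
    using err0 by (simp add: \<kappa>_def power_mult_distrib power_divide)
  then have dst2: "(dst X x0)\<^sup>2 / real N \<le> 64 * \<eta>" by simp
  have zero: "err X = 0"
  proof (rule ccontr)
    assume "err X \<noteq> 0"
    then have r: "err X > 0" using L2_set_nonneg[of _ "{..<D}"] by (simp add: err_def less_le)
    define u where "u k = mean_error N X (e k) / err X" for k
    define P where "P y = (\<Sum>k<D. u k * e k y)" for y
    have P: "poly_deg n P" unfolding P_def by (rule energy_orthonormal_combination(1)[OF e])
    have "(err X)\<^sup>2 = (\<Sum>k<D. (mean_error N X (e k))\<^sup>2)" by (simp add: err_def L2_set_def sum_nonneg)
    moreover have "(\<Sum>k<D. (u k)\<^sup>2) = (\<Sum>k<D. (mean_error N X (e k))\<^sup>2) / (err X)\<^sup>2"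
      by (simp add: u_def power_divide sum_divide_distrib)
    ultimately have "(\<Sum>k<D. (u k)\<^sup>2) = (err X)\<^sup>2 / (err X)\<^sup>2" by simp
    then have "(\<Sum>k<D. (u k)\<^sup>2) = 1" using r by simp
    then have energy1: "energy P P = 1"
      using energy_orthonormal_combination(4)[OF e, of u] by (simp add: P_def[abs_def])
    define v where "v i = - tgrad P (X i)" for i
    have vX: "v i \<bullet> X i = 0" for i by (simp add: v_def tgrad_orthogonal X)
    define V where "V = L2_set (\<lambda>i. norm (v i)) {..<N}"
    have V0: "V \<ge> 0" by (simp add: V_def)
    have V2: "V\<^sup>2 = (\<Sum>i<N. (norm (v i))\<^sup>2)" by (simp add: V_def L2_set_def sum_nonneg)
    \<comment> \<open>At \<open>x0\<close> the average is at least \<open>1 / 2\<close>; passing to \<open>X\<close> costs a factor of two and, by the bound for the distance, at most \<open>1 / 4\<close>.\<close>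
    have large: "V\<^sup>2 / real N \<ge> 1 / 8"
    proof -
      have half: "energy P P / 2 \<le> (\<Sum>i<N. (norm (tgrad P (x0 i)))\<^sup>2) / real N"
      proof (rule energy_le_sampled_gradient[OF card P disc \<eta>(1)])
        show "4 * ?L * \<eta> \<le> 1" using \<eta>(2) mult_nonneg_nonneg[OF L0 \<eta>(1)] by linarith
      qed
      have "(norm (tgrad P (x0 i)))\<^sup>2 \<le> 2 * (norm (v i))\<^sup>2 + 2 * ?L * (norm (X i - x0 i))\<^sup>2" for i
      proof -
        have "norm (tgrad P (x0 i)) \<le> norm (tgrad P (X i)) + norm (tgrad P (X i) - tgrad P (x0 i))"
          using norm_triangle_ineq4[of "tgrad P (X i)" "tgrad P (X i) - tgrad P (x0 i)"] by simp
        then have "(norm (tgrad P (x0 i)))\<^sup>2 \<le> (norm (tgrad P (X i)) + norm (tgrad P (X i) - tgrad P (x0 i)))\<^sup>2"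
          by (rule power_mono) simp
        also have "\<dots> \<le> 2 * (norm (tgrad P (X i)))\<^sup>2 + 2 * (norm (tgrad P (X i) - tgrad P (x0 i)))\<^sup>2"
          by (rule two_squares)
        also have "(norm (tgrad P (X i) - tgrad P (x0 i)))\<^sup>2 \<le> ?L * (norm (X i - x0 i))\<^sup>2"
          using tgrad_lipschitz[OF card P X x0, of i i] by (simp add: energy1)
        finally show ?thesis by (simp only: v_def norm_minus_cancel mult.assoc)
      qed
      then have "(\<Sum>i<N. (norm (tgrad P (x0 i)))\<^sup>2) \<le> (\<Sum>i<N. 2 * (norm (v i))\<^sup>2 + 2 * ?L * (norm (X i - x0 i))\<^sup>2)"
        by (rule sum_mono)
      also have "\<dots> = 2 * V\<^sup>2 + 2 * ?L * (dst X x0)\<^sup>2"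
        unfolding sum.distrib sum_distrib_left[symmetric] V2 by (simp add: dst_def L2_set_def sum_nonneg)
      finally have "(\<Sum>i<N. (norm (tgrad P (x0 i)))\<^sup>2) / real N \<le> (2 * V\<^sup>2 + 2 * ?L * (dst X x0)\<^sup>2) / real N"
        by (intro divide_right_mono) auto
      moreover have "(2 * V\<^sup>2 + 2 * ?L * (dst X x0)\<^sup>2) / real N = 2 * (V\<^sup>2 / real N) + 2 * (?L * ((dst X x0)\<^sup>2 / real N))"
        by (simp add: add_divide_distrib)
      ultimately have "1 / 2 \<le> 2 * (V\<^sup>2 / real N) + 2 * (?L * ((dst X x0)\<^sup>2 / real N))"
        using half unfolding energy1 by linarith
      moreover have "?L * ((dst X x0)\<^sup>2 / real N) \<le> ?L * (64 * \<eta>)" by (rule mult_left_mono[OF dst2 L0])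
      ultimately show ?thesis using \<eta>(2) by linarith
    qed
    define Y where "Y t i = sphere_step (X i) (v i) t" for t i
    have YT: "Y t \<in> ?T" for t unfolding Y_def by (simp add: Pi_iff sphere_step_properties(2)[OF X vX])
    have Y0: "Y 0 = X" by (simp add: fun_eq_iff Y_def sphere_step_properties(1)[OF X vX])
    \<comment> \<open>For \<open>t \<ge> 0\<close> and up to an additive constant, \<open>\<psi> t\<close> is an upper bound of \<open>J (Y t)\<close>, with equality at \<open>0\<close>.\<close>
    define \<psi> where "\<psi> t = err (Y t) + \<kappa> * (2 * t * V)" for t
    have mono: "\<psi> 0 \<le> \<psi> t" if t: "t \<ge> 0" for t
    proof -
      have "dst (Y t) X \<le> L2_set (\<lambda>i. (2 * t) * norm (v i)) {..<N}"
        unfolding dst_def using sphere_step_properties(3)[OF X vX t] by (intro L2_set_mono) (auto simp: Y_def)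
      also have "\<dots> = 2 * t * V" using t by (simp add: V_def L2_set_right_distrib)
      finally have 1: "dst (Y t) X \<le> 2 * t * V" .
      have "dst (Y t) x0 \<le> L2_set (\<lambda>i. norm (Y t i - X i) + norm (X i - x0 i)) {..<N}"
        unfolding dst_def
      proof (rule L2_set_mono)
        fix i
        show "norm (Y t i - x0 i) \<le> norm (Y t i - X i) + norm (X i - x0 i)"
          using norm_triangle_ineq[of "Y t i - X i" "X i - x0 i"] by simp
      qed simp
      also have "\<dots> \<le> dst (Y t) X + dst X x0" unfolding dst_def by (rule L2_set_triangle_ineq)
      finally have "\<kappa> * dst (Y t) x0 \<le> \<kappa> * (2 * t * V + dst X x0)" using 1 \<kappa> by (intro mult_left_mono) auto
      moreover have "J X \<le> J (Y t)" by (rule min[OF YT])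
      ultimately show ?thesis by (simp add: J_def \<psi>_def Y0 algebra_simps)
    qed
    have err_deriv: "((\<lambda>t. err (Y t)) has_real_derivative - (V\<^sup>2 / real N)) (at 0)"
    proof -
      define h' where "h' k = (\<Sum>i<N. grad (e k) (X i) \<bullet> v i) / real N" for k
      have h: "((\<lambda>t. mean_error N (Y t) (e k)) has_real_derivative h' k) (at 0)" if k: "k < D" for k
      proof -
        have "((\<lambda>t. \<Sum>i<N. e k (Y t i)) has_real_derivative (\<Sum>i<N. grad (e k) (X i) \<bullet> v i)) (at 0)"
          unfolding Y_def by (rule DERIV_sum) (rule poly_deg_sphere_step_derivative[OF X vX ek[OF k]])
        from DERIV_diff[OF DERIV_cdivide[OF this, of "real N"] DERIV_const[of "LINT y|sphere_measure. e k y"]]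
        show ?thesis unfolding mean_error_def h'_def by simp
      qed
      have sq: "((\<lambda>t. \<Sum>k<D. (mean_error N (Y t) (e k))\<^sup>2) has_real_derivative (\<Sum>k<D. 2 * mean_error N X (e k) * h' k)) (at 0)"
      proof (rule DERIV_sum)
        fix k assume "k \<in> {..<D}"
        then have "k < D" by simp
        from DERIV_mult[OF h[OF this] h[OF this]]
        show "((\<lambda>t. (mean_error N (Y t) (e k))\<^sup>2) has_real_derivative 2 * mean_error N X (e k) * h' k) (at 0)"
          unfolding Y0 power2_eq_square by (rule DERIV_cong) simp
      qed
      have pos: "(\<Sum>k<D. (mean_error N (Y 0) (e k))\<^sup>2) > 0"
        using r unfolding Y0 err_def L2_set_def by simp
      have "((\<lambda>t. sqrt (\<Sum>k<D. (mean_error N (Y t) (e k))\<^sup>2)) has_real_derivative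
          (inverse (sqrt (\<Sum>k<D. (mean_error N (Y 0) (e k))\<^sup>2)) / 2) * (\<Sum>k<D. 2 * mean_error N X (e k) * h' k)) (at 0)"
        by (rule DERIV_chain2[OF DERIV_real_sqrt[OF pos] sq])
      moreover have "sqrt (\<Sum>k<D. (mean_error N (Y 0) (e k))\<^sup>2) = err X" by (simp add: Y0 err_def L2_set_def)
      moreover have "(inverse (err X) / 2) * (\<Sum>k<D. 2 * mean_error N X (e k) * h' k) = (\<Sum>k<D. u k * h' k)"
        unfolding sum_distrib_left by (intro sum.cong refl) (simp add: u_def inverse_eq_divide)
      moreover have "(\<Sum>k<D. u k * h' k) = - (V\<^sup>2 / real N)"
      proof -
        have tg: "tgrad P y = (\<Sum>k<D. u k *\<^sub>R tgrad (e k) y)" for y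
          unfolding P_def by (subst tgrad_sum[where m = n]) (auto intro!: poly_deg_cmult sum.cong tgrad_cmult ek)
        have "(\<Sum>k<D. u k * h' k) = (\<Sum>k<D. \<Sum>i<N. u k * (tgrad (e k) (X i) \<bullet> v i)) / real N"
          by (simp add: h'_def tgrad_inner[OF vX] sum_distrib_left sum_divide_distrib)
        also have "(\<Sum>k<D. \<Sum>i<N. u k * (tgrad (e k) (X i) \<bullet> v i)) = (\<Sum>i<N. tgrad P (X i) \<bullet> v i)"
          by (subst sum.swap) (simp add: tg inner_sum_left)
        also have "\<dots> = - V\<^sup>2" unfolding V2 by (simp add: v_def power2_norm_eq_inner sum_negf)
        finally show ?thesis by simp
      qed
      ultimately show ?thesis by (simp add: err_def[abs_def] L2_set_def)
    qed
    have "(\<psi> has_real_derivative - (V\<^sup>2 / real N) + \<kappa> * (2 * V)) (at 0)"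
      unfolding \<psi>_def[abs_def] by (auto intro!: derivative_eq_intros err_deriv)
    moreover have "- (V\<^sup>2 / real N) + \<kappa> * (2 * V) < 0"
    proof -
      define g where "g = V / sqrt (real N)"
      have g2: "g\<^sup>2 = V\<^sup>2 / real N" by (simp add: g_def power_divide)
      have "(1 / 4)\<^sup>2 < g\<^sup>2" 
      proof -
        have "(1 / 4)\<^sup>2 < (1 / 8 :: real)" by (simp add: power2_eq_square)
        also have "\<dots> \<le> g\<^sup>2" unfolding g2 by (rule large)
        finally show ?thesis .
      qed
      moreover have "g \<ge> 0" using V0 by (simp add: g_def)
      ultimately have g: "1 / 4 < g" by (rule power_less_imp_less_base)
      have "- (V\<^sup>2 / real N) + \<kappa> * (2 * V) = - (g * (g - 1 / 4))"
        unfolding g2[symmetric] by (simp add: g_def \<kappa>_def power2_eq_square algebra_simps)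
      then show ?thesis using g by (simp add: mult_pos_pos)
    qed
    ultimately obtain d where d: "d > 0" "\<And>h. 0 < h \<Longrightarrow> h < d \<Longrightarrow> \<psi> (0 + h) < \<psi> 0"
      using DERIV_neg_dec_right[of \<psi> _ 0] by blast
    have "\<psi> (0 + d / 2) < \<psi> 0" using d(1) by (intro d(2)) auto
    moreover have "\<psi> 0 \<le> \<psi> (0 + d / 2)" using d(1) by (intro mono) auto
    ultimately show False by simp
  qed
  show ?thesis
  proof (rule that[OF X])
    fix Q :: "real ^ 'n \<Rightarrow> real" assume Q: "poly_deg n Q"
    have "mean_error N X Q = (\<Sum>k<D. energy Q (e k) * mean_error N X (e k))"
      by (rule mean_error_expansion(1)[OF card N X e Q complete[OF Q]])
    also have "\<dots> = 0" using zero by (intro sum.neutral) (auto simp: err_def L2_set_eq_0_iff)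
    finally show "mean_error N X Q = 0" .
  qed
qed

lemma spherical_design_of_mean_error:
  fixes X :: "nat \<Rightarrow> real ^ 'n::finite"
  assumes "\<And>i. norm (X i) = 1" "\<And>Q. poly_deg n Q \<Longrightarrow> mean_error N X Q = 0"
  shows "spherical_design n N (\<lambda>i. X (i - 1))"
  unfolding spherical_design_def
proof (intro conjI ballI)
  fix P :: "real ^ 'n \<Rightarrow> real" assume "P \<in> polynomials_le n"
  then have "mean_error N X P = 0" by (intro assms(2) poly_deg_polynomials_le)
  moreover have "(\<Sum>i=1..N. P (X (i - 1))) = (\<Sum>i<N. P (X i))"
    by (rule sum.reindex_bij_witness[of _ Suc "\<lambda>i. i - 1"]) auto
  ultimately show "(LINT y|sphere_measure. P y) = (1 / real N) * (\<Sum>i=1..N. P (X (i - 1)))"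
    by (simp add: mean_error_def)
qed (simp add: assms(1))

text \<open>Points with small mean error for polynomials of degree \<open>2 n + 4\<close>, the degree of
  \<open>norm (tgrad P x)\<close> squared, are the starting point of the minimisation.\<close>

lemma exists_spherical_design:
  assumes card: "CARD('n::finite) \<ge> 2" and N: "N \<ge> 1"
    and small: "512 * gradient_lipschitz_const TYPE('n) n * discrepancy_const TYPE('n) (n + 2 + (n + 2)) N \<le> 1"
  shows "\<exists>x :: nat \<Rightarrow> real ^ 'n. spherical_design n N x"
proof -
  obtain x :: "nat \<Rightarrow> real ^ 'n" where x: "\<And>i. i < N \<Longrightarrow> norm (x i) = 1"
    and disc: "\<And>Q. poly_deg (n + 2 + (n + 2)) Q \<Longrightarrow>
      (mean_error N x Q)\<^sup>2 \<le> discrepancy_const TYPE('n) (n + 2 + (n + 2)) N * energy Q Q"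
    by (rule exists_points_small_mean_error[OF card N, of "n + 2 + (n + 2)"]) blast
  \<comment> \<open>Compactness of the set of tuples needs a point of the sphere at every index.\<close>
  define x0 where "x0 i = (if i < N then x i else x 0)" for i
  have x0: "norm (x0 i) = 1" for i using x N by (simp add: x0_def)
  have "mean_error N x0 Q = mean_error N x Q" for Q by (simp add: mean_error_def x0_def)
  then have disc0: "(mean_error N x0 Q)\<^sup>2 \<le> discrepancy_const TYPE('n) (n + 2 + (n + 2)) N * energy Q Q"
    if "poly_deg (n + 2 + (n + 2)) Q" for Q using disc[OF that] by simp
  have "discrepancy_const TYPE('n) (n + 2 + (n + 2)) N \<ge> 0"
    by (simp add: discrepancy_const_def nikolskii_const_nonneg)
  then obtain X :: "nat \<Rightarrow> real ^ 'n" where "\<And>i. norm (X i) = 1" "\<And>Q. poly_deg n Q \<Longrightarrow> mean_error N X Q = 0"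
    using exists_zero_mean_error[OF card N x0 disc0 _ small] by blast
  then show ?thesis using spherical_design_of_mean_error by blast
qed

text \<open>The quantity that has to be small for the minimisation to work, as a function of \<open>n\<close> and \<open>N\<close>.\<close>

lemma sampling_constants_le:
  assumes d: "d \<ge> 1" and card: "CARD('n::finite) = d + 1"
  obtains C :: real where "C > 0"
    "\<And>n N. n \<ge> 1 \<Longrightarrow> N \<ge> 1 \<Longrightarrow> gradient_lipschitz_const TYPE('n) n * discrepancy_const TYPE('n) (n + 2 + (n + 2)) N
      \<le> C * real n ^ (2 * d + 2) * real N powr (- (1 + 2 / real d))"
proof -
  define A where "A = (64::real) ^ (d + 1)"
  define B where "B = (2 * 8 ^ (d + 1)) powr (1 / real d)"
  define C where "C = 16 * 9 * (A * 3 ^ d) * real (d + 1) * (4 * (A * 8 ^ d) * (144 * B\<^sup>2))"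
  have pos: "A > 0" "B > 0" by (auto simp: A_def B_def)
  show ?thesis
  proof (rule that[of C])
    show "C > 0" using pos by (simp add: C_def)
    fix n N :: nat assume n: "n \<ge> 1" and N: "N \<ge> 1"
    have n3: "real (n + 2) \<le> 3 * real n" and n8: "real (n + 2 + (n + 2) + 2) \<le> 8 * real n" using n by auto
    have p2: "(real (n + 2))\<^sup>2 \<le> (3 * real n)\<^sup>2" by (rule power_mono[OF n3]) simp
    have p3: "real (n + 2) ^ d \<le> (3 * real n) ^ d" by (rule power_mono[OF n3]) simp
    have p8: "real (n + 2 + (n + 2) + 2) ^ d \<le> (8 * real n) ^ d" by (rule power_mono[OF n8]) simp
    have cell: "(cell_radius TYPE('n) N)\<^sup>2 / real N = 144 * B\<^sup>2 * real N powr (- (1 + 2 / real d))"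
    proof -
      have "cell_radius TYPE('n) N = 12 * (B * real N powr (- (1 / real d)))"
      proof -
        have "(2 * 8 ^ (d + 1) / real N) powr (1 / real d) = B / real N powr (1 / real d)"
          unfolding B_def by (rule powr_divide)
        then show ?thesis by (simp add: cell_radius_def card powr_minus_divide)
      qed
      then have "(cell_radius TYPE('n) N)\<^sup>2 = 144 * B\<^sup>2 * (real N powr (- (1 / real d)))\<^sup>2"
        by (simp add: power_mult_distrib)
      also have "(real N powr (- (1 / real d)))\<^sup>2 = real N powr (- (2 / real d))"
        by (simp add: power2_eq_square flip: powr_add)
      finally have "(cell_radius TYPE('n) N)\<^sup>2 / real N = 144 * B\<^sup>2 * (real N powr (- (2 / real d)) * real N powr (- 1))"
        using N by (simp add: powr_minus divide_inverse)
      also have "real N powr (- (2 / real d)) * real N powr (- 1) = real N powr (- (1 + 2 / real d))"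
        unfolding powr_add[symmetric] by (rule arg_cong[where f = "\<lambda>z. real N powr z"]) simp
      finally show ?thesis .
    qed
    have "gradient_lipschitz_const TYPE('n) n \<le> 16 * (3 * real n)\<^sup>2 * (A * (3 * real n) ^ d) * real (d + 1)"
      unfolding gradient_lipschitz_const_def nikolskii_const_def card A_def add_diff_cancel_right'
      by (intro mult_mono p2 p3 order_refl) auto
    moreover have "discrepancy_const TYPE('n) (n + 2 + (n + 2)) N \<le>
        4 * (A * (8 * real n) ^ d) * (144 * B\<^sup>2 * real N powr (- (1 + 2 / real d)))"
      unfolding discrepancy_const_def times_divide_eq_right[symmetric] cell nikolskii_const_def card A_def add_diff_cancel_right'
      by (intro mult_mono p8 order_refl) auto
    ultimately have "gradient_lipschitz_const TYPE('n) n * discrepancy_const TYPE('n) (n + 2 + (n + 2)) N \<le>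
       (16 * (3 * real n)\<^sup>2 * (A * (3 * real n) ^ d) * real (d + 1)) *
       (4 * (A * (8 * real n) ^ d) * (144 * B\<^sup>2 * real N powr (- (1 + 2 / real d))))"
      using pos by (intro mult_mono) (auto simp: discrepancy_const_def nikolskii_const_nonneg)
    also have "\<dots> = C * ((real n)\<^sup>2 * (real n ^ d * real n ^ d)) * real N powr (- (1 + 2 / real d))"
      by (simp add: C_def power_mult_distrib)
    also have "(real n)\<^sup>2 * (real n ^ d * real n ^ d) = real n ^ (2 * d + 2)"
      by (simp add: power_add mult_2 power2_eq_square)
    finally show "gradient_lipschitz_const TYPE('n) n * discrepancy_const TYPE('n) (n + 2 + (n + 2)) N
      \<le> C * real n ^ (2 * d + 2) * real N powr (- (1 + 2 / real d))" .
  qed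
qed

text \<open>The quantity just bounded is at most \<open>1 / 512\<close> once \<open>N powr (1 + 2 / d)\<close> exceeds a constant times
  \<open>n ^ (2 * d + 2)\<close>; taking roots gives the exponent \<open>2 * d * (d + 1) / (d + 2)\<close>.\<close>

theorem theorem1:
  fixes d :: nat
  assumes "d \<ge> 1" and "CARD('n::finite) = d + 1"
  shows "\<exists>c::real. c > 0 \<and>
    (\<forall>n N :: nat. n \<ge> 1 \<longrightarrow> N \<ge> 1 \<longrightarrow>
       real N \<ge> c * real n powr (2 * real d * (real d + 1) / (real d + 2)) \<longrightarrow>
       (\<exists>x :: nat \<Rightarrow> real ^ 'n. spherical_design n N x))"
proof -
  obtain C :: real where C: "C > 0"
    and bound: "\<And>n N. n \<ge> 1 \<Longrightarrow> N \<ge> 1 \<Longrightarrow> gradient_lipschitz_const TYPE('n) n * discrepancy_const TYPE('n) (n + 2 + (n + 2)) N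
      \<le> C * real n ^ (2 * d + 2) * real N powr (- (1 + 2 / real d))"
    by (rule sampling_constants_le[OF assms]) blast
  define p where "p = 1 + 2 / real d"
  have d: "real d > 0" using assms(1) by simp
  have p: "p > 0" using d by (simp add: p_def add_pos_nonneg)
  define c where "c = (512 * C) powr (1 / p)"
  have exponent: "2 * real d * (real d + 1) / (real d + 2) * p = real (2 * d + 2)"
  proof -
    have "p = (real d + 2) / real d" using d by (simp add: p_def add_divide_distrib)
    moreover have "real d + 2 \<noteq> 0" using d by linarith
    ultimately show ?thesis using d by simp
  qed
  show ?thesis
  proof (intro exI[of _ c] conjI allI impI)
    show "c > 0" using C by (simp add: c_def)
    fix n N :: nat
    assume n: "n \<ge> 1" and N: "N \<ge> 1" and large: "c * real n powr (2 * real d * (real d + 1) / (real d + 2)) \<le> real N"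
    have "512 * C * real n ^ (2 * d + 2) = c powr p * (real n powr (2 * real d * (real d + 1) / (real d + 2))) powr p"
    proof -
      have "c powr p = 512 * C" using C p by (simp add: c_def powr_powr)
      moreover have "(real n powr (2 * real d * (real d + 1) / (real d + 2))) powr p = real n ^ (2 * d + 2)"
        unfolding powr_powr exponent using n by (intro powr_realpow) simp
      ultimately show ?thesis by simp
    qed
    also have "\<dots> = (c * real n powr (2 * real d * (real d + 1) / (real d + 2))) powr p"
      by (subst powr_mult) (auto simp: c_def)
    also have "\<dots> \<le> real N powr p"
      using p by (intro powr_mono2 large) (auto simp: c_def)
    finally have le: "512 * C * real n ^ (2 * d + 2) \<le> real N powr p" .
    have "512 * gradient_lipschitz_const TYPE('n) n * discrepancy_const TYPE('n) (n + 2 + (n + 2)) N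
        \<le> 512 * (C * real n ^ (2 * d + 2) * real N powr (- p))"
      using bound[OF n N] by (simp add: p_def)
    also have "\<dots> = (512 * C * real n ^ (2 * d + 2)) * real N powr (- p)" by simp
    also have "\<dots> \<le> real N powr p * real N powr (- p)" by (rule mult_right_mono[OF le]) simp
    also have "\<dots> = 1" using N by (simp flip: powr_add)
    finally show "\<exists>x :: nat \<Rightarrow> real ^ 'n. spherical_design n N x"
      using assms by (intro exists_spherical_design N) auto
  qed
qed

end
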